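(* Assume that $\mu,\nu$ are probability measures on $\mathbb{R}$ with $\mu\preceq_C\nu$ (convex order) and that $c:\mathbb{R}^2\to\mathbb{R}$ is a Borel measurable cost function satisfying the sufficient integrability condition with respect to $\mu,\nu$. Assume that $\pi\in\Pi_M(\mu,\nu)$ is an optimal martingale transport plan (it minimizes $\pi'\mapsto\iint c\,d\pi'$ over $\Pi_M(\mu,\nu)$) which leads to finite costs, $\iint c\,d\pi<\infty$. Then there exists a Borel set $\Gamma\subseteq\mathbb{R}^2$ with $\pi(\Gamma)=1$ such that the following holds: if $\alpha$ is a (finite, nonnegative) measure on $\mathbb{R}\times\mathbb{R}$ with finite support $\operatorname{spt}(\alpha)\subseteq\Gamma$, then $\int c\,d\alpha\le\int c\,d\alpha'$ for every competitor $\alpha'$ of $\alpha$.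
   Context: Convex order: two finite Borel measures $\mu,\nu$ on $\mathbb{R}$ with finite first moments satisfy $\mu\preceq_C\nu$ if $\int\varphi\,d\mu\le\int\varphi\,d\nu$ for every convex $\varphi:\mathbb{R}\to\mathbb{R}$. $\Pi_M(\mu,\nu)$ (martingale transport plans) is the set of Borel measures $\pi$ on $\mathbb{R}\times\mathbb{R}$ with first marginal $\mu$, second marginal $\nu$, whose disintegration $(\pi_x)_{x\in\mathbb{R}}$ into probability measures with respect to $\mu$ satisfies $\int y\,d\pi_x(y)=x$ for $\mu$-a.e. $x$. Sufficient integrability condition: $c(x,y)\ge a(x)+b(y)$ for all $x,y$, where $a$ is $\mu$-integrable and $b$ is $\nu$-integrable. Competitor: let $\alpha$ be a measure on $\mathbb{R}\times\mathbb{R}$ with finite first moment in the second variable. A measure $\alpha'$ on $\mathbb{R}\times\mathbb{R}$ is a competitor of $\alpha$ if $\alpha'$ has the same two marginals as $\alpha$ and for $(\mathrm{proj}^x_\#\alpha)$-a.e. $x$ one has $\int y\,d\alpha_x(y)=\int y\,d\alpha'_x(y)$, where $(\alpha_x)$, $(\alpha'_x)$ are the disintegrations of $\alpha,\alpha'$ with respect to the common first marginal $\mathrm{proj}^x_\#\alpha$. *)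

theory Defs
  imports "HOL-Probability.Probability"
begin

text \<open>
  The integral of a real function with values in the extended reals: positive part minus negative
  part. (The library's \<^term>\<open>lebesgue_integral\<close> is 0 when the function is not integrable, so it cannot
  be used for integrals that may be infinite.) All integrands below are bounded from below by
  an integrable function or are integrated against a finite measure with finite support, so that
  the meaningless case \<open>\<infinity> - \<infinity>\<close> does not arise.
\<close>

definition ext_integral :: "'a measure \<Rightarrow> ('a \<Rightarrow> real) \<Rightarrow> ereal" where
  "ext_integral M f =
     enn2ereal (\<integral>\<^sup>+z. ennreal (f z) \<partial>M) - enn2ereal (\<integral>\<^sup>+z. ennreal (- f z) \<partial>M)"

definition finite_first_moment :: "real measure \<Rightarrow> bool" where
  "finite_first_moment \<mu> \<longleftrightarrow> sets \<mu> = sets borel \<and> finite_measure \<mu> \<and> integrable \<mu> (\<lambda>x. x)"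

definition convex_order :: "real measure \<Rightarrow> real measure \<Rightarrow> bool" where
  "convex_order \<mu> \<nu> \<longleftrightarrow>
     finite_first_moment \<mu> \<and> finite_first_moment \<nu> \<and>
     (\<forall>\<phi>::real \<Rightarrow> real. convex_on UNIV \<phi> \<longrightarrow> ext_integral \<mu> \<phi> \<le> ext_integral \<nu> \<phi>)"

abbreviation fst_marginal :: "(real \<times> real) measure \<Rightarrow> real measure" where
  "fst_marginal \<pi> \<equiv> distr \<pi> borel fst"

abbreviation snd_marginal :: "(real \<times> real) measure \<Rightarrow> real measure" where
  "snd_marginal \<pi> \<equiv> distr \<pi> borel snd"

text \<open>
  \<open>\<kappa>\<close> is a measurable family of Borel probability measures with
  \<open>\<pi>(dx, dy) = \<kappa> x (dy) \<pi>\<^sub>1(dx)\<close>, where \<open>\<pi>\<^sub>1\<close> is the first marginal of \<open>\<pi>\<close>. For finite \<open>\<pi>\<close> such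
  a family exists and is unique up to a null set of the first marginal; hence it does not matter
  whether the properties of the disintegration below are required of some or of every such family.
\<close>

definition disintegration :: "(real \<times> real) measure \<Rightarrow> (real \<Rightarrow> real measure) \<Rightarrow> bool" where
  "disintegration \<pi> \<kappa> \<longleftrightarrow>
     \<kappa> \<in> borel \<rightarrow>\<^sub>M prob_algebra borel \<and>
     (\<forall>E\<in>sets borel. emeasure \<pi> E = (\<integral>\<^sup>+x. emeasure (\<kappa> x) {y. (x, y) \<in> E} \<partial>fst_marginal \<pi>))"

definition martingale_plans :: "real measure \<Rightarrow> real measure \<Rightarrow> (real \<times> real) measure set" where
  "martingale_plans \<mu> \<nu> =
     {\<pi>. sets \<pi> = sets borel \<and> fst_marginal \<pi> = \<mu> \<and> snd_marginal \<pi> = \<nu> \<and>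
         (\<exists>\<kappa>. disintegration \<pi> \<kappa> \<and>
              (AE x in \<mu>. integrable (\<kappa> x) (\<lambda>y. y) \<and> (\<integral>y. y \<partial>\<kappa> x) = x))}"

definition sufficient_integrability ::
    "real measure \<Rightarrow> real measure \<Rightarrow> (real \<times> real \<Rightarrow> real) \<Rightarrow> bool" where
  "sufficient_integrability \<mu> \<nu> c \<longleftrightarrow>
     (\<exists>a b. integrable \<mu> a \<and> integrable \<nu> b \<and> (\<forall>x y. c (x, y) \<ge> a x + b y))"

definition optimal_martingale_plan ::
    "real measure \<Rightarrow> real measure \<Rightarrow> (real \<times> real \<Rightarrow> real) \<Rightarrow> (real \<times> real) measure \<Rightarrow> bool" where
  "optimal_martingale_plan \<mu> \<nu> c \<pi> \<longleftrightarrow>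
     \<pi> \<in> martingale_plans \<mu> \<nu> \<and>
     (\<forall>\<pi>'\<in>martingale_plans \<mu> \<nu>. ext_integral \<pi> c \<le> ext_integral \<pi>' c)"

text \<open>The second component of \<open>\<alpha>\<close> is required to have a finite first moment; by equality of the
  marginals the same then holds for \<open>\<alpha>'\<close>.\<close>

definition competitor :: "(real \<times> real) measure \<Rightarrow> (real \<times> real) measure \<Rightarrow> bool" where
  "competitor \<alpha> \<alpha>' \<longleftrightarrow>
     sets \<alpha> = sets borel \<and> integrable \<alpha> snd \<and> sets \<alpha>' = sets borel \<and>
     fst_marginal \<alpha>' = fst_marginal \<alpha> \<and> snd_marginal \<alpha>' = snd_marginal \<alpha> \<and>
     (\<exists>\<kappa> \<kappa>'. disintegration \<alpha> \<kappa> \<and> disintegration \<alpha>' \<kappa>' \<and>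
        (AE x in fst_marginal \<alpha>.
           integrable (\<kappa> x) (\<lambda>y. y) \<and> integrable (\<kappa>' x) (\<lambda>y. y) \<and>
           (\<integral>y. y \<partial>\<kappa> x) = (\<integral>y. y \<partial>\<kappa>' x)))"

definition spt :: "'a::topological_space measure \<Rightarrow> 'a set" where
  "spt M = {z. \<forall>U. open U \<and> z \<in> U \<longrightarrow> emeasure M U > 0}"

end

theory Submission
  imports Defs
begin

text \<open>
  Fix a finite pattern \<open>S\<close> of grid points and call a configuration (points \<open>x\<^sub>i\<close>, \<open>y\<^sub>j\<close>, weights \<open>w\<^sub>i\<^sub>j\<close> of
  \<open>\<alpha>\<close> on \<open>S\<close>, weights \<open>v\<^sub>i\<^sub>j\<close> of a competitor) improvable if the competitor is strictly cheaper. Either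
  there is a \<open>\<pi>\<close>-null set \<open>N\<close> such that every improvable configuration has one of its points
  \<open>(x\<^sub>i, y\<^sub>j)\<close>, \<open>(i, j) \<in> S\<close>, in \<open>N\<close>, or there is a probability measure \<open>\<eta>\<close> on improvable configurations
  for which the laws of these points are dominated by a multiple of \<open>\<pi>\<close>. In the second case the
  mixtures \<open>\<omega> \<le> \<pi>\<close> of the \<open>\<alpha>\<close>'s and \<open>\<omega>'\<close> of the competitors make \<open>\<pi> - \<omega> + \<omega>'\<close> a martingale plan which
  is cheaper than \<open>\<pi>\<close>. So the first case holds for each of the countably many patterns, and \<open>\<Gamma>\<close> is the
  complement of the union of the null sets.

  The dichotomy (a form of Kellerer's theorem) is proved like Choquet's capacitability theorem for the
  cost \<open>inf \<integral> f\<^sup>2 d\<pi>\<close> of covering a set of configurations by \<open>\<Sum>\<^sub>s f (p\<^sub>s) \<ge> 1\<close>: this cost is continuous along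
  increasing sequences, so a Borel set of positive cost contains a compact set of positive cost, and
  there linear duality gives \<open>\<eta>\<close>. Since the weights belong to the configuration, no measurable
  selection of competitors is needed.
\<close>

text \<open>Optimality speaks only of \<pi>, while the claim compares infinitely many finite
  measures with their competitors. A single improvement has no weight under \<pi>; it contradicts
  optimality only after being averaged into a positive amount of mass. Four choices make this work.
  Equal marginals force a competitor of a finitely supported measure onto the grid spanned by the
  support, so a configuration has finitely many real entries and can be coded by one sequence.
  Rescaling to weights at most 1 turns a bound on the laws of the points into
  \<open>\<omega> \<le> \<pi>\<close>. The martingale property is tested by integrals of
  \<open>indicator A x * y\<close>, which are linear in the plan and hence easily followed through
  the exchange of mass. Finally, the dual measure is a limit of empirical measures taken on the real
  line, where a tight sequence has a weakly convergent subsequence; this is why compact boxes of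
  sequences are parametrised by compact sets of reals.\<close>

section \<open>Analytic sets\<close>

text \<open>The parameters are real sequences rather than sequences of natural numbers: bounding the
  coordinates one after the other again leaves a compact box.\<close>

definition analytic :: "'a::t2_space set \<Rightarrow> bool" where
  "analytic A \<longleftrightarrow> (\<exists>(D :: (nat \<Rightarrow> real) set) g. closed D \<and> continuous_on D g \<and> A = g ` D)"

lemma continuous_on_reindex:
  "continuous_on S (\<lambda>(e :: 'a \<Rightarrow> 'b::topological_space) i. e (h i))"
  by (intro continuous_on_coordinatewise_then_product continuous_on_subset[OF continuous_on_product_coordinates]) auto

lemma closed_reindex_vimage:
  fixes D :: "('a \<Rightarrow> 'b::topological_space) set"
  assumes "closed D" shows "closed ((\<lambda>e i. e (h i)) -` D)"
  using continuous_on_reindex[of UNIV h] assms continuous_on_closed_vimage[OF closed_UNIV] by (metis inf_top.right_neutral)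

lemma analytic_closed: "closed (D :: (nat \<Rightarrow> real) set) \<Longrightarrow> analytic D"
  unfolding analytic_def by (intro exI[of _ D] exI[of _ "\<lambda>x. x"]) auto

lemma continuous_on_coordinate: "continuous_on S (\<lambda>e :: 'a \<Rightarrow> 'b::topological_space. e i)"
  by (rule continuous_on_subset[OF continuous_on_product_coordinates]) auto

text \<open>Coordinate 0 of a parameter holds the index \<open>k\<close>, the shifted sequence a
  parameter for \<open>A k\<close>. An integer-valued coordinate keeps the pieces apart, so the
  glued domain stays closed and the glued map continuous.\<close>

lemma analytic_UN:
  fixes A :: "nat \<Rightarrow> 'a::t2_space set"
  assumes "\<And>k. analytic (A k)"
  shows "analytic (\<Union>k. A k)"
proof -
  obtain D :: "nat \<Rightarrow> (nat \<Rightarrow> real) set" and g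
    where D: "\<And>k. closed (D k)" "\<And>k. continuous_on (D k) (g k)" "\<And>k. A k = g k ` D k"
    using assms unfolding analytic_def by metis
  define sh where "sh = (\<lambda>(e :: nat \<Rightarrow> real) i. e (Suc i))"
  have cont_sh: "continuous_on S sh" for S
    unfolding sh_def by (rule continuous_on_reindex)
  define F where "F n = {e. e 0 = real n} \<inter> sh -` D n" for n
  define E where "E = (\<Union>n. F n)"
  define G where "G = (\<lambda>e. g (nat \<lfloor>e 0\<rfloor>) (sh e))"
  have clF: "closed (F n)" for n
    unfolding F_def using closed_reindex_vimage[OF D(1)[of n], of Suc]
    by (intro closed_Int closed_Collect_eq continuous_on_coordinate) (auto simp: sh_def)
  \<comment> \<open>The pieces \<open>F n\<close> are locally finite: below \<open>N\<close> only
    those with \<open>n < N\<close> occur, so each open set on the right loses just finitely many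
    closed ones.\<close>
  have "- E = (\<Union>N. {e. e 0 < real N} - (\<Union>n<N. F n))"
  proof (intro equalityI subsetI)
    fix e assume "e \<in> - E"
    moreover obtain N where "e 0 < real N" using reals_Archimedean2 by blast
    ultimately show "e \<in> (\<Union>N. {e. e 0 < real N} - (\<Union>n<N. F n))" by (auto simp: E_def)
  qed (auto simp: E_def F_def)
  also have "open \<dots>"
    using clF by (intro open_UN ballI open_Diff open_Collect_less continuous_on_coordinate closed_UN) auto
  finally have "closed E" by (simp add: closed_def)
  moreover have "continuous_on E G"
    unfolding continuous_on_eq_continuous_within
  proof
    fix e assume "e \<in> E"
    then obtain n where n: "e 0 = real n" by (auto simp: E_def F_def)
    \<comment> \<open>The only natural number at distance less than 1 from \<open>n\<close> is
      \<open>n\<close>, so near \<open>e\<close> the glued map is the single map \<open>g n\<close>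
      after the shift.\<close>
    let ?U = "{\<tau> :: nat \<Rightarrow> real. \<tau> 0 < real n + 1} \<inter> {\<tau>. real n - 1 < \<tau> 0}"
    have op: "open ?U"
      by (intro open_Int open_Collect_less continuous_on_coordinate continuous_on_const)
    have U: "\<tau> 0 = real n \<and> sh \<tau> \<in> D n" if t: "\<tau> \<in> E \<inter> ?U" for \<tau>
    proof -
      obtain m where m: "\<tau> 0 = real m" "sh \<tau> \<in> D m" using t unfolding E_def F_def by blast
      moreover have "m = n" using t m(1) by auto
      ultimately show ?thesis by simp
    qed
    have "continuous_on (E \<inter> ?U) (\<lambda>\<tau>. g n (sh \<tau>))"
      by (rule continuous_on_compose2[OF D(2)[of n] cont_sh]) (use U in auto)
    then have "continuous_on (E \<inter> ?U) G"
      by (rule continuous_on_eq) (use U in \<open>force simp: G_def\<close>)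
    with \<open>e \<in> E\<close> n have "continuous (at e within E \<inter> ?U) G"
      by (auto simp: continuous_on_eq_continuous_within)
    moreover have "at e within E \<inter> ?U = at e within E"
      using op n by (intro at_within_nhd[of _ ?U]) auto
    ultimately show "continuous (at e within E) G" by (simp add: continuous_within)
  qed
  moreover have "(\<Union>k. A k) = G ` E"
  proof (intro equalityI subsetI)
    fix x assume "x \<in> (\<Union>k. A k)"
    then obtain k e where "e \<in> D k" "x = g k e" using D(3) by auto
    then have "case_nat (real k) e \<in> E" "x = G (case_nat (real k) e)"
      by (auto simp: E_def F_def G_def sh_def)
    then show "x \<in> G ` E" by blast
  next
    fix x assume "x \<in> G ` E"
    then obtain e k where "e \<in> F k" "x = G e" by (auto simp: E_def)
    then have "x \<in> A k" by (auto simp: F_def G_def D(3))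
    then show "x \<in> (\<Union>k. A k)" by blast
  qed
  ultimately show ?thesis unfolding analytic_def by blast
qed

text \<open>A fibre product: pairing of indices lets one sequence code a parameter for every
  \<open>A k\<close>, and exactly those codes are kept whose images coincide. This condition is
  closed because the diagonal of a Hausdorff space is.\<close>

lemma analytic_INT:
  fixes A :: "nat \<Rightarrow> 'a::t2_space set"
  assumes "\<And>k. analytic (A k)"
  shows "analytic (\<Inter>k. A k)"
proof -
  obtain D :: "nat \<Rightarrow> (nat \<Rightarrow> real) set" and g
    where D: "\<And>k. closed (D k)" "\<And>k. continuous_on (D k) (g k)" "\<And>k. A k = g k ` D k"
    using assms unfolding analytic_def by metis
  define r where "r k e = (\<lambda>i. e (prod_encode (k, i)))" for k and e :: "nat \<Rightarrow> real"
  have cont_r: "continuous_on S (r k)" for S k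
    unfolding r_def by (rule continuous_on_reindex)
  have cl: "closed (r k -` D k)" for k
    using closed_reindex_vimage[OF D(1)] unfolding r_def .
  define E0 where "E0 = (\<Inter>k. r k -` D k)"
  have E0: "closed E0" unfolding E0_def using cl by auto
  define G where "G k e = g k (r k e)" for k e
  have cG: "continuous_on E0 (G k)" for k
    unfolding G_def by (rule continuous_on_compose2[OF D(2) cont_r]) (auto simp: E0_def)
  define E where "E = (\<Inter>k. {e\<in>E0. G k e = G 0 e})"
  have "closed {e\<in>E0. G k e = G 0 e}" for k
  proof -
    have "closed (E0 \<inter> (\<lambda>e. (G k e, G 0 e)) -` {z. fst z = snd z})"
      using closed_diagonal[where 'a='a] cG
      by (intro continuous_closed_preimage continuous_on_Pair E0) (auto simp: case_prod_beta' closed_Collect_eq continuous_on_fst continuous_on_snd)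
    then show ?thesis by (simp add: Int_def)
  qed
  then have "closed E" unfolding E_def by auto
  moreover have "continuous_on E (G 0)" by (rule continuous_on_subset[OF cG]) (auto simp: E_def)
  moreover have "(\<Inter>k. A k) = G 0 ` E"
  proof (intro equalityI subsetI)
    fix x assume "x \<in> (\<Inter>k. A k)"
    then have "\<forall>k. \<exists>e\<in>D k. x = g k e" using D(3) by auto
    then obtain s where s: "\<And>k. s k \<in> D k" "\<And>k. x = g k (s k)" by metis
    define e where "e n = s (fst (prod_decode n)) (snd (prod_decode n))" for n
    have r: "r k e = s k" for k unfolding r_def e_def by simp
    have "e \<in> E" unfolding E_def E0_def G_def by (auto simp: r s(1) s(2)[symmetric])
    moreover have "x = G 0 e" by (simp add: G_def r s(2)[symmetric])
    ultimately show "x \<in> G 0 ` E" by blast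
  next
    fix x assume "x \<in> G 0 ` E"
    then obtain e where s: "e \<in> E" "x = G 0 e" by auto
    show "x \<in> (\<Inter>k. A k)"
    proof
      fix k
      have "G k e = G 0 e" "r k e \<in> D k" using s(1) by (auto simp: E_def E0_def)
      then show "x \<in> A k" using D(3)[of k] s(2) by (metis G_def image_eqI)
    qed
  qed
  ultimately show ?thesis unfolding analytic_def by blast
qed

text \<open>Analytic sets are not stable under complements, so the induction over the sigma-algebra
  carries the complement along. It starts because an open set is a countable union of closed
  sets.\<close>

lemma analytic_borel:
  fixes A :: "(nat \<Rightarrow> real) set"
  assumes "A \<in> sets borel"
  shows "analytic A"
proof -
  have *: "analytic A \<and> analytic (- A)" if "A \<in> sigma_sets UNIV {S :: (nat \<Rightarrow> real) set. closed S}" for A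
    using that
  proof induction
    case (Basic S)
    then have "fsigma_in euclidean (- S)"
      by (intro open_imp_fsigma_in metrizable_space_euclidean) auto
    then obtain C :: "nat \<Rightarrow> _" where "\<And>n. closed (C n)" "(\<Union>n. C n) = - S"
      unfolding fsigma_in_ascending by auto
    then show ?case using Basic analytic_closed analytic_UN[of C] by auto
  next
    case Empty
    then show ?case by (auto intro: analytic_closed)
  next
    case (Compl a)
    then show ?case by (simp add: Compl_eq_Diff_UNIV[symmetric])
  next
    case (Union a)
    have "- \<Union> (range a) = (\<Inter>i. - a i)" by auto
    with Union show ?case by (auto intro: analytic_UN analytic_INT)
  qed
  have "sets (borel :: (nat \<Rightarrow> real) measure) = sigma_sets UNIV {S. closed S}"
    unfolding borel_eq_closed by simp
  with * assms show ?thesis by auto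
qed

section \<open>The covering cost\<close>

text \<open>The covering condition holds at every point of \<open>A\<close>, not almost everywhere:
  a null set of bad points is paid for by giving \<open>f\<close> the value 1 there. The bound by 1
  provides an integrable majorant for limits, and clipping restores it.\<close>

definition covers :: "'z measure \<Rightarrow> 'i set \<Rightarrow> ('i \<Rightarrow> 'e \<Rightarrow> 'z) \<Rightarrow> 'e set \<Rightarrow> ('z \<Rightarrow> real) set" where
  "covers \<pi> I p A =
     {f \<in> borel_measurable \<pi>. (\<forall>z. 0 \<le> f z \<and> f z \<le> 1) \<and> (\<forall>e\<in>A. 1 \<le> (\<Sum>i\<in>I. f (p i e)))}"

lemma coversD:
  assumes "f \<in> covers \<pi> I p A"
  shows "f \<in> borel_measurable \<pi>" "0 \<le> f z" "f z \<le> 1" "e \<in> A \<Longrightarrow> 1 \<le> (\<Sum>i\<in>I. f (p i e))"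
  using assms by (auto simp: covers_def)

text \<open>Either some clipped term is already 1, or nothing is clipped and the sum is merely
  divided by \<open>q\<close>.\<close>

lemma sum_clip_ge_1:
  fixes f :: "'i \<Rightarrow> real"
  assumes I: "finite I" and f: "\<And>i. 0 \<le> f i" and q: "0 < q" "q \<le> (\<Sum>i\<in>I. f i)"
  shows "1 \<le> (\<Sum>i\<in>I. min 1 (f i / q))"
proof (cases "\<exists>i\<in>I. 1 \<le> f i / q")
  case True
  then obtain i where "i \<in> I" "min 1 (f i / q) = 1" by auto
  then show ?thesis using member_le_sum[of i I "\<lambda>i. min 1 (f i / q)"] I f q by auto
next
  case False
  then have "(\<Sum>i\<in>I. min 1 (f i / q)) = (\<Sum>i\<in>I. f i) / q"
    unfolding sum_divide_distrib by (intro sum.cong) auto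
  then show ?thesis using q by simp
qed

lemma integrable_unit_interval:
  assumes "finite_measure M" "f \<in> borel_measurable M" "\<And>z. 0 \<le> f z" "\<And>z. f z \<le> (1::real)"
  shows "integrable M f" "integrable M (\<lambda>z. (f z)\<^sup>2)"
proof -
  interpret finite_measure M by fact
  note [measurable] = assms(2)
  show "integrable M f"
    by (rule integrable_const_bound[of _ 1]) (use assms in \<open>auto simp: abs_le_iff\<close>)
  show "integrable M (\<lambda>z. (f z)\<^sup>2)"
    by (rule integrable_const_bound[of _ 1]) (use assms in \<open>auto simp: power_le_one\<close>)
qed

lemma AE_summable_of_summable_integral:
  fixes d :: "nat \<Rightarrow> 'a \<Rightarrow> real"
  assumes int: "\<And>k. integrable M (d k)" and nn: "\<And>k z. 0 \<le> d k z"
    and s: "summable b" and le: "\<And>k. (\<integral>z. d k z \<partial>M) \<le> b k"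
  shows "AE z in M. summable (\<lambda>k. d k z)"
proof -
  have b: "0 \<le> b k" for k using le[of k] integral_nonneg_AE[of "d k" M] nn by (meson AE_I2 order_trans)
  have [measurable]: "d k \<in> borel_measurable M" for k using int by auto
  have "(\<integral>\<^sup>+z. (\<Sum>k. ennreal (d k z)) \<partial>M) = (\<Sum>k. \<integral>\<^sup>+z. ennreal (d k z) \<partial>M)"
    by (rule nn_integral_suminf) simp
  also have "\<dots> = (\<Sum>k. ennreal (\<integral>z. d k z \<partial>M))"
    using int nn by (subst nn_integral_eq_integral) auto
  also have "\<dots> \<le> (\<Sum>k. ennreal (b k))"
    by (intro suminf_le allI ennreal_leI le) auto
  also have "\<dots> = ennreal (\<Sum>k. b k)" using b s by (intro suminf_ennreal2) auto
  finally have "(\<integral>\<^sup>+z. (\<Sum>k. ennreal (d k z)) \<partial>M) \<noteq> \<infinity>"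
    by (auto simp: top_unique)
  then have "AE z in M. (\<Sum>k. ennreal (d k z)) \<noteq> \<infinity>"
    by (intro nn_integral_noteq_infinite) auto
  then show ?thesis
    by eventually_elim (use nn in \<open>auto intro: summable_suminf_not_top\<close>)
qed

text \<open>Near-minimizers of the cost are Cauchy in \<open>L\<^sup>2\<close> by the parallelogram law. This is the reason for
  integrating \<open>f\<^sup>2\<close> instead of \<open>f\<close>.\<close>

lemma covers_Union:
  fixes A :: "nat \<Rightarrow> 'e set"
  assumes fin: "finite_measure \<pi>" and I: "finite I" and inc: "incseq A"
    and cov: "\<And>k. \<exists>f\<in>covers \<pi> I p (A k). (\<integral>z. (f z)\<^sup>2 \<partial>\<pi>) \<le> s"
  shows "\<exists>f\<in>covers \<pi> I p (\<Union>k. A k). (\<integral>z. (f z)\<^sup>2 \<partial>\<pi>) \<le> s"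
proof -
  interpret finite_measure \<pi> by fact
  define E where "E f = (\<integral>z. (f z)\<^sup>2 \<partial>\<pi>)" for f :: "'a \<Rightarrow> real"
  define J where "J k = Inf (E ` covers \<pi> I p (A k))" for k
  have E0: "0 \<le> E f" for f unfolding E_def by simp
  have bdd: "bdd_below (E ` F)" for F using E0 by (auto intro!: bdd_belowI[of _ 0])
  have ne: "covers \<pi> I p (A k) \<noteq> {}" for k using cov[of k] by auto
  have anti: "covers \<pi> I p (A l) \<subseteq> covers \<pi> I p (A k)" if "k \<le> l" for k l
    using incseqD[OF inc that] by (auto simp: covers_def)
  have Jle: "J k \<le> E f" if "f \<in> covers \<pi> I p (A k)" for k f
    unfolding J_def using that by (intro cInf_lower bdd) auto
  have Js: "J k \<le> s" for k
    using cov[of k] Jle[of _ k] by (auto simp: E_def intro: order_trans)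
  have "incseq J"
    unfolding J_def incseq_def using anti ne by (auto intro!: cInf_superset_mono bdd)
  moreover have "bdd_above (range J)" using Js by (auto intro!: bdd_aboveI[of _ s])
  ultimately have lim: "J \<longlonglongrightarrow> (SUP k. J k)" by (intro LIMSEQ_incseq_SUP)
  define j where "j = (SUP k. J k)"
  have js: "j \<le> s" unfolding j_def using Js by (intro cSUP_least) auto
  have Jj: "J k \<le> j" for k unfolding j_def by (rule cSUP_upper) (use Js in \<open>auto intro!: bdd_aboveI[of _ s]\<close>)
  \<comment> \<open>The level \<open>r\<close> runs ahead until the cost is within (1/4)^k of its
    limit \<open>j\<close>. The condition \<open>k \<le> r\<close> ensures that a point of any fixed
    \<open>A l\<close> is eventually covered by all the chosen functions.\<close>
  have "\<exists>f r. k \<le> r \<and> j - (1/4)^k \<le> J r \<and> f \<in> covers \<pi> I p (A r) \<and> E f \<le> j + (1/4)^k" for k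
  proof -
    have "eventually (\<lambda>r. j - (1/4)^k < J r) sequentially"
      using lim unfolding j_def by (rule order_tendstoD) simp
    then obtain r where r: "k \<le> r" "j - (1/4)^k < J r"
      by (metis eventually_sequentially linorder_le_cases)
    have "Inf (E ` covers \<pi> I p (A r)) < J r + (1/4)^k" by (simp add: J_def)
    then obtain f where "f \<in> covers \<pi> I p (A r)" "E f < J r + (1/4)^k"
      using cInf_lessD[of "E ` covers \<pi> I p (A r)"] ne by auto
    then show ?thesis using r Jj[of r] by (intro exI[of _ f] exI[of _ r]) auto
  qed
  then obtain g r where r: "\<And>k. k \<le> r k" "\<And>k. j - (1/4)^k \<le> J (r k)"
    and g: "\<And>k. g k \<in> covers \<pi> I p (A (r k))" "\<And>k. E (g k) \<le> j + (1/4)^k"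
    by metis
  note gD = coversD[OF g(1)]
  note [measurable] = gD(1)
  have int[simp]: "integrable \<pi> (g k)" "integrable \<pi> (\<lambda>z. (g k z)\<^sup>2)" for k
    using integrable_unit_interval[OF fin gD(1) gD(2) gD(3)] by auto
  have "integrable \<pi> (\<lambda>z. g k z * g l z)" for k l
    by (rule integrable_const_bound[of _ 1]) (use gD(2,3) in \<open>auto simp: abs_mult mult_le_one\<close>)
  note [simp] = this
  have d: "(\<integral>z. (g k z - g (Suc k) z)\<^sup>2 \<partial>\<pi>) \<le> 8 * (1/4)^k" for k
  proof -
    let ?h = "\<lambda>z. (g k z + g (Suc k) z) / 2"
    \<comment> \<open>The levels \<open>r k\<close> need not increase, so the midpoint of two
      neighbours is used as a cover of the smaller of the two sets. Its energy is at least j -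
      (1/4)^k, and with both energies at most j + (1/4)^k the parallelogram law leaves 8 *
      (1/4)^k.\<close>
    let ?m = "min (r k) (r (Suc k))"
    have "?h \<in> covers \<pi> I p (A ?m)"
    proof -
      have "1 \<le> (\<Sum>i\<in>I. ?h (p i e))" if "e \<in> A ?m" for e
      proof -
        have "e \<in> A (r k)" "e \<in> A (r (Suc k))"
          using that incseqD[OF inc, of ?m "r k"] incseqD[OF inc, of ?m "r (Suc k)"] by auto
        from gD(4)[OF this(1)] gD(4)[OF this(2)] show ?thesis
          by (simp add: sum_divide_distrib[symmetric] sum.distrib)
      qed
      moreover have "0 \<le> ?h z \<and> ?h z \<le> 1" for z
        using gD(2,3)[of k z] gD(2,3)[of "Suc k" z] by auto
      ultimately show ?thesis by (auto simp: covers_def)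
    qed
    from Jle[OF this] have "J ?m \<le> E ?h" .
    moreover have q: "(1/4::real)^Suc k \<le> (1/4)^k" by simp
    have "j - (1/4)^k \<le> J (r (Suc k))" using r(2)[of "Suc k"] q by linarith
    with r(2)[of k] have "j - (1/4)^k \<le> J ?m" by (auto simp: min_def)
    moreover have "(\<integral>z. (g k z - g (Suc k) z)\<^sup>2 \<partial>\<pi>) = 2 * E (g k) + 2 * E (g (Suc k)) - 4 * E ?h"
      unfolding E_def by (simp add: power2_eq_square algebra_simps add_divide_distrib)
    moreover have "E (g (Suc k)) \<le> j + (1/4)^k" using g(2)[of "Suc k"] q by linarith
    ultimately show ?thesis using g(2)[of k] by linarith
  qed
  have "AE z in \<pi>. summable (\<lambda>k. \<bar>g k z - g (Suc k) z\<bar>)"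
  proof (rule AE_summable_of_summable_integral)
    show "summable (\<lambda>k. (8 + measure \<pi> (space \<pi>)) * (1/2::real)^k)"
      by (intro summable_mult summable_geometric) auto
    fix k
    have le: "\<bar>g k z - g (Suc k) z\<bar> \<le> 2^k * (g k z - g (Suc k) z)\<^sup>2 + (1/2)^k" for z
    proof -
      let ?d = "\<bar>g k z - g (Suc k) z\<bar>"
      have "0 \<le> (2^k * ?d - 1)\<^sup>2" by simp
      then have "2 * (2^k * ?d) \<le> (2^k * ?d)\<^sup>2 + 1" by (simp add: power2_eq_square algebra_simps)
      moreover have "0 \<le> 2^k * ?d" by simp
      ultimately have "2^k * ?d \<le> (2^k * ?d)\<^sup>2 + 1" by linarith
      then have "(1/2)^k * (2^k * ?d) \<le> (1/2)^k * ((2^k * ?d)\<^sup>2 + 1)" by (intro mult_left_mono) auto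
      then show ?thesis by (simp add: power_mult_distrib power2_eq_square algebra_simps power_one_over)
    qed
    have "integrable \<pi> (\<lambda>z. (g k z - g (Suc k) z)\<^sup>2)"
      by (simp add: power2_eq_square algebra_simps)
    then have "(\<integral>z. \<bar>g k z - g (Suc k) z\<bar> \<partial>\<pi>) \<le> (\<integral>z. 2^k * (g k z - g (Suc k) z)\<^sup>2 + (1/2)^k \<partial>\<pi>)"
      by (intro integral_mono le) auto
    also have "\<dots> = 2^k * (\<integral>z. (g k z - g (Suc k) z)\<^sup>2 \<partial>\<pi>) + (1/2)^k * measure \<pi> (space \<pi>)"
      using \<open>integrable \<pi> (\<lambda>z. (g k z - g (Suc k) z)\<^sup>2)\<close> by (subst Bochner_Integration.integral_add) auto
    also have "2^k * (\<integral>z. (g k z - g (Suc k) z)\<^sup>2 \<partial>\<pi>) \<le> 2^k * (8 * (1/4)^k)"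
      by (intro mult_left_mono d) auto
    also have "2^k * (8 * (1/4)^k) = 8 * (1/2::real)^k"
      by (simp add: power_mult_distrib[symmetric] field_simps)
    finally show "(\<integral>z. \<bar>g k z - g (Suc k) z\<bar> \<partial>\<pi>) \<le> (8 + measure \<pi> (space \<pi>)) * (1/2::real)^k"
      by (simp add: algebra_simps)
  qed auto
  then have conv: "AE z in \<pi>. Cauchy (\<lambda>k. g k z)"
  proof eventually_elim
    case (elim z)
    then have "summable (\<lambda>k. g (Suc k) z - g k z)"
      using summable_rabs_cancel by (simp add: abs_minus_commute)
    then obtain l where "(\<lambda>n. \<Sum>k<n. g (Suc k) z - g k z) \<longlonglongrightarrow> l"
      unfolding summable_def sums_def by blast
    then have "(\<lambda>n. (g n z - g 0 z) + g 0 z) \<longlonglongrightarrow> l + g 0 z"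
      using sum_lessThan_telescope[of "\<lambda>k. g k z"] by (intro tendsto_add tendsto_const) simp
    then have "convergent (\<lambda>k. g k z)" by (auto simp: convergent_def)
    then show ?case by (rule convergent_Cauchy)
  qed
  \<comment> \<open>The default 1 at points without a limit makes the covering inequality automatic
    for any configuration that has such a point. These points form a null set, so the energy is
    unaffected.\<close>
  define f where "f z = (if Cauchy (\<lambda>k. g k z) then lim (\<lambda>k. g k z) else 1)" for z
  have lim_f: "(\<lambda>k. g k z) \<longlonglongrightarrow> f z" if "Cauchy (\<lambda>k. g k z)" for z
    using that by (simp add: f_def Cauchy_convergent_iff convergent_LIMSEQ_iff)
  have f_meas[measurable]: "f \<in> borel_measurable \<pi>" unfolding f_def by measurable
  have f01: "0 \<le> f z \<and> f z \<le> 1" for z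
  proof (cases "Cauchy (\<lambda>k. g k z)")
    case True
    from lim_f[OF this] show ?thesis using gD(2,3)
      by (auto intro: LIMSEQ_le_const LIMSEQ_le_const2)
  qed (simp add: f_def)
  have "1 \<le> (\<Sum>i\<in>I. f (p i e))" if e: "e \<in> (\<Union>k. A k)" for e
  proof (cases "\<forall>i\<in>I. Cauchy (\<lambda>k. g k (p i e))")
    case True
    obtain k0 where "e \<in> A k0" using e by auto
    then have "e \<in> A (r k)" if "k \<ge> k0" for k
      using incseqD[OF inc, of k0 "r k"] r(1)[of k] that by auto
    then have "\<forall>k\<ge>k0. 1 \<le> (\<Sum>i\<in>I. g k (p i e))" using gD(4) by auto
    moreover have "(\<lambda>k. \<Sum>i\<in>I. g k (p i e)) \<longlonglongrightarrow> (\<Sum>i\<in>I. f (p i e))"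
      using True by (intro tendsto_sum lim_f) auto
    ultimately show ?thesis by (intro LIMSEQ_le_const) auto
  next
    case False
    then obtain i where i: "i \<in> I" "f (p i e) = 1" by (auto simp: f_def)
    have "f (p i e) \<le> (\<Sum>i\<in>I. f (p i e))" using i I f01 by (intro member_le_sum) auto
    then show ?thesis using i by simp
  qed
  then have "f \<in> covers \<pi> I p (\<Union>k. A k)" using f01 by (auto simp: covers_def)
  moreover have "E f \<le> s"
  proof -
    have "(\<lambda>k. E (g k)) \<longlonglongrightarrow> E f" unfolding E_def
    proof (rule integral_dominated_convergence[where w="\<lambda>_. 1"])
      show "AE z in \<pi>. (\<lambda>k. (g k z)\<^sup>2) \<longlonglongrightarrow> (f z)\<^sup>2"
        using conv by eventually_elim (intro tendsto_intros lim_f)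
      show "AE z in \<pi>. norm ((g k z)\<^sup>2) \<le> 1" for k using gD(2,3) by (auto simp: power_le_one)
    qed auto
    moreover have "(\<lambda>k. j + (1/4::real)^k) \<longlonglongrightarrow> j + 0"
      by (intro tendsto_intros LIMSEQ_realpow_zero) auto
    ultimately have "E f \<le> j" using g(2) by (intro LIMSEQ_le[of "\<lambda>k. E (g k)"]) auto
    then show ?thesis using js by simp
  qed
  ultimately show ?thesis unfolding E_def by blast
qed

section \<open>Compactness in spaces of real sequences\<close>

lemma tendsto_funI:
  fixes X :: "'b \<Rightarrow> 'a \<Rightarrow> 'c::topological_space"
  assumes "\<And>i. ((\<lambda>k. X k i) \<longlongrightarrow> l i) F"
  shows "(X \<longlongrightarrow> l) F"
proof -
  have "limitin (product_topology (\<lambda>i. euclidean) UNIV) X l F"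
    using assms by (simp add: limitin_componentwise)
  then show ?thesis by (simp add: euclidean_product_topology)
qed

lemma tendsto_funD:
  fixes X :: "'b \<Rightarrow> 'a \<Rightarrow> 'c::topological_space"
  assumes "(X \<longlongrightarrow> l) F"
  shows "((\<lambda>k. X k i) \<longlongrightarrow> l i) F"
  by (rule continuous_on_tendsto_compose[OF continuous_on_coordinate[of UNIV i] assms]) auto

lemma compact_box_fun:
  fixes m :: "'a \<Rightarrow> real"
  shows "compact {\<tau>. \<forall>i. \<bar>\<tau> i\<bar> \<le> m i}"
proof -
  have "{\<tau>. \<forall>i. \<bar>\<tau> i\<bar> \<le> m i} = PiE UNIV (\<lambda>i. {- m i..m i})"
    by (auto simp: PiE_def Pi_def abs_le_iff) (metis minus_le_iff)+
  moreover have "compactin (product_topology (\<lambda>i. euclidean) UNIV) (PiE UNIV (\<lambda>i. {- m i..m i}))"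
    by (simp add: compactin_PiE)
  ultimately show ?thesis by (simp add: euclidean_product_topology)
qed

text \<open>Choquet's capacitability argument: the bounds \<open>m\<close> on the coordinates are chosen one after the
  other such that the covering cost stays above \<open>a\<close>.\<close>

lemma compact_part_not_covered:
  fixes D :: "(nat \<Rightarrow> real) set" and p :: "'i \<Rightarrow> (nat \<Rightarrow> real) \<Rightarrow> 'z::topological_space"
  assumes fin: "finite_measure \<pi>" and sets: "sets \<pi> = sets borel" and I: "finite I"
    and D: "closed D" and cont: "\<And>i. i \<in> I \<Longrightarrow> continuous_on D (p i)" and a: "0 < a"
    and nocov: "\<not> (\<exists>f\<in>covers \<pi> I p D. (\<integral>z. (f z)\<^sup>2 \<partial>\<pi>) \<le> a)"
  obtains m :: "nat \<Rightarrow> nat" where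
    "\<And>f. continuous_on UNIV f \<Longrightarrow> (\<And>z. 0 \<le> f z) \<Longrightarrow> (\<And>z. f z \<le> 1) \<Longrightarrow>
       (\<And>e. e \<in> D \<Longrightarrow> (\<forall>i. \<bar>e i\<bar> \<le> m i) \<Longrightarrow> 1 \<le> (\<Sum>i\<in>I. f (p i e))) \<Longrightarrow>
       a \<le> (\<integral>z. f z \<partial>\<pi>)"
proof -
  let ?cov = "\<lambda>A. \<exists>f\<in>covers \<pi> I p A. (\<integral>z. (f z)\<^sup>2 \<partial>\<pi>) \<le> a"
  let ?D = "\<lambda>k (x :: nat \<Rightarrow> nat). D \<inter> {e. \<forall>i<k. \<bar>e i\<bar> \<le> x i}"
  have "\<exists>x. \<forall>k. \<not> ?cov (?D k (x k)) \<and> (\<forall>i<k. x (Suc k) i = x k i)"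
  proof (rule dependent_nat_choice)
    show "\<exists>x. \<not> ?cov (?D 0 x)" using nocov by auto
    fix x k assume nc: "\<not> ?cov (?D k x)"
    have "\<exists>n. \<not> ?cov (?D (Suc k) (x(k := n)))"
    proof (rule ccontr)
      assume "\<not> ?thesis"
      then have "?cov (?D (Suc k) (x(k := n)))" for n by blast
      moreover have "incseq (\<lambda>n. ?D (Suc k) (x(k := n)))"
        by (rule incseq_SucI) (auto simp: less_Suc_eq split: if_splits)
      ultimately have "?cov (\<Union>n. ?D (Suc k) (x(k := n)))"
        by (intro covers_Union fin I)
      moreover have "(\<Union>n. ?D (Suc k) (x(k := n))) = ?D k x"
      proof (intro equalityI subsetI)
        fix e assume "e \<in> ?D k x"
        moreover obtain n where "\<bar>e k\<bar> \<le> real n" using real_arch_simple by blast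
        ultimately show "e \<in> (\<Union>n. ?D (Suc k) (x(k := n)))" by (auto simp: less_Suc_eq)
      qed (auto simp: less_Suc_eq split: if_splits)
      ultimately show False using nc by simp
    qed
    then obtain n where "\<not> ?cov (?D (Suc k) (x(k := n)))" by blast
    then show "\<exists>y. \<not> ?cov (?D (Suc k) y) \<and> (\<forall>i<k. y i = x i)"
      by (intro exI[of _ "x(k := n)"]) auto
  qed
  then obtain x where x: "\<And>k. \<not> ?cov (?D k (x k))" "\<And>k i. i < k \<Longrightarrow> x (Suc k) i = x k i" by blast
  define m where "m i = x (Suc i) i" for i
  have xm: "x k i = m i" if "i < k" for k i
    using that by (induction k) (auto simp: m_def less_Suc_eq x(2))
  show ?thesis
  proof (rule that[of m])
    fix f :: "'z \<Rightarrow> real"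
    assume f: "continuous_on UNIV f" "\<And>z. 0 \<le> f z" "\<And>z. f z \<le> 1"
      and cov: "\<And>e. e \<in> D \<Longrightarrow> (\<forall>i. \<bar>e i\<bar> \<le> m i) \<Longrightarrow> 1 \<le> (\<Sum>i\<in>I. f (p i e))"
    show "a \<le> (\<integral>z. f z \<partial>\<pi>)"
    proof (rule ccontr)
      assume "\<not> ?thesis"
      then have "(\<integral>z. f z \<partial>\<pi>) / a < 1" using a by simp
      then obtain c' where c': "(\<integral>z. f z \<partial>\<pi>) / a < c'" "c' < 1" by (rule dense[THEN exE]) auto
      have nn: "0 \<le> (\<integral>z. f z \<partial>\<pi>)" using f by simp
      have c0: "0 < c'" using c' nn a by (smt (verit) divide_nonneg_pos)
      \<comment> \<open>Suppose that for each \<open>k\<close> some point obeying only the first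
        \<open>k\<close> bounds had a sum below \<open>c'\<close>. A limit point would obey all
        bounds and have a sum at most \<open>c' < 1\<close>. So the level \<open>c'\<close> is
        reached under finitely many bounds, and only these were used in showing that
        \<open>?D k (x k)\<close> has no cheap cover.\<close>
      have "\<exists>k. \<forall>e\<in>D. (\<forall>i<k. \<bar>e i\<bar> \<le> m i) \<longrightarrow> c' \<le> (\<Sum>i\<in>I. f (p i e))"
      proof (rule ccontr)
        assume "\<not> ?thesis"
        then have "\<forall>k. \<exists>e. e \<in> D \<and> (\<forall>i<k. \<bar>e i\<bar> \<le> m i) \<and> (\<Sum>i\<in>I. f (p i e)) < c'"
          by (meson not_less)
        then obtain s where s: "\<And>k. s k \<in> D" "\<And>k i. i < k \<Longrightarrow> \<bar>s k i\<bar> \<le> m i"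
          "\<And>k. (\<Sum>i\<in>I. f (p i (s k))) < c'" by metis
        \<comment> \<open>Clamping moves the sequences into a compact box. Coordinate
          \<open>i\<close> is unchanged once \<open>k > i\<close>, so the unclamped subsequence has
          the same limit.\<close>
        define t where "t k i = max (- real (m i)) (min (s k i) (m i))" for k i
        have "t k \<in> {\<tau>. \<forall>i. \<bar>\<tau> i\<bar> \<le> real (m i)}" for k by (auto simp: t_def)
        then obtain l r where l: "\<forall>i. \<bar>l i\<bar> \<le> real (m i)" "strict_mono (r :: nat \<Rightarrow> nat)" "(t \<circ> r) \<longlonglongrightarrow> l"
          using compact_box_fun[of "\<lambda>i. real (m i)"]
          unfolding compact_eq_seq_compact_metric seq_compact_def by blast
        have lim: "(\<lambda>k. s (r k)) \<longlonglongrightarrow> l"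
        proof (rule tendsto_funI)
          fix i
          have "eventually (\<lambda>k. i < k) sequentially" by (rule eventually_gt_at_top)
          then have "eventually (\<lambda>k. t (r k) i = s (r k) i) sequentially"
          proof eventually_elim
            case (elim k)
            then have "i < r k" using seq_suble[OF l(2), of k] by linarith
            from s(2)[OF this] show ?case by (auto simp: t_def)
          qed
          moreover have "(\<lambda>k. t (r k) i) \<longlonglongrightarrow> l i" using tendsto_funD[OF l(3)] by (simp add: comp_def)
          ultimately show "(\<lambda>k. s (r k) i) \<longlonglongrightarrow> l i" by (simp add: tendsto_cong)
        qed
        then have lD: "l \<in> D" using closed_sequentially[OF D _ lim] s(1) by blast
        have "(\<lambda>k. \<Sum>i\<in>I. f (p i (s (r k)))) \<longlonglongrightarrow> (\<Sum>i\<in>I. f (p i l))"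
        proof (rule tendsto_sum)
          fix i assume "i \<in> I"
          have "(\<lambda>k. p i (s (r k))) \<longlonglongrightarrow> p i l"
            by (rule continuous_on_tendsto_compose[OF cont[OF \<open>i \<in> I\<close>] lim lD]) (simp add: s)
          then show "(\<lambda>k. f (p i (s (r k)))) \<longlonglongrightarrow> f (p i l)"
            by (rule continuous_on_tendsto_compose[OF f(1)]) auto
        qed
        then have "(\<Sum>i\<in>I. f (p i l)) \<le> c'"
          using s(3) by (intro LIMSEQ_le_const2) (auto intro: less_imp_le)
        moreover have "1 \<le> (\<Sum>i\<in>I. f (p i l))" using lD l(1) by (intro cov) auto
        ultimately show False using c'(2) by simp
      qed
      then obtain k where k: "\<And>e. e \<in> D \<Longrightarrow> \<forall>i<k. \<bar>e i\<bar> \<le> m i \<Longrightarrow> c' \<le> (\<Sum>i\<in>I. f (p i e))" by blast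
      define g where "g z = min 1 (f z / c')" for z
      have f_meas: "f \<in> borel_measurable \<pi>"
        using borel_measurable_continuous_onI[OF f(1)] by (simp add: measurable_cong_sets[OF sets refl])
      have g_meas: "g \<in> borel_measurable \<pi>" unfolding g_def using f_meas by measurable
      have g01: "0 \<le> g z" "g z \<le> 1" for z using f(2)[of z] c0 by (auto simp: g_def)
      have "g \<in> covers \<pi> I p (?D k (x k))"
      proof -
        have "1 \<le> (\<Sum>i\<in>I. g (p i e))" if "e \<in> ?D k (x k)" for e
          unfolding g_def by (rule sum_clip_ge_1[OF I f(2) c0 k]) (use that xm in auto)
        then show ?thesis using g_meas g01 by (auto simp: covers_def)
      qed
      \<comment> \<open>Squaring only lowers values in [0, 1], so a cheap cover for the linear cost
        is also cheap for the quadratic one. This is how the linear inequality needed for duality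
        comes out of the quadratic cost.\<close>
      moreover have "(\<integral>z. (g z)\<^sup>2 \<partial>\<pi>) \<le> a"
      proof -
        note gi = integrable_unit_interval[OF fin g_meas g01]
        note fi = integrable_unit_interval[OF fin f_meas f(2,3)]
        have "(\<integral>z. (g z)\<^sup>2 \<partial>\<pi>) \<le> (\<integral>z. f z / c' \<partial>\<pi>)"
        proof (rule integral_mono)
          fix z
          have "(g z)\<^sup>2 \<le> g z" using g01[of z] by (simp add: power2_eq_square mult_left_le)
          also have "\<dots> \<le> f z / c'" by (simp add: g_def)
          finally show "(g z)\<^sup>2 \<le> f z / c'" .
        qed (use gi fi in auto)
        also have "\<dots> \<le> a" using c'(1) c0 a by (simp add: field_simps)
        finally show ?thesis .
      qed
      ultimately show False using x(1)[of k] by blast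
    qed
  qed
qed

section \<open>Compact boxes as images of compact sets of reals\<close>

lemma continuous_on_digit_sum:
  fixes r :: real
  assumes "0 \<le> r" "r < 1"
  shows "continuous_on S (\<lambda>b :: nat \<Rightarrow> bool. \<Sum>k. of_bool (b (e k)) * r ^ k)"
proof -
  have ul: "uniform_limit S (\<lambda>n (b :: nat \<Rightarrow> bool). \<Sum>k<n. of_bool (b (e k)) * r ^ k)
          (\<lambda>b. \<Sum>k. of_bool (b (e k)) * r ^ k) sequentially"
    by (rule Weierstrass_m_test[where M="\<lambda>k. r ^ k"]) (use assms in \<open>auto intro!: summable_geometric\<close>)
  have "continuous_on S (\<lambda>b :: nat \<Rightarrow> bool. of_bool (b (e k)) :: real)" for k
    by (rule continuous_on_compose2[OF Topological_Spaces.continuous_on_discrete continuous_on_coordinate]) auto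
  then have "continuous_on S (\<lambda>b :: nat \<Rightarrow> bool. \<Sum>k<n. of_bool (b (e k)) * r ^ k)" for n
    by (intro continuous_intros)
  then show ?thesis
    by (intro uniform_limit_theorem[OF _ ul]) auto
qed

lemma summable_digit_sum:
  fixes r :: real
  assumes "0 \<le> r" "r < 1" "\<And>k. \<bar>d k\<bar> \<le> 1"
  shows "summable (\<lambda>k. d k * r ^ k)"
proof (rule summable_comparison_test'[of "\<lambda>k. r ^ k" 0])
  show "norm (d k * r ^ k) \<le> r ^ k" for k
    using mult_right_mono[OF assms(3)[of k], of "r ^ k"] assms(1) by (simp add: abs_mult)
qed (use assms in \<open>auto intro!: summable_geometric\<close>)

text \<open>With digits 0 and 1 in base 3, the first difference is worth (1/3)^n and all later ones
  together at most half of that. In base 2 the two amounts could balance.\<close>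

lemma inj_ternary_sum: "inj (\<lambda>b :: nat \<Rightarrow> bool. \<Sum>k. of_bool (b k) * (1/3::real) ^ k)"
proof -
  have sm: "summable (\<lambda>k. of_bool (b k) * (1/3::real) ^ k)" for b
    by (rule summable_digit_sum) auto
  have *: "(\<Sum>k. of_bool (b' k) * (1/3::real) ^ k) < (\<Sum>k. of_bool (b k) * (1/3::real) ^ k)"
    if n: "\<And>k. k < n \<Longrightarrow> b k = b' k" "b n" "\<not> b' n" for b b' :: "nat \<Rightarrow> bool" and n
  proof -
    define d where "d k = of_bool (b k) - (of_bool (b' k) :: real)" for k
    have d: "d k = 0" if "k < n" for k using n(1)[OF that] by (simp add: d_def)
    have sd: "summable (\<lambda>k. d k * (1/3::real) ^ k)"
      by (rule summable_digit_sum) (auto simp: d_def)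
    have 1: "(\<Sum>k. of_bool (b k) * (1/3::real) ^ k) - (\<Sum>k. of_bool (b' k) * (1/3::real) ^ k) = (\<Sum>k. d k * (1/3) ^ k)"
      using suminf_diff[OF sm[of b] sm[of b']] by (simp add: d_def left_diff_distrib)
    have 2: "(\<Sum>k. d k * (1/3) ^ k) = (\<Sum>k. d (k + Suc n) * (1/3) ^ (k + Suc n)) + (1/3) ^ n"
      using suminf_split_initial_segment[OF sd, of "Suc n"] n(2,3) d by (simp add: d_def)
    have 3: "(\<Sum>k. - ((1/3::real) ^ (k + Suc n))) \<le> (\<Sum>k. d (k + Suc n) * (1/3) ^ (k + Suc n))"
    proof (rule suminf_le)
      show "- ((1/3::real) ^ (k + Suc n)) \<le> d (k + Suc n) * (1/3) ^ (k + Suc n)" for k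
        using mult_right_mono[of "- 1" "d (k + Suc n)" "(1/3::real) ^ (k + Suc n)"] by (simp add: d_def)
      show "summable (\<lambda>k. - ((1/3::real) ^ (k + Suc n)))"
        by (intro summable_minus summable_ignore_initial_segment summable_geometric) auto
      show "summable (\<lambda>k. d (k + Suc n) * (1/3::real) ^ (k + Suc n))"
        using summable_ignore_initial_segment[OF sd] .
    qed
    have "(\<lambda>k. (1/3) ^ Suc n * (1/3::real) ^ k) sums ((1/3) ^ Suc n * (1 / (1 - 1/3)))"
      by (intro sums_mult geometric_sums) auto
    then have "(\<lambda>k. - ((1/3::real) ^ (k + Suc n))) sums - ((1/3) ^ Suc n * (1 / (1 - 1/3)))"
      by (intro sums_minus) (simp add: power_add mult.commute)
    then have 4: "(\<Sum>k. - ((1/3::real) ^ (k + Suc n))) = - ((1/3)^n / 2)"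
      by (simp add: sums_iff)
    have 5: "0 < (1/3::real)^n" by simp
    show ?thesis using 1 2 3 4 5 by linarith
  qed
  show ?thesis
  proof (rule injI, rule ccontr)
    fix b b' :: "nat \<Rightarrow> bool"
    assume eq: "(\<Sum>k. of_bool (b k) * (1/3::real) ^ k) = (\<Sum>k. of_bool (b' k) * (1/3::real) ^ k)" and "b \<noteq> b'"
    then obtain j where "b j \<noteq> b' j" by auto
    define n where "n = (LEAST j. b j \<noteq> b' j)"
    have n: "b n \<noteq> b' n" unfolding n_def by (rule LeastI) fact
    have "b k = b' k" if "k < n" for k using not_less_Least[of k "\<lambda>j. b j \<noteq> b' j"] that unfolding n_def by auto
    then show False using *[of n b b'] *[of n b' b] n eq by (cases "b n") auto
  qed
qed

text \<open>The digits are parities of \<lfloor>2^(k+1) x\<rfloor>, which makes the partial sums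
  telescope. The factor 2 appears because the first binary place carries weight 1. For x = 1 all
  these parities are 0, hence the separate case.\<close>

lemma binary_expansion:
  fixes x :: real
  assumes "0 \<le> x" "x \<le> 1"
  obtains b :: "nat \<Rightarrow> bool" where "(\<Sum>k. of_bool (b k) * (1/2::real) ^ k) = 2 * x"
proof (cases "x = 1")
  case True
  have "(\<Sum>k. of_bool True * (1/2::real) ^ k) = 2 * x"
    using geometric_sums[of "1/2::real"] True by (simp add: sums_iff)
  then show ?thesis by (rule that)
next
  case False
  define b where "b k \<longleftrightarrow> odd \<lfloor>2 ^ Suc k * x\<rfloor>" for k
  have fl: "\<lfloor>2 ^ Suc k * x\<rfloor> = 2 * \<lfloor>2 ^ k * x\<rfloor> + of_bool (b k)" for k
  proof -
    have "\<lfloor>2 ^ k * x\<rfloor> = \<lfloor>2 ^ Suc k * x\<rfloor> div 2"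
      using floor_divide_real_eq_div[of 2 "2 ^ Suc k * x"] by (simp add: mult.assoc)
    then show ?thesis unfolding b_def
      by (metis odd_iff_mod_2_eq_one mod_2_eq_odd mult_div_mod_eq)
  qed
  have sum: "(\<Sum>k<n. of_bool (b k) * (1/2::real) ^ k) = 2 * (real_of_int \<lfloor>2 ^ n * x\<rfloor> / 2 ^ n)" for n
  proof (induction n)
    case 0
    then show ?case using assms False by (simp add: floor_eq_iff)
  next
    case (Suc n)
    show ?case unfolding sum.lessThan_Suc Suc fl by (simp add: field_simps power_one_over)
  qed
  have "(\<lambda>n. real_of_int \<lfloor>2 ^ n * x\<rfloor> / 2 ^ n) \<longlonglongrightarrow> x"
  proof (rule real_tendsto_sandwich)
    show "\<forall>\<^sub>F n in sequentially. x - (1/2)^n \<le> real_of_int \<lfloor>2 ^ n * x\<rfloor> / 2 ^ n"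
    proof (intro always_eventually allI)
      fix n
      have "2 ^ n * x - 1 \<le> real_of_int \<lfloor>2 ^ n * x\<rfloor>" by linarith
      then have "(2 ^ n * x - 1) / 2 ^ n \<le> real_of_int \<lfloor>2 ^ n * x\<rfloor> / 2 ^ n" by (rule divide_right_mono) simp
      then show "x - (1/2)^n \<le> real_of_int \<lfloor>2 ^ n * x\<rfloor> / 2 ^ n" by (simp add: diff_divide_distrib power_one_over)
    qed
    show "\<forall>\<^sub>F n in sequentially. real_of_int \<lfloor>2 ^ n * x\<rfloor> / 2 ^ n \<le> x"
      by (intro always_eventually allI) (simp add: divide_le_eq mult.commute)
    have "(\<lambda>n. x - (1/2::real)^n) \<longlonglongrightarrow> x - 0" by (intro tendsto_intros LIMSEQ_realpow_zero) auto
    then show "(\<lambda>n. x - (1/2::real)^n) \<longlonglongrightarrow> x" by simp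
  qed auto
  then have "(\<lambda>k. of_bool (b k) * (1/2::real) ^ k) sums (2 * x)"
    unfolding sums_def sum by (intro tendsto_intros)
  then show ?thesis by (intro that[of b]) (simp add: sums_iff)
qed

text \<open>The space of Boolean sequences mediates: ternary sums embed it into the reals, with
  continuous inverse by compactness, and binary digits map it onto the box. The lemma moves the
  search for a dual measure to the real line.\<close>

lemma box_fun_continuous_image:
  fixes m :: "nat \<Rightarrow> real"
  assumes m: "\<And>i. 0 \<le> m i"
  obtains C :: "real set" and h :: "real \<Rightarrow> nat \<Rightarrow> real"
  where "compact C" "continuous_on C h" "h ` C = {\<tau>. \<forall>i. \<bar>\<tau> i\<bar> \<le> m i}"
proof -
  define \<Psi> where "\<Psi> = (\<lambda>b :: nat \<Rightarrow> bool. \<Sum>k. of_bool (b k) * (1/3::real) ^ k)"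
  have inj: "inj \<Psi>" unfolding \<Psi>_def by (rule inj_ternary_sum)
  have cont: "continuous_on UNIV \<Psi>" unfolding \<Psi>_def by (rule continuous_on_digit_sum[of _ _ "\<lambda>k. k"]) auto
  have "compactin (product_topology (\<lambda>i::nat. euclidean) UNIV) (PiE UNIV (\<lambda>i. UNIV :: bool set))"
    unfolding compactin_PiE by (simp add: finite_imp_compact)
  then have comp: "compact (UNIV :: (nat \<Rightarrow> bool) set)" by (simp add: euclidean_product_topology)
  \<comment> \<open>Position \<open>prod_encode (i, k)\<close> holds the k-th binary digit of
    coordinate \<open>i\<close>; the digit sum ranges over [0, 2] and is rescaled to
    [- m i, m i].\<close>
  define q where "q = (\<lambda>(b :: nat \<Rightarrow> bool) i. - m i + m i * (\<Sum>k. of_bool (b (prod_encode (i, k))) * (1/2::real) ^ k))"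
  have q: "continuous_on S q" for S
    unfolding q_def by (intro continuous_on_coordinatewise_then_product continuous_intros continuous_on_digit_sum) auto
  have inv: "continuous_on (range \<Psi>) (inv \<Psi>)"
    by (rule continuous_on_inv[OF cont comp]) (use inj in auto)
  have "range q = {\<tau>. \<forall>i. \<bar>\<tau> i\<bar> \<le> m i}"
  proof (intro equalityI subsetI)
    fix \<tau> assume "\<tau> \<in> range q"
    then obtain b where b: "\<tau> = q b" by auto
    have "\<bar>\<tau> i\<bar> \<le> m i" for i
    proof -
      let ?s = "\<Sum>k. of_bool (b (prod_encode (i, k))) * (1/2::real) ^ k"
      have sm: "summable (\<lambda>k. of_bool (b (prod_encode (i, k))) * (1/2::real) ^ k)"
        by (rule summable_digit_sum) auto
      have "0 \<le> ?s" by (rule suminf_nonneg[OF sm]) auto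
      moreover have "?s \<le> (\<Sum>k. (1/2::real) ^ k)"
        by (rule suminf_le[OF _ sm]) (auto intro!: summable_geometric)
      then have "?s \<le> 2" using suminf_geometric[of "1/2::real"] by simp
      ultimately have "0 \<le> m i * ?s" "m i * ?s \<le> m i * 2" using m[of i] by (auto intro: mult_left_mono)
      then show ?thesis unfolding b q_def by (simp add: abs_le_iff)
    qed
    then show "\<tau> \<in> {\<tau>. \<forall>i. \<bar>\<tau> i\<bar> \<le> m i}" by blast
  next
    fix \<tau> assume "\<tau> \<in> {\<tau>. \<forall>i. \<bar>\<tau> i\<bar> \<le> m i}"
    then have \<tau>: "\<bar>\<tau> i\<bar> \<le> m i" for i by blast
    have "\<exists>b :: nat \<Rightarrow> bool. - m i + m i * (\<Sum>k. of_bool (b k) * (1/2::real) ^ k) = \<tau> i" for i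
    proof (cases "m i = 0")
      case True
      then show ?thesis using \<tau>[of i] by simp
    next
      case False
      define x where "x = (\<tau> i + m i) / (2 * m i)"
      have "0 \<le> x" "x \<le> 1" using \<tau>[of i] m[of i] False by (auto simp: x_def field_simps abs_le_iff)
      then obtain b :: "nat \<Rightarrow> bool" where "(\<Sum>k. of_bool (b k) * (1/2::real) ^ k) = 2 * x" by (rule binary_expansion)
      then show ?thesis using False by (intro exI[of _ b]) (simp add: x_def field_simps)
    qed
    then obtain b :: "nat \<Rightarrow> nat \<Rightarrow> bool" where b: "\<And>i. - m i + m i * (\<Sum>k. of_bool (b i k) * (1/2::real) ^ k) = \<tau> i"
      by metis
    have "\<tau> = q (\<lambda>n. b (fst (prod_decode n)) (snd (prod_decode n)))"
      using b by (simp add: q_def)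
    then show "\<tau> \<in> range q" by blast
  qed
  moreover have "(\<lambda>t. q (inv \<Psi> t)) ` range \<Psi> = range q"
    using inj by (auto simp: image_image)
  moreover have "continuous_on (range \<Psi>) (\<lambda>t. q (inv \<Psi> t))"
    by (rule continuous_on_compose2[OF q[of UNIV] inv]) auto
  moreover have "compact (range \<Psi>)" by (rule compact_continuous_image[OF cont comp])
  ultimately show ?thesis using that by metis
qed

section \<open>Duality on compact sets\<close>

text \<open>Blackwell's approachability argument: always play a point at which the positive part of the
  accumulated vector is (almost) not pushed further.\<close>

lemma approachability:
  fixes v :: "'e \<Rightarrow> nat \<Rightarrow> real"
  assumes bd: "\<And>e l. e \<in> P \<Longrightarrow> \<bar>v e l\<bar> \<le> B"
    and H: "\<And>w. (\<And>l. 0 \<le> w l) \<Longrightarrow> \<exists>e\<in>P. (\<Sum>l<r. w l * v e l) \<le> 1"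
  shows "\<exists>e :: nat \<Rightarrow> 'e. (\<forall>s<t. e s \<in> P) \<and>
           (\<Sum>l<r. (max 0 (\<Sum>s<t. v (e s) l))\<^sup>2) \<le> real t * (real r * B\<^sup>2 + 2)"
proof (induction t)
  case 0
  then show ?case by auto
next
  case (Suc t)
  then obtain e where e: "\<And>s. s < t \<Longrightarrow> e s \<in> P"
    "(\<Sum>l<r. (max 0 (\<Sum>s<t. v (e s) l))\<^sup>2) \<le> real t * (real r * B\<^sup>2 + 2)" by blast
  define S where "S l = (\<Sum>s<t. v (e s) l)" for l
  obtain x where x: "x \<in> P" "(\<Sum>l<r. max 0 (S l) * v x l) \<le> 1"
    using H[of "\<lambda>l. max 0 (S l)"] by auto
  \<comment> \<open>In the expanded square the cross terms add up to at most 2 by the choice of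
    \<open>x\<close>, and the remaining ones to at most \<open>r\<close> times the square of
    \<open>B\<close>: this is the increment allowed per round.\<close>
  have "(\<Sum>l<r. (max 0 (S l + v x l))\<^sup>2) \<le> (\<Sum>l<r. (max 0 (S l))\<^sup>2 + 2 * (max 0 (S l) * v x l) + B\<^sup>2)"
  proof (rule sum_mono)
    fix l
    have "(v x l)\<^sup>2 \<le> B\<^sup>2" using bd[OF x(1), of l] by (metis abs_ge_zero power2_abs power_mono)
    moreover have "(max 0 (S l + v x l))\<^sup>2 \<le> (max 0 (S l) + v x l)\<^sup>2"
      by (rule abs_le_square_iff[THEN iffD1]) auto
    ultimately show "(max 0 (S l + v x l))\<^sup>2 \<le> (max 0 (S l))\<^sup>2 + 2 * (max 0 (S l) * v x l) + B\<^sup>2"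
      unfolding power2_sum by (simp add: algebra_simps)
  qed
  also have "\<dots> = (\<Sum>l<r. (max 0 (S l))\<^sup>2) + 2 * (\<Sum>l<r. max 0 (S l) * v x l) + real r * B\<^sup>2"
    by (simp add: sum.distrib sum_distrib_left)
  also have "\<dots> \<le> real (Suc t) * (real r * B\<^sup>2 + 2)"
    using e(2) x(2) by (simp add: S_def algebra_simps)
  finally have "(\<Sum>l<r. (max 0 (\<Sum>s<Suc t. v ((e(t := x)) s) l))\<^sup>2) \<le> real (Suc t) * (real r * B\<^sup>2 + 2)"
    by (simp add: S_def)
  then show ?case using e(1) x(1) by (intro exI[of _ "e(t := x)"]) (auto simp: less_Suc_eq)
qed

text \<open>The squared norm of the positive part of the accumulated vector grows at most linearly
  in \<open>t\<close>, so that of the average is of order 1/t.\<close>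

lemma approachability_average:
  fixes v :: "'e \<Rightarrow> nat \<Rightarrow> real"
  assumes bd: "\<And>e l. e \<in> P \<Longrightarrow> \<bar>v e l\<bar> \<le> B"
    and H: "\<And>w. (\<And>l. 0 \<le> w l) \<Longrightarrow> \<exists>e\<in>P. (\<Sum>l<r. w l * v e l) \<le> 1"
    and \<epsilon>: "0 < \<epsilon>"
  obtains t :: nat and e where "0 < t" "\<And>s. s < t \<Longrightarrow> e s \<in> P"
    "\<And>l. l < r \<Longrightarrow> (\<Sum>s<t. v (e s) l) / real t \<le> \<epsilon>"
proof -
  define K where "K = real r * B\<^sup>2 + 2"
  \<comment> \<open>Chosen so that the bound \<open>t * K\<close> on the squared norm is at most the
    square of \<open>\<epsilon> * t\<close>.\<close>
  obtain t where t: "K / \<epsilon>\<^sup>2 < real t" using reals_Archimedean2 by blast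
  have "0 < K" unfolding K_def by (simp add: add_nonneg_pos)
  then have "0 < K / \<epsilon>\<^sup>2" using \<epsilon> by simp
  then have t0: "0 < real t" using t by linarith
  obtain e where e: "\<And>s. s < t \<Longrightarrow> e s \<in> P"
    "(\<Sum>l<r. (max 0 (\<Sum>s<t. v (e s) l))\<^sup>2) \<le> real t * K"
    using approachability[of P v B r t] bd H unfolding K_def by blast
  show ?thesis
  proof (rule that[of t e])
    fix l assume l: "l < r"
    let ?S = "\<Sum>s<t. v (e s) l"
    have "(max 0 ?S)\<^sup>2 \<le> (\<Sum>l<r. (max 0 (\<Sum>s<t. v (e s) l))\<^sup>2)"
      using l by (intro member_le_sum[of l "{..<r}" "\<lambda>l. (max 0 (\<Sum>s<t. v (e s) l))\<^sup>2"]) auto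
    also have "\<dots> \<le> real t * K" by (rule e)
    also have "\<dots> \<le> real t * (\<epsilon>\<^sup>2 * real t)"
      using t \<epsilon> by (intro mult_left_mono) (auto simp: field_simps)
    also have "\<dots> = (\<epsilon> * real t)\<^sup>2" by (simp add: power2_eq_square)
    finally have "max 0 ?S \<le> \<epsilon> * real t"
      by (rule power2_le_imp_le) (use \<epsilon> t0 in simp)
    then show "?S / real t \<le> \<epsilon>" using t0 by (simp add: field_simps)
  qed (use t0 e in auto)
qed

text \<open>The case distinction is needed because \<^term>\<open>infdist z {}\<close> is 0.\<close>

definition tent :: "'z::metric_space set \<Rightarrow> nat \<Rightarrow> 'z \<Rightarrow> real" where
  "tent U k z = (if U = UNIV then 1 else min 1 (real k * infdist z (- U)))"

lemma tent:
  shows "continuous_on S (tent U k)" "0 \<le> tent U k z" "tent U k z \<le> 1" "tent U k z \<le> indicator U z"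
proof -
  show "continuous_on S (tent U k)"
    unfolding tent_def by (cases "U = UNIV") (auto intro!: continuous_intros)
qed (auto simp: tent_def indicator_def infdist_nonneg)

lemma tent_LIMSEQ:
  assumes "open U"
  shows "(\<lambda>k. tent U k z) \<longlonglongrightarrow> indicator U z"
proof (cases "U = UNIV \<or> z \<notin> U")
  case True
  then show ?thesis by (cases "U = UNIV") (auto simp: tent_def)
next
  case False
  then have d: "0 < infdist z (- U)"
    using assms by (intro infdist_pos_not_in_closed) auto
  obtain k0 where "1 / infdist z (- U) < real k0" using reals_Archimedean2 by blast
  then have "1 \<le> real k * infdist z (- U)" if "k \<ge> k0" for k
  proof -
    have "1 / infdist z (- U) \<le> real k" using \<open>1 / infdist z (- U) < real k0\<close> that by linarith
    then show ?thesis using d by (simp add: field_simps)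
  qed
  then have "eventually (\<lambda>k. tent U k z = indicator U z) sequentially"
    using False unfolding eventually_sequentially tent_def by (intro exI[of _ k0]) auto
  then show ?thesis by (rule tendsto_eventually)
qed

text \<open>Tents increase to the indicator of a finite union of basis sets, finite unions increase
  to an open set, and outer regularity reaches Borel sets. So countably many continuous test
  functions decide domination.\<close>

lemma measure_dominated_openI:
  fixes \<eta> :: "'e measure" and q :: "'i \<Rightarrow> 'e \<Rightarrow> 'z::polish_space"
  assumes \<eta>: "finite_measure \<eta>" and \<pi>: "finite_measure \<pi>" and sets[measurable_cong]: "sets \<pi> = sets borel"
    and I: "finite I" and q[measurable]: "\<And>i. q i \<in> \<eta> \<rightarrow>\<^sub>M borel"
    and Bs: "topological_basis Bs" "countable Bs"
    and le: "\<And>F k. finite F \<Longrightarrow> F \<subseteq> Bs \<Longrightarrow>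
       a * (\<Sum>i\<in>I. \<integral>e. tent (\<Union>F) k (q i e) \<partial>\<eta>) \<le> (\<integral>z. tent (\<Union>F) k z \<partial>\<pi>)"
    and a: "0 \<le> a" and B: "B \<in> sets borel"
  shows "ennreal a * (\<Sum>i\<in>I. emeasure \<eta> (q i -` B \<inter> space \<eta>)) \<le> emeasure \<pi> B"
proof -
  interpret \<eta>: finite_measure \<eta> by fact
  interpret \<pi>: finite_measure \<pi> by fact
  have tm[measurable]: "tent U k \<in> borel_measurable borel" for U :: "'z set" and k
    by (intro borel_measurable_continuous_onI tent)
  have fin: "a * (\<Sum>i\<in>I. measure \<eta> (q i -` (\<Union>F) \<inter> space \<eta>)) \<le> measure \<pi> (\<Union>F)"
    if F: "finite F" "F \<subseteq> Bs" for F
  proof -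
    let ?U = "\<Union>F"
    have U: "open ?U" using F(2) topological_basis_open[OF Bs(1)] by blast
    have [measurable]: "?U \<in> sets borel" using U by simp
    have "(\<lambda>k. \<integral>e. tent ?U k (q i e) \<partial>\<eta>) \<longlonglongrightarrow> (\<integral>e. indicat_real ?U (q i e) \<partial>\<eta>)" for i
      by (rule integral_dominated_convergence[where w="\<lambda>_. 1"]) (auto simp: tent_LIMSEQ[OF U] tent)
    moreover have "(\<integral>e. indicat_real ?U (q i e) \<partial>\<eta>) = measure \<eta> (q i -` ?U \<inter> space \<eta>)" for i
    proof -
      have "(\<integral>e. indicat_real ?U (q i e) \<partial>\<eta>) = (\<integral>e. indicat_real (q i -` ?U \<inter> space \<eta>) e \<partial>\<eta>)"
        by (intro Bochner_Integration.integral_cong) (auto simp: indicator_def)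
      then show ?thesis by simp
    qed
    ultimately have "(\<lambda>k. a * (\<Sum>i\<in>I. \<integral>e. tent ?U k (q i e) \<partial>\<eta>)) \<longlonglongrightarrow>
        a * (\<Sum>i\<in>I. measure \<eta> (q i -` ?U \<inter> space \<eta>))"
      by (intro tendsto_intros) simp
    moreover have "a * (\<Sum>i\<in>I. \<integral>e. tent ?U k (q i e) \<partial>\<eta>) \<le> measure \<pi> ?U" for k
    proof -
      have "(\<integral>z. tent ?U k z \<partial>\<pi>) \<le> (\<integral>z. indicator ?U z \<partial>\<pi>)"
      proof (rule integral_mono)
        show "integrable \<pi> (tent ?U k)"
          by (rule \<pi>.integrable_const_bound[where B=1]) (auto simp: tent)
        show "integrable \<pi> (indicat_real ?U)"
          by (rule \<pi>.integrable_const_bound[where B=1]) auto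
      qed (rule tent)
      also have "\<dots> = measure \<pi> ?U" using sets_eq_imp_space_eq[OF sets] by simp
      finally show ?thesis using le[OF F, of k] by linarith
    qed
    ultimately show ?thesis by (intro LIMSEQ_le_const2) auto
  qed
  have op: "a * (\<Sum>i\<in>I. measure \<eta> (q i -` U \<inter> space \<eta>)) \<le> measure \<pi> U" if U: "open U" for U
  proof -
    obtain G where G: "G \<subseteq> Bs" "\<Union>G = U"
      using Bs(1) U unfolding topological_basis_def by blast
    show ?thesis
    proof (cases "G = {}")
      case True
      then show ?thesis using G by simp
    next
      case False
      have cG: "countable G" using G(1) Bs(2) by (rule countable_subset)
      define V where "V n = \<Union>(from_nat_into G ` {..<n})" for n
      have opV: "open (V n)" for n
        unfolding V_def using G(1) from_nat_into[OF False] topological_basis_open[OF Bs(1)] by blast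
      have inc: "incseq V" unfolding V_def by (intro incseq_SucI Union_mono image_mono) auto
      have UV: "(\<Union>n. V n) = U"
      proof -
        have "(\<Union>n. V n) = \<Union>(range (from_nat_into G))" unfolding V_def by auto
        also have "range (from_nat_into G) = G" using range_from_nat_into[OF False cG] .
        finally show ?thesis using G(2) by simp
      qed
      have [measurable]: "V n \<in> sets borel" for n using opV by simp
      have "(\<lambda>n. measure \<eta> (q i -` V n \<inter> space \<eta>)) \<longlonglongrightarrow> measure \<eta> (\<Union>n. q i -` V n \<inter> space \<eta>)" for i
        by (rule \<eta>.finite_Lim_measure_incseq) (use inc in \<open>auto simp: incseq_def le_fun_def intro!: measurable_sets[OF q]\<close>)
      moreover have "(\<Union>n. q i -` V n \<inter> space \<eta>) = q i -` U \<inter> space \<eta>" for i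
        unfolding UV[symmetric] by auto
      ultimately have "(\<lambda>n. a * (\<Sum>i\<in>I. measure \<eta> (q i -` V n \<inter> space \<eta>))) \<longlonglongrightarrow>
          a * (\<Sum>i\<in>I. measure \<eta> (q i -` U \<inter> space \<eta>))"
        by (intro tendsto_intros) simp
      moreover have "(\<lambda>n. measure \<pi> (V n)) \<longlonglongrightarrow> measure \<pi> U"
        unfolding UV[symmetric] by (rule \<pi>.finite_Lim_measure_incseq) (use inc in \<open>auto simp: sets\<close>)
      moreover have "a * (\<Sum>i\<in>I. measure \<eta> (q i -` V n \<inter> space \<eta>)) \<le> measure \<pi> (V n)" for n
        unfolding V_def using G(1) from_nat_into[OF False] by (intro fin) auto
      ultimately show ?thesis by (intro LIMSEQ_le) auto
    qed
  qed
  have "emeasure \<pi> B = (INF U \<in> {U. B \<subseteq> U \<and> open U}. emeasure \<pi> U)"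
    by (rule outer_regular) (use B sets in auto)
  also have "ennreal a * (\<Sum>i\<in>I. emeasure \<eta> (q i -` B \<inter> space \<eta>)) \<le> \<dots>"
  proof (rule INF_greatest)
    fix U assume "U \<in> {U. B \<subseteq> U \<and> open U}"
    then have U: "B \<subseteq> U" "open U" by auto
    have "ennreal a * (\<Sum>i\<in>I. emeasure \<eta> (q i -` B \<inter> space \<eta>)) \<le>
        ennreal a * (\<Sum>i\<in>I. emeasure \<eta> (q i -` U \<inter> space \<eta>))"
      using U by (intro mult_left_mono sum_mono emeasure_mono) (auto intro!: measurable_sets[OF q])
    also have "\<dots> = ennreal (a * (\<Sum>i\<in>I. measure \<eta> (q i -` U \<inter> space \<eta>)))"
      using a by (simp add: \<eta>.emeasure_eq_measure ennreal_mult sum_nonneg)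
    also have "\<dots> \<le> emeasure \<pi> U"
      using op[OF U(2)] by (simp add: \<pi>.emeasure_eq_measure ennreal_leI)
    finally show "ennreal a * (\<Sum>i\<in>I. emeasure \<eta> (q i -` B \<inter> space \<eta>)) \<le> emeasure \<pi> U" .
  qed
  finally show ?thesis .
qed

text \<open>Each test function is one linear constraint on \<eta>. Any nonnegative combination of
  constraints is nearly satisfied at some point of \<open>C\<close>, as otherwise it would yield a
  cover of integral less than \<open>a\<close>. Approachability then gives empirical measures that
  satisfy the first \<open>r\<close> constraints up to 1/(r+1), and \<eta> is a weak limit of
  them.\<close>

lemma ex_dual_measure_compact_real:
  fixes C :: "real set" and p :: "'i \<Rightarrow> real \<Rightarrow> 'z::polish_space"
  assumes fin: "finite_measure \<pi>" and sets[measurable_cong]: "sets \<pi> = sets borel" and I: "finite I"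
    and C: "compact C" and cont: "\<And>i. i \<in> I \<Longrightarrow> continuous_on C (p i)" and a: "0 < a"
    and H: "\<And>f. continuous_on UNIV f \<Longrightarrow> (\<And>z. 0 \<le> f z) \<Longrightarrow> (\<And>z. f z \<le> 1) \<Longrightarrow>
       (\<And>t. t \<in> C \<Longrightarrow> 1 \<le> (\<Sum>i\<in>I. f (p i t))) \<Longrightarrow> a \<le> (\<integral>z. f z \<partial>\<pi>)"
  obtains \<eta> where "real_distribution \<eta>" "emeasure \<eta> (- C) = 0"
    "\<And>B. B \<in> sets borel \<Longrightarrow> ennreal a * (\<Sum>i\<in>I. emeasure \<eta> (p i -` B \<inter> C)) \<le> emeasure \<pi> B"
proof -
  interpret \<pi>: finite_measure \<pi> by fact
  have ne: "C \<noteq> {}" using H[of "\<lambda>_. 0"] a by fastforce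
  have clC: "closed C" using C by (rule compact_imp_closed)
  obtain Bs :: "'z set set" where Bs: "countable Bs" "topological_basis Bs" using ex_countable_basis by blast
  \<comment> \<open>Finite unions are included because domination on the basis sets alone would say
    nothing about unions of overlapping ones.\<close>
  define \<F> where "\<F> = (\<lambda>(F, k). tent (\<Union>F) k) ` ({F. finite F \<and> F \<subseteq> Bs} \<times> (UNIV :: nat set))"
  have "countable \<F>" unfolding \<F>_def
    by (intro countable_image countable_SIGMA countable_Collect_finite_subset Bs) auto
  moreover have "\<F> \<noteq> {}" unfolding \<F>_def by auto
  ultimately obtain \<phi> :: "nat \<Rightarrow> 'z \<Rightarrow> real" where \<phi>: "range \<phi> = \<F>"
    by (metis range_from_nat_into)
  have \<phi>_tent: "\<exists>F k. finite F \<and> F \<subseteq> Bs \<and> \<phi> l = tent (\<Union>F) k" for l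
  proof -
    have "\<phi> l \<in> \<F>" using \<phi> by blast
    then show ?thesis by (auto simp: \<F>_def)
  qed
  have \<phi>c: "continuous_on S (\<phi> l)" and \<phi>01: "0 \<le> \<phi> l z" "\<phi> l z \<le> 1" for S l z
    using \<phi>_tent[of l] tent(1)[of S] tent(2,3) by auto
  have [measurable]: "\<phi> l \<in> borel_measurable borel" for l
    by (rule borel_measurable_continuous_onI[OF \<phi>c])
  have \<phi>int: "integrable \<pi> (\<phi> l)" for l
    by (rule \<pi>.integrable_const_bound[where B=1]) (auto simp: \<phi>01)
  define b where "b l = (\<integral>z. \<phi> l z \<partial>\<pi>) / a" for l
  have b0: "0 \<le> b l" for l unfolding b_def using a \<phi>01 by auto
  define \<Phi> where "\<Phi> l t = (\<Sum>i\<in>I. \<phi> l (p i t))" for l t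
  have \<Phi>0: "0 \<le> \<Phi> l t" "\<Phi> l t \<le> card I" for l t
    unfolding \<Phi>_def using \<phi>01 sum_bounded_above[of I "\<lambda>i. \<phi> l (p i t)" 1] by (auto intro: sum_nonneg)
  have \<Phi>c: "continuous_on C (\<Phi> l)" for l
    unfolding \<Phi>_def by (intro continuous_on_sum continuous_on_compose2[OF \<phi>c[of UNIV] cont]) auto
  have ble: "b l \<le> measure \<pi> (space \<pi>) / a" for l
  proof -
    have "(\<integral>z. \<phi> l z \<partial>\<pi>) \<le> (\<integral>z. 1 \<partial>\<pi>)" by (intro integral_mono \<phi>int \<phi>01) auto
    then show ?thesis unfolding b_def using a by (intro divide_right_mono) auto
  qed
  \<comment> \<open>If the weighted excess were above 1 everywhere on \<open>C\<close>, the
    combination \<open>f\<close> would exceed \<open>Q\<close> in every covering sum, so that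
    \<open>f / Q\<close>, clipped, would be a cover. The slack 1 enters \<open>Q\<close>: it keeps
    \<open>Q\<close> positive and makes the integral, at most a (Q - 1) / Q, strictly less than
    \<open>a\<close>.\<close>
  have play: "\<exists>t\<in>C. (\<Sum>l<r. w l * (\<Phi> l t - b l)) \<le> 1" if w: "\<And>l. 0 \<le> w l" for w r
  proof (rule ccontr)
    assume neg: "\<not> ?thesis"
    define f where "f z = (\<Sum>l<r. w l * \<phi> l z)" for z
    have fc: "continuous_on UNIV f" unfolding f_def by (intro continuous_intros \<phi>c)
    have f0: "0 \<le> f z" for z unfolding f_def by (intro sum_nonneg mult_nonneg_nonneg w \<phi>01)
    have fint: "integrable \<pi> f" unfolding f_def using \<phi>int by auto
    have fb: "(\<integral>z. f z \<partial>\<pi>) = a * (\<Sum>l<r. w l * b l)"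
      unfolding f_def b_def using \<phi>int a by (simp add: sum_distrib_left)
    define Q where "Q = (\<Sum>l<r. w l * b l) + 1"
    have Q: "1 \<le> Q" unfolding Q_def using w b0 by (simp add: sum_nonneg)
    have gt: "Q < (\<Sum>i\<in>I. f (p i t))" if "t \<in> C" for t
    proof -
      have "(\<Sum>l<r. w l * (\<Phi> l t - b l)) > 1" using neg that by auto
      moreover have "(\<Sum>l<r. w l * \<Phi> l t) = (\<Sum>i\<in>I. f (p i t))"
        unfolding f_def \<Phi>_def sum_distrib_left by (rule sum.swap)
      ultimately show ?thesis by (simp add: Q_def right_diff_distrib sum_subtractf)
    qed
    define g where "g z = min 1 (f z / Q)" for z
    have gc: "continuous_on UNIV g" unfolding g_def using Q by (intro continuous_intros fc) auto
    have g01: "0 \<le> g z" "g z \<le> 1" for z unfolding g_def using f0 Q by auto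
    have "a \<le> (\<integral>z. g z \<partial>\<pi>)"
    proof (rule H[OF gc g01])
      fix t assume t: "t \<in> C"
      show "1 \<le> (\<Sum>i\<in>I. g (p i t))"
        unfolding g_def by (rule sum_clip_ge_1[OF I f0]) (use gt[OF t] Q in auto)
    qed
    also have "(\<integral>z. g z \<partial>\<pi>) \<le> (\<integral>z. f z / Q \<partial>\<pi>)"
    proof (rule integral_mono)
      have "g \<in> borel_measurable borel" using gc by (rule borel_measurable_continuous_onI)
      then have "g \<in> borel_measurable \<pi>" by simp
      then show "integrable \<pi> g" by (rule integrable_unit_interval[OF fin _ g01])
    qed (use fint in \<open>auto simp: g_def\<close>)
    also have "\<dots> = a * (Q - 1) / Q" using fb by (simp add: Q_def)
    also have "\<dots> < a" using a Q by (simp add: field_simps)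
    finally show False by simp
  qed
  have "\<exists>e n. 0 < (n::nat) \<and> (\<forall>s<n. e s \<in> C) \<and> (\<forall>l<r. (\<Sum>s<n. \<Phi> l (e s) - b l) / real n \<le> 1 / real (Suc r))" for r
  proof -
    have "\<bar>\<Phi> l t - b l\<bar> \<le> card I + measure \<pi> (space \<pi>) / a" for l t
      using \<Phi>0[of l t] b0[of l] ble[of l] a by (simp add: abs_le_iff)
    from approachability_average[of C "\<lambda>t l. \<Phi> l t - b l", OF this play, of "1 / real (Suc r)" r]
    show ?thesis by (metis of_nat_0_less_iff zero_less_Suc zero_less_divide_1_iff)
  qed
  then obtain e n where n: "\<And>r. 0 < (n r :: nat)" and eC: "\<And>r s. s < n r \<Longrightarrow> e r s \<in> C"
    and e\<Phi>: "\<And>r l. l < r \<Longrightarrow> (\<Sum>s<n r. \<Phi> l (e r s) - b l) / real (n r) \<le> 1 / real (Suc r)"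
    by metis
  define M where "M r = distr (measure_pmf (pmf_of_set {..<n r})) borel (e r)" for r
  have M: "real_distribution (M r)" for r unfolding M_def by (intro prob_space.real_distribution_distr prob_space_measure_pmf) simp
  have intM: "(\<integral>x. h x \<partial>M r) = (\<Sum>s<n r. h (e r s)) / real (n r)"
    if [measurable]: "h \<in> borel_measurable borel" for h :: "real \<Rightarrow> real" and r
    unfolding M_def using n[of r]
    by (subst integral_distr, simp, simp, subst integral_pmf_of_set) (auto simp: lessThan_empty_iff)
  have MC: "AE x in M r. x \<in> C" for r
  proof -
    have "set_pmf (pmf_of_set {..<n r}) = {..<n r}" by (rule set_pmf_of_set) (use n[of r] in auto)
    then show ?thesis
      unfolding M_def using clC eC by (subst AE_distr_iff) (auto simp: AE_measure_pmf_iff)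
  qed
  obtain N where N: "\<And>x. x \<in> C \<Longrightarrow> norm x < N" "0 < N"
    using compact_imp_bounded[OF C] unfolding bounded_pos_less by blast
  have "tight M" unfolding tight_def
  proof (intro conjI allI impI M)
    fix \<epsilon> :: real assume "0 < \<epsilon>"
    have "measure (M r) {-N<..N} = 1" for r
    proof -
      interpret real_distribution "M r" by (rule M)
      have "AE x in M r. x \<in> {-N<..N}"
        using MC[of r] by eventually_elim (use N(1) in \<open>fastforce simp: abs_less_iff\<close>)
      then show ?thesis by (subst prob_eq_1) auto
    qed
    then show "\<exists>a b. a < b \<and> (\<forall>r. 1 - \<epsilon> < measure (M r) {a<..b})"
      using N(2) \<open>0 < \<epsilon>\<close> by (intro exI[of _ "-N"] exI[of _ N]) auto
  qed
  from tight_imp_convergent_subsubsequence[OF this strict_mono_id]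
  obtain r \<eta> where r: "strict_mono (r :: nat \<Rightarrow> nat)" "real_distribution \<eta>" "weak_conv_m (M \<circ> r) \<eta>"
    by (auto simp: comp_def)
  interpret \<eta>: real_distribution \<eta> by fact
  have lim: "(\<lambda>k. \<integral>x. h x \<partial>M (r k)) \<longlonglongrightarrow> (\<integral>x. h x \<partial>\<eta>)"
    if h: "continuous_on UNIV h" "\<And>x. norm (h x) \<le> K" for h :: "real \<Rightarrow> real" and K
    using weak_conv_imp_integral_bdd_continuous_conv[of "M \<circ> r" \<eta> h K] r M h
    by (auto simp: comp_def continuous_on_eq_continuous_at)
  have [measurable]: "(\<lambda>x. infdist x C) \<in> borel_measurable borel"
    by (intro borel_measurable_continuous_onI continuous_intros)
  \<comment> \<open>The truncated distance to \<open>C\<close> is bounded and continuous and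
    vanishes almost surely under each empirical measure, so the weak limit is also concentrated on
    the closed set \<open>C\<close>.\<close>
  have "(\<lambda>k. \<integral>x. min 1 (infdist x C) \<partial>M (r k)) \<longlonglongrightarrow> (\<integral>x. min 1 (infdist x C) \<partial>\<eta>)"
    by (rule lim[of _ 1]) (auto intro!: continuous_intros simp: infdist_nonneg)
  moreover have "(\<integral>x. min 1 (infdist x C) \<partial>M (r k)) = 0" for k
    by (rule integral_eq_zero_AE) (use MC[of "r k"] in \<open>eventually_elim, simp\<close>)
  ultimately have "(\<integral>x. min 1 (infdist x C) \<partial>\<eta>) = 0"
    by (simp add: LIMSEQ_const_iff)
  moreover have "integrable \<eta> (\<lambda>x. min 1 (infdist x C))"
    by (rule \<eta>.integrable_const_bound[where B=1]) (auto simp: infdist_nonneg)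
  ultimately have "AE x in \<eta>. min 1 (infdist x C) = 0"
    by (subst (asm) integral_nonneg_eq_0_iff_AE) (auto simp: infdist_nonneg)
  then have \<eta>C: "AE x in \<eta>. x \<in> C"
    by eventually_elim (use clC ne in \<open>auto simp: in_closed_iff_infdist_zero min_def split: if_splits\<close>)
  obtain c where c: "c \<in> C" using ne by blast
  \<comment> \<open>The maps \<open>p i\<close> are controlled only on \<open>C\<close>; a constant
    value elsewhere gives Borel maps on the whole line without changing anything \<eta>-almost
    everywhere.\<close>
  define q where "q i t = (if i \<in> I \<and> t \<in> C then p i t else p i c)" for i t
  have qm[measurable]: "q i \<in> borel_measurable borel" for i
  proof (cases "i \<in> I")
    case True
    have "(\<lambda>t. if t \<in> C then p i t else p i c) \<in> borel_measurable borel"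
      by (rule borel_measurable_continuous_on_if) (use clC cont True in auto)
    then show ?thesis using True by (simp add: q_def[abs_def])
  qed (simp add: q_def[abs_def])
  have int_le: "a * (\<Sum>i\<in>I. \<integral>t. \<phi> l (q i t) \<partial>\<eta>) \<le> (\<integral>z. \<phi> l z \<partial>\<pi>)" for l
  proof -
    \<comment> \<open>Weak convergence tests functions that are continuous on the whole line,
      whereas \<Phi> is continuous only on \<open>C\<close>. A Tietze extension has the same
      integrals, since all measures involved live on \<open>C\<close>.\<close>
    obtain h where h: "continuous_on UNIV h" "\<And>x. x \<in> C \<Longrightarrow> h x = \<Phi> l x" "\<And>x. norm (h x) \<le> card I"
      by (rule Tietze[OF \<Phi>c[of l], of UNIV "card I"]) (use clC \<Phi>0 in auto)
    have hm: "h \<in> borel_measurable borel" by (rule borel_measurable_continuous_onI[OF h(1)])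
    have le: "(\<integral>x. h x \<partial>M (r k)) \<le> b l + 1 / real (Suc k)" if "l < k" for k
    proof -
      have k: "k \<le> r k" by (rule seq_suble[OF r(1)])
      have "(\<integral>x. h x \<partial>M (r k)) = (\<Sum>s<n (r k). \<Phi> l (e (r k) s)) / real (n (r k))"
        unfolding intM[OF hm] using eC by (simp add: h(2))
      also have "\<dots> = b l + (\<Sum>s<n (r k). \<Phi> l (e (r k) s) - b l) / real (n (r k))"
        using n[of "r k"] by (simp add: sum_subtractf diff_divide_distrib)
      also have "(\<Sum>s<n (r k). \<Phi> l (e (r k) s) - b l) / real (n (r k)) \<le> 1 / real (Suc (r k))"
        using that k by (intro e\<Phi>) auto
      also have "1 / real (Suc (r k)) \<le> 1 / real (Suc k)" using k by (intro divide_left_mono) auto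
      finally show ?thesis by simp
    qed
    have lim_h: "(\<lambda>k. \<integral>x. h x \<partial>M (r k)) \<longlonglongrightarrow> (\<integral>x. h x \<partial>\<eta>)" by (rule lim[OF h(1,3)])
    have "(\<lambda>k. b l + 1 / real (Suc k)) \<longlonglongrightarrow> b l + 0"
      by (intro tendsto_intros LIMSEQ_inverse_real_of_nat[unfolded inverse_eq_divide])
    moreover have "\<exists>K. \<forall>k\<ge>K. (\<integral>x. h x \<partial>M (r k)) \<le> b l + 1 / real (Suc k)"
      by (rule exI[of _ "Suc l"]) (use le in auto)
    ultimately have "(\<integral>x. h x \<partial>\<eta>) \<le> b l + 0"
      by (rule LIMSEQ_le[OF lim_h])
    then have "(\<integral>x. h x \<partial>\<eta>) \<le> b l" by simp
    moreover have "(\<integral>x. h x \<partial>\<eta>) = (\<integral>x. (\<Sum>i\<in>I. \<phi> l (q i x)) \<partial>\<eta>)"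
    proof (rule integral_cong_AE)
      show "AE x in \<eta>. h x = (\<Sum>i\<in>I. \<phi> l (q i x))"
        using \<eta>C by eventually_elim (simp add: h(2) \<Phi>_def q_def)
    qed (use hm in measurable)
    moreover have "(\<integral>x. (\<Sum>i\<in>I. \<phi> l (q i x)) \<partial>\<eta>) = (\<Sum>i\<in>I. \<integral>t. \<phi> l (q i t) \<partial>\<eta>)"
      by (intro Bochner_Integration.integral_sum \<eta>.integrable_const_bound[where B=1]) (auto simp: \<phi>01)
    ultimately show ?thesis unfolding b_def using a by (simp add: field_simps)
  qed
  show ?thesis
  proof (rule that[of \<eta>])
    show "real_distribution \<eta>" by fact
    have "emeasure \<eta> (- C) = emeasure \<eta> {}"
      by (rule emeasure_eq_AE) (use \<eta>C clC in auto)
    then show "emeasure \<eta> (- C) = 0" by simp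
    fix B :: "'z set" assume B[measurable]: "B \<in> sets borel"
    have "ennreal a * (\<Sum>i\<in>I. emeasure \<eta> (q i -` B \<inter> space \<eta>)) \<le> emeasure \<pi> B"
    proof (rule measure_dominated_openI[OF _ fin sets I _ Bs(2,1) _ _ B])
      fix F :: "'z set set" and k :: nat assume "finite F" "F \<subseteq> Bs"
      then have "tent (\<Union>F) k \<in> \<F>" by (auto simp: \<F>_def)
      then obtain l where "tent (\<Union>F) k = \<phi> l" using \<phi> by (metis rangeE)
      then show "a * (\<Sum>i\<in>I. \<integral>t. tent (\<Union>F) k (q i t) \<partial>\<eta>) \<le> (\<integral>z. tent (\<Union>F) k z \<partial>\<pi>)"
        using int_le[of l] by simp
    qed (use a \<eta>.finite_measure_axioms in auto)
    moreover have "(\<Sum>i\<in>I. emeasure \<eta> (q i -` B \<inter> space \<eta>)) = (\<Sum>i\<in>I. emeasure \<eta> (p i -` B \<inter> C))"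
    proof (rule sum.cong)
      fix i assume i: "i \<in> I"
      have eq: "p i -` B \<inter> C = q i -` B \<inter> C" using i by (auto simp: q_def)
      have [measurable]: "C \<in> sets borel" using clC by simp
      have "q i -` B \<inter> C \<in> sets borel" using measurable_sets_borel[OF qm B, of i] by auto
      then show "emeasure \<eta> (q i -` B \<inter> space \<eta>) = emeasure \<eta> (p i -` B \<inter> C)"
        unfolding eq by (intro emeasure_eq_AE) (use \<eta>C measurable_sets_borel[OF qm B, of i] in auto)
    qed simp
    ultimately show "ennreal a * (\<Sum>i\<in>I. emeasure \<eta> (p i -` B \<inter> C)) \<le> emeasure \<pi> B" by simp
  qed
qed

text \<open>The cases are those of covering cost zero and positive. At cost zero, covers with
  summable energies tend to 0 off a null set, and a configuration avoiding that set could not keep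
  its covering sums at least 1.\<close>

theorem null_cover_or_dominated_measure:
  fixes A :: "(nat \<Rightarrow> real) set" and p :: "'i \<Rightarrow> (nat \<Rightarrow> real) \<Rightarrow> 'z::polish_space"
  assumes fin: "finite_measure \<pi>" and sets[measurable_cong]: "sets \<pi> = sets borel" and I: "finite I"
    and A: "A \<in> sets borel" and cont: "\<And>i. i \<in> I \<Longrightarrow> continuous_on UNIV (p i)"
  obtains (null) N where "N \<in> sets borel" "emeasure \<pi> N = 0" "\<And>e. e \<in> A \<Longrightarrow> \<exists>i\<in>I. p i e \<in> N"
  | (dominated) a \<eta> where "0 < a" "prob_space \<eta>" "sets \<eta> = sets borel" "AE e in \<eta>. e \<in> A"
      "\<And>B. B \<in> sets borel \<Longrightarrow> ennreal a * (\<Sum>i\<in>I. emeasure \<eta> (p i -` B)) \<le> emeasure \<pi> B"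
proof -
  obtain D :: "(nat \<Rightarrow> real) set" and g where D: "closed D" "continuous_on D g" "A = g ` D"
    using analytic_borel[OF A] unfolding analytic_def by blast
  \<comment> \<open>Covering \<open>A\<close> by the \<open>p i\<close> is the same as covering the
    parameter set \<open>D\<close> by the \<open>q i\<close>. The truncation to a compact part
    happens in \<open>D\<close>, as \<open>A\<close> itself need be neither closed nor a countable
    union of compact sets.\<close>
  define q where "q i \<sigma> = p i (g \<sigma>)" for i \<sigma>
  have qc: "continuous_on D (q i)" if "i \<in> I" for i
    unfolding q_def by (rule continuous_on_compose2[OF cont[OF that] D(2)]) auto
  show thesis
  proof (cases "\<forall>a>0. \<exists>f\<in>covers \<pi> I q D. (\<integral>z. (f z)\<^sup>2 \<partial>\<pi>) \<le> a")
    case True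
    \<comment> \<open>Energies (1/4)^k are summable, so the squares, and hence the covers, converge
      to 0 almost everywhere.\<close>
    then have "\<exists>f\<in>covers \<pi> I q D. (\<integral>z. (f z)\<^sup>2 \<partial>\<pi>) \<le> (1/4)^k" for k by simp
    then obtain f where f: "\<And>k. f k \<in> covers \<pi> I q D" "\<And>k. (\<integral>z. (f k z)\<^sup>2 \<partial>\<pi>) \<le> (1/4)^k"
      by metis
    note fD = coversD[OF f(1)]
    have "AE z in \<pi>. summable (\<lambda>k. (f k z)\<^sup>2)"
      by (rule AE_summable_of_summable_integral[OF _ _ summable_geometric f(2)])
         (use integrable_unit_interval(2)[OF fin fD(1,2,3)] in auto)
    then have "AE z in \<pi>. (\<lambda>k. f k z) \<longlonglongrightarrow> 0"
    proof eventually_elim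
      case (elim z)
      then have "(\<lambda>k. sqrt ((f k z)\<^sup>2)) \<longlonglongrightarrow> sqrt 0"
        by (intro tendsto_real_sqrt summable_LIMSEQ_zero)
      then show ?case using fD(2) by simp
    qed
    then obtain N where N: "{z\<in>space \<pi>. \<not> (\<lambda>k. f k z) \<longlonglongrightarrow> 0} \<subseteq> N" "emeasure \<pi> N = 0" "N \<in> sets \<pi>"
      by (rule AE_E)
    show thesis
    proof (rule null[of N])
      fix e assume "e \<in> A"
      then obtain \<sigma> where \<sigma>: "\<sigma> \<in> D" "e = g \<sigma>" using D(3) by blast
      show "\<exists>i\<in>I. p i e \<in> N"
      proof (rule ccontr)
        assume "\<not> ?thesis"
        then have "(\<lambda>k. f k (q i \<sigma>)) \<longlonglongrightarrow> 0" if "i \<in> I" for i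
          using N(1) sets_eq_imp_space_eq[OF sets] \<sigma> that unfolding q_def by auto
        then have "(\<lambda>k. \<Sum>i\<in>I. f k (q i \<sigma>)) \<longlonglongrightarrow> (\<Sum>i\<in>I. 0)" by (intro tendsto_sum)
        moreover have "1 \<le> (\<Sum>i\<in>I. f k (q i \<sigma>))" for k using fD(4)[OF \<sigma>(1)] .
        ultimately have "1 \<le> (\<Sum>i\<in>I. 0 :: real)" by (intro LIMSEQ_le_const) auto
        then show False by simp
      qed
    qed (use N sets in auto)
  next
    case False
    then obtain a where a: "0 < a" "\<not> (\<exists>f\<in>covers \<pi> I q D. (\<integral>z. (f z)\<^sup>2 \<partial>\<pi>) \<le> a)" by blast
    obtain m :: "nat \<Rightarrow> nat" where m:
      "\<And>f. continuous_on UNIV f \<Longrightarrow> (\<And>z. 0 \<le> f z) \<Longrightarrow> (\<And>z. f z \<le> 1) \<Longrightarrow>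
       (\<And>\<sigma>. \<sigma> \<in> D \<Longrightarrow> (\<forall>i. \<bar>\<sigma> i\<bar> \<le> m i) \<Longrightarrow> 1 \<le> (\<Sum>i\<in>I. f (q i \<sigma>))) \<Longrightarrow>
       a \<le> (\<integral>z. f z \<partial>\<pi>)"
      by (rule compact_part_not_covered[OF fin sets I D(1) qc a]) blast+
    obtain C :: "real set" and h :: "real \<Rightarrow> nat \<Rightarrow> real"
      where C: "compact C" "continuous_on C h" "h ` C = {\<tau>. \<forall>i. \<bar>\<tau> i\<bar> \<le> real (m i)}"
      by (rule box_fun_continuous_image[of "\<lambda>i. real (m i)"]) auto
    \<comment> \<open>The part of the box that lies in \<open>D\<close>, pulled back to the real
      line; it is compact since \<open>D\<close> is closed.\<close>
    define C' where "C' = C \<inter> h -` D"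
    have clC': "closed C'" unfolding C'_def
      by (rule continuous_closed_preimage[OF C(2) compact_imp_closed[OF C(1)] D(1)])
    then have cC': "compact C'"
      using C(1) compact_Int_closed[of C C'] by (simp add: C'_def Int_absorb1 Int_assoc[symmetric])
    have ghc: "continuous_on C' (\<lambda>t. g (h t))"
      by (rule continuous_on_compose2[OF D(2) continuous_on_subset[OF C(2)]]) (auto simp: C'_def)
    have contC': "continuous_on C' (\<lambda>t. p i (g (h t)))" if "i \<in> I" for i
      by (rule continuous_on_compose2[OF cont[OF that] ghc]) auto
    have covC': "a \<le> (\<integral>z. f z \<partial>\<pi>)"
      if f: "continuous_on UNIV f" "\<And>z. 0 \<le> f z" "\<And>z. f z \<le> 1"
        and cov: "\<And>t. t \<in> C' \<Longrightarrow> 1 \<le> (\<Sum>i\<in>I. f (p i (g (h t))))" for f :: "'z \<Rightarrow> real"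
    proof (rule m[OF f])
      fix \<sigma> assume s: "\<sigma> \<in> D" "\<forall>i. \<bar>\<sigma> i\<bar> \<le> real (m i)"
      then have "\<sigma> \<in> h ` C" using C(3) by blast
      then show "1 \<le> (\<Sum>i\<in>I. f (q i \<sigma>))" using cov s by (auto simp: C'_def q_def)
    qed
    obtain \<eta> where \<eta>: "real_distribution \<eta>" "emeasure \<eta> (- C') = 0"
      "\<And>B. B \<in> sets borel \<Longrightarrow> ennreal a * (\<Sum>i\<in>I. emeasure \<eta> ((\<lambda>t. p i (g (h t))) -` B \<inter> C')) \<le> emeasure \<pi> B"
      by (rule ex_dual_measure_compact_real[OF fin sets I cC' contC' a(1) covC']) blast+
    interpret \<eta>: real_distribution \<eta> by fact
    have \<eta>C: "AE t in \<eta>. t \<in> C'" using \<eta>(2) clC' by (intro AE_I[of _ _ "- C'"]) auto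
    \<comment> \<open>Outside the closed set \<open>C'\<close>, which carries all of \<eta>, the map
      \<open>g\<close> may be evaluated off \<open>D\<close> and be arbitrary there; a constant
      keeps \<theta> Borel.\<close>
    define \<theta> where "\<theta> t = (if t \<in> C' then g (h t) else undefined)" for t
    have \<theta>m[measurable]: "\<theta> \<in> borel \<rightarrow>\<^sub>M borel" unfolding \<theta>_def
      by (rule borel_measurable_continuous_on_if) (use clC' ghc in auto)
    show thesis
    proof (rule dominated[OF a(1)])
      show "prob_space (distr \<eta> borel \<theta>)" by (rule \<eta>.prob_space_distr) simp
      have "AE t in \<eta>. \<theta> t \<in> A"
        using \<eta>C by eventually_elim (auto simp: \<theta>_def C'_def D(3))
      then show "AE e in distr \<eta> borel \<theta>. e \<in> A"
        using A by (subst AE_distr_iff) auto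
      fix B :: "'z set" assume B: "B \<in> sets borel"
      have "emeasure (distr \<eta> borel \<theta>) (p i -` B) = emeasure \<eta> ((\<lambda>t. p i (g (h t))) -` B \<inter> C')" if "i \<in> I" for i
      proof -
        have pm: "p i \<in> borel_measurable borel" by (rule borel_measurable_continuous_onI[OF cont[OF that]])
        have pB: "p i -` B \<in> sets borel" using measurable_sets_borel[OF pm B] .
        have eq: "(\<lambda>t. p i (g (h t))) -` B \<inter> C' = \<theta> -` (p i -` B) \<inter> C'" by (auto simp: \<theta>_def)
        have tB: "\<theta> -` (p i -` B) \<in> sets borel" using measurable_sets_borel[OF \<theta>m pB] .
        show ?thesis unfolding eq using pB tB clC' \<eta>C
          by (subst emeasure_distr) (auto intro!: emeasure_eq_AE)
      qed
      then show "ennreal a * (\<Sum>i\<in>I. emeasure (distr \<eta> borel \<theta>) (p i -` B)) \<le> emeasure \<pi> B"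
        using \<eta>(3)[OF B] by simp
    qed simp
  qed
qed

section \<open>Disintegration\<close>

lemma AE_le_of_integrals_le:
  fixes f g :: "'a \<Rightarrow> ennreal"
  assumes [measurable]: "f \<in> borel_measurable M" "g \<in> borel_measurable M"
    and fin: "(\<integral>\<^sup>+x. f x \<partial>M) \<noteq> \<infinity>"
    and le: "\<And>A. A \<in> sets M \<Longrightarrow> (\<integral>\<^sup>+x\<in>A. f x \<partial>M) \<le> (\<integral>\<^sup>+x\<in>A. g x \<partial>M)"
  shows "AE x in M. f x \<le> g x"
proof -
  define A where "A = {x\<in>space M. g x < f x}"
  have [measurable]: "A \<in> sets M" unfolding A_def by measurable
  have gA: "(\<integral>\<^sup>+x\<in>A. g x \<partial>M) \<le> (\<integral>\<^sup>+x. f x \<partial>M)"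
    by (intro nn_integral_mono) (auto simp: A_def indicator_def)
  have "(\<integral>\<^sup>+x. f x * indicator A x - g x * indicator A x \<partial>M) = (\<integral>\<^sup>+x\<in>A. f x \<partial>M) - (\<integral>\<^sup>+x\<in>A. g x \<partial>M)"
    by (rule nn_integral_diff) (use gA fin in \<open>auto simp: A_def indicator_def top_unique\<close>)
  also have "\<dots> = 0" 
  proof (rule diff_eq_0_ennreal)
    have "(\<integral>\<^sup>+x\<in>A. f x \<partial>M) \<le> (\<integral>\<^sup>+x. f x \<partial>M)" by (intro nn_integral_mono) (auto simp: indicator_def)
    then show "(\<integral>\<^sup>+x\<in>A. f x \<partial>M) < top" using fin by (auto simp: top_unique less_top)
  qed (rule le, simp)
  finally have "AE x in M. f x * indicator A x - g x * indicator A x = 0"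
    by (subst (asm) nn_integral_0_iff_AE) auto
  with AE_space show ?thesis
  proof eventually_elim
    case (elim x)
    show ?case
    proof (rule ccontr)
      assume "\<not> ?thesis"
      then have "x \<in> A" using elim by (auto simp: A_def)
      then have "f x - g x = 0" using elim by simp
      then show False using \<open>x \<in> A\<close> by (auto simp: A_def diff_eq_0_iff_ennreal)
    qed
  qed
qed

text \<open>A distribution function recorded at rational arguments only, so that conditional
  versions have to be corrected on countably many null sets. Right continuity is not demanded;
  \<open>right_limit\<close> produces it. With monotonicity, the last condition gives the limits 0
  and 1 at the two ends.\<close>

definition rat_cdf :: "(rat \<Rightarrow> real) \<Rightarrow> bool" where
  "rat_cdf H \<longleftrightarrow> mono H \<and> (\<forall>q. 0 \<le> H q \<and> H q \<le> 1) \<and>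
     (\<forall>\<epsilon>>0. (\<exists>q. H q < \<epsilon>) \<and> (\<exists>q. 1 - \<epsilon> < H q))"

text \<open>The strict inequality is what makes the result right continuous, whatever the behaviour
  of \<open>H\<close> at a rational point itself.\<close>

definition right_limit :: "(rat \<Rightarrow> real) \<Rightarrow> real \<Rightarrow> real" where
  "right_limit H t = (INF q\<in>{q. t < of_rat q}. H q)"

lemma right_limit:
  assumes H: "rat_cdf H"
  shows right_limit_le: "t < of_rat q \<Longrightarrow> right_limit H t \<le> H q"
    and right_limit_greatest: "(\<And>q. t < of_rat q \<Longrightarrow> c \<le> H q) \<Longrightarrow> c \<le> right_limit H t"
    and right_limit_lessE: "right_limit H t < c \<Longrightarrow> \<exists>q. t < of_rat q \<and> H q < c"
proof -
  have bdd: "bdd_below (H ` S)" for S using H by (auto simp: rat_cdf_def intro!: bdd_belowI[of _ 0])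
  obtain q0 where q0: "t < of_rat q0" using of_rat_dense[of t "t + 1"] by auto
  show "t < of_rat q \<Longrightarrow> right_limit H t \<le> H q"
    unfolding right_limit_def by (rule cINF_lower[OF bdd]) simp
  show "(\<And>q. t < of_rat q \<Longrightarrow> c \<le> H q) \<Longrightarrow> c \<le> right_limit H t"
    unfolding right_limit_def using q0 by (intro cINF_greatest) auto
  show "right_limit H t < c \<Longrightarrow> \<exists>q. t < of_rat q \<and> H q < c"
    unfolding right_limit_def using q0 by (subst (asm) cINF_less_iff[OF _ bdd]) auto
qed

lemma rat_cdf_measure:
  assumes H: "rat_cdf H"
  shows "real_distribution (interval_measure (right_limit H))"
    and "emeasure (interval_measure (right_limit H)) {..t} = ennreal (right_limit H t)"
proof -
  note R = right_limit_le[OF H] right_limit_greatest[OF H] right_limit_lessE[OF H]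
  have H01: "0 \<le> H q" "H q \<le> 1" and Hmono: "q \<le> q' \<Longrightarrow> H q \<le> H q'" for q q'
    using H by (auto simp: rat_cdf_def mono_def)
  have mono: "right_limit H x \<le> right_limit H y" if "x \<le> y" for x y
    by (rule R(2)) (use that R(1)[of x] in auto)
  have R01: "0 \<le> right_limit H t" "right_limit H t \<le> 1" for t
  proof -
    show "0 \<le> right_limit H t" by (rule R(2)) (rule H01)
    obtain q0 where q0: "t < of_rat q0" using of_rat_dense[of t "t + 1"] by auto
    show "right_limit H t \<le> 1" using R(1)[OF q0] H01(2)[of q0] by linarith
  qed
  have rc: "continuous (at_right a) (right_limit H)" for a
    unfolding continuous_within
  proof (rule order_tendstoI)
    fix c assume c: "c < right_limit H a"
    show "\<forall>\<^sub>F x in at_right a. c < right_limit H x"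
      unfolding eventually_at_filter
      by (intro always_eventually allI impI) (auto intro: less_le_trans[OF c mono])
  next
    fix c assume "right_limit H a < c"
    then obtain q where q: "a < of_rat q" "H q < c" using R(3) by blast
    have "\<forall>\<^sub>F x in at_right a. x < real_of_rat q" using q(1) by (rule order_tendstoD[OF tendsto_ident_at])
    then show "\<forall>\<^sub>F x in at_right a. right_limit H x < c"
      by eventually_elim (use R(1) q(2) in \<open>fastforce intro: le_less_trans\<close>)
  qed
  have bot: "(right_limit H \<longlongrightarrow> 0) at_bot"
  proof (rule order_tendstoI)
    fix c :: real assume "0 < c"
    then obtain q where q: "H q < c" using H by (auto simp: rat_cdf_def)
    have "\<forall>\<^sub>F x in at_bot. x < real_of_rat q" by (rule eventually_gt_at_bot)
    then show "\<forall>\<^sub>F x in at_bot. right_limit H x < c"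
      by eventually_elim (use R(1) q in \<open>fastforce intro: le_less_trans\<close>)
  qed (use R01 in \<open>auto intro!: always_eventually intro: less_le_trans\<close>)
  have top: "(right_limit H \<longlongrightarrow> 1) at_top"
  proof (rule order_tendstoI)
    fix c :: real assume "c < 1"
    then obtain q where q: "c < H q" using H by (auto simp: rat_cdf_def dest: spec[of _ "1 - c"])
    have "\<forall>\<^sub>F x in at_top. real_of_rat q < x" by (rule eventually_gt_at_top)
    then show "\<forall>\<^sub>F x in at_top. c < right_limit H x"
    proof eventually_elim
      case (elim x)
      have "H q \<le> right_limit H x"
      proof (rule R(2))
        fix q' :: rat assume "x < of_rat q'"
        then have "real_of_rat q < of_rat q'" using elim by linarith
        then show "H q \<le> H q'" by (intro Hmono) (simp add: of_rat_less)
      qed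
      then show ?case using q by linarith
    qed
  qed (use R01 in \<open>auto intro!: always_eventually intro: le_less_trans\<close>)
  show rd: "real_distribution (interval_measure (right_limit H))"
    by (rule real_distribution_interval_measure[OF mono rc bot top])
  interpret real_distribution "interval_measure (right_limit H)" by (rule rd)
  have "measure (interval_measure (right_limit H)) {..t} = right_limit H t"
    using cdf_interval_measure[OF mono rc bot] by (metis cdf_def)
  then show "emeasure (interval_measure (right_limit H)) {..t} = ennreal (right_limit H t)"
    by (simp add: emeasure_eq_measure)
qed

section \<open>Kernels and regular conditional distributions\<close>

lemma kernel_pair_measurable:
  assumes "\<kappa> \<in> borel \<rightarrow>\<^sub>M prob_algebra borel"
  shows "(\<lambda>x. distr (\<kappa> x) borel (Pair x)) \<in> borel \<rightarrow>\<^sub>M prob_algebra (borel :: (real \<times> real) measure)"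
  by (rule measurable_distr_prob_space2[OF assms]) (simp add: borel_prod)

lemma kernel_simps:
  fixes \<kappa> :: "real \<Rightarrow> real measure"
  assumes "\<kappa> \<in> borel \<rightarrow>\<^sub>M prob_algebra borel"
  shows "sets (\<kappa> x) = sets borel" "space (\<kappa> x) = UNIV" "prob_space (\<kappa> x)"
proof -
  have "\<kappa> x \<in> space (prob_algebra borel)" using measurable_space[OF assms] by simp
  then show 1: "sets (\<kappa> x) = sets borel" "prob_space (\<kappa> x)" by (auto simp: space_prob_algebra)
  show "space (\<kappa> x) = UNIV" using sets_eq_imp_space_eq[OF 1(1)] by simp
qed

text \<open>Writing a disintegration as a monadic bind gives access to the integral formula for
  \<open>bind\<close>, instead of extending the set-wise identity to functions by hand.\<close>

lemma disintegration_iff_bind: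
  fixes \<pi> :: "(real \<times> real) measure"
  assumes sets: "sets \<pi> = sets borel" and \<kappa>: "\<kappa> \<in> borel \<rightarrow>\<^sub>M prob_algebra borel"
  shows "disintegration \<pi> \<kappa> \<longleftrightarrow> \<pi> = fst_marginal \<pi> \<bind> (\<lambda>x. distr (\<kappa> x) borel (Pair x))"
    (is "_ \<longleftrightarrow> \<pi> = ?b")
proof -
  have k: "(\<lambda>x. distr (\<kappa> x) borel (Pair x)) \<in> fst_marginal \<pi> \<rightarrow>\<^sub>M subprob_algebra borel"
    using measurable_prob_algebraD[OF kernel_pair_measurable[OF \<kappa>]] by simp
  have em: "emeasure ?b E = (\<integral>\<^sup>+x. emeasure (\<kappa> x) {y. (x, y) \<in> E} \<partial>fst_marginal \<pi>)"
    if "E \<in> sets borel" for E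
  proof -
    have [measurable]: "Pair x \<in> borel \<rightarrow>\<^sub>M (borel :: (real \<times> real) measure)" for x :: real
      by (intro borel_measurable_continuous_onI continuous_intros)
    have "emeasure ?b E = (\<integral>\<^sup>+x. emeasure (distr (\<kappa> x) borel (Pair x)) E \<partial>fst_marginal \<pi>)"
      by (rule emeasure_bind[OF _ k that]) simp
    also have "\<dots> = (\<integral>\<^sup>+x. emeasure (\<kappa> x) {y. (x, y) \<in> E} \<partial>fst_marginal \<pi>)"
      using that kernel_simps[OF \<kappa>]
      by (intro nn_integral_cong, subst emeasure_distr)
         (auto simp: vimage_def measurable_cong_sets[OF kernel_simps(1)[OF \<kappa>] refl])
    finally show ?thesis .
  qed
  have "sets ?b = sets borel" by (rule sets_bind[of _ _ borel]) auto
  then have "\<pi> = ?b" if "\<forall>E\<in>sets borel. emeasure \<pi> E = emeasure ?b E"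
    by (intro measure_eqI) (use sets that in simp_all)
  then have "\<pi> = ?b \<longleftrightarrow> (\<forall>E\<in>sets borel. emeasure \<pi> E = emeasure ?b E)" by auto
  then show ?thesis using em \<kappa> by (simp add: disintegration_def)
qed

lemma nn_integral_disintegration:
  fixes \<pi> :: "(real \<times> real) measure"
  assumes sets: "sets \<pi> = sets borel" and dis: "disintegration \<pi> \<kappa>"
    and f[measurable]: "f \<in> borel_measurable borel"
  shows "(\<integral>\<^sup>+z. f z \<partial>\<pi>) = (\<integral>\<^sup>+x. (\<integral>\<^sup>+y. f (x, y) \<partial>\<kappa> x) \<partial>fst_marginal \<pi>)"
proof -
  have \<kappa>: "\<kappa> \<in> borel \<rightarrow>\<^sub>M prob_algebra borel" using dis by (simp add: disintegration_def)
  have k: "(\<lambda>x. distr (\<kappa> x) borel (Pair x)) \<in> fst_marginal \<pi> \<rightarrow>\<^sub>M subprob_algebra borel"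
    using measurable_prob_algebraD[OF kernel_pair_measurable[OF \<kappa>]] by simp
  have P: "Pair x \<in> \<kappa> x \<rightarrow>\<^sub>M (borel :: (real \<times> real) measure)" for x :: real
    unfolding measurable_cong_sets[OF kernel_simps(1)[OF \<kappa>] refl]
    by (intro borel_measurable_continuous_onI continuous_intros)
  have "(\<integral>\<^sup>+z. f z \<partial>\<pi>) = (\<integral>\<^sup>+z. f z \<partial>(fst_marginal \<pi> \<bind> (\<lambda>x. distr (\<kappa> x) borel (Pair x))))"
    using disintegration_iff_bind[OF sets \<kappa>] dis by simp
  also have "\<dots> = (\<integral>\<^sup>+x. (\<integral>\<^sup>+z. f z \<partial>distr (\<kappa> x) borel (Pair x)) \<partial>fst_marginal \<pi>)"
    by (rule nn_integral_bind[OF f k])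
  also have "\<dots> = (\<integral>\<^sup>+x. (\<integral>\<^sup>+y. f (x, y) \<partial>\<kappa> x) \<partial>fst_marginal \<pi>)"
    by (intro nn_integral_cong nn_integral_distr P) simp
  finally show ?thesis .
qed

text \<open>For each rational \<open>q\<close> the conditional probability of y \<le> q given x is a
  Radon-Nikodym derivative. Off one null set these derivatives form a distribution function on the
  rationals, whose right limits define the kernel; agreement on sets \<open>A \<times> {..t}\<close>
  then suffices.\<close>

lemma ex_disintegration:
  fixes \<pi> :: "(real \<times> real) measure"
  assumes "prob_space \<pi>" and sets[measurable_cong]: "sets \<pi> = sets borel"
  shows "\<exists>\<kappa>. disintegration \<pi> \<kappa>"
proof -
  interpret \<pi>: prob_space \<pi> by fact
  have space: "space \<pi> = UNIV" using sets_eq_imp_space_eq[OF sets] by simp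
  have [measurable]: "fst \<in> \<pi> \<rightarrow>\<^sub>M (borel :: real measure)" "snd \<in> \<pi> \<rightarrow>\<^sub>M (borel :: real measure)"
    unfolding measurable_cong_sets[OF sets refl] borel_prod[symmetric] by auto
  have rect[measurable]: "A \<times> B \<in> sets (borel :: (real \<times> real) measure)"
    if "A \<in> sets borel" "B \<in> sets borel" for A B :: "real set"
    unfolding borel_prod[symmetric] using that by auto
  define \<mu> where "\<mu> = fst_marginal \<pi>"
  interpret \<mu>: prob_space \<mu> unfolding \<mu>_def by (rule \<pi>.prob_space_distr) simp
  have s\<mu>[simp, measurable_cong]: "sets \<mu> = sets borel" by (simp add: \<mu>_def)
  have sp\<mu>[simp]: "space \<mu> = UNIV" by (simp add: \<mu>_def)
  have \<mu>A: "emeasure \<mu> A = emeasure \<pi> (A \<times> UNIV)" if "A \<in> sets borel" for A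
    unfolding \<mu>_def using that space by (subst emeasure_distr) (auto intro!: arg_cong[where f="emeasure \<pi>"])
  have "\<exists>G\<in>borel_measurable borel. \<forall>A\<in>sets borel. (\<integral>\<^sup>+x\<in>A. G x \<partial>\<mu>) = emeasure \<pi> (A \<times> {..of_rat q})" for q :: rat
  proof -
    define N where "N = distr (density \<pi> (indicator (UNIV \<times> {..of_rat q}))) borel fst"
    have em: "emeasure N A = emeasure \<pi> (A \<times> {..of_rat q})" if A[measurable]: "A \<in> sets borel" for A
    proof -
      have "emeasure N A = emeasure (density \<pi> (indicator (UNIV \<times> {..of_rat q}))) (A \<times> UNIV)"
        unfolding N_def using space by (subst emeasure_distr) (auto intro!: arg_cong[where f="emeasure _"])
      also have "\<dots> = (\<integral>\<^sup>+z. indicator (A \<times> {..of_rat q}) z \<partial>\<pi>)"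
      proof -
        have "indicator (UNIV \<times> {..of_rat q}) \<in> borel_measurable \<pi>" "A \<times> UNIV \<in> sets \<pi>"
          by (auto simp: sets intro!: borel_measurable_indicator)
        from emeasure_density[OF this] show ?thesis
          by (auto intro!: nn_integral_cong simp: indicator_def simp del: nn_integral_indicator)
      qed
      finally show ?thesis by (simp add: sets)
    qed
    have "absolutely_continuous \<mu> N"
      unfolding absolutely_continuous_def
    proof
      fix A assume "A \<in> null_sets \<mu>"
      then have "A \<in> sets borel" "emeasure \<mu> A = 0" by auto
      then have A: "A \<in> sets borel" "emeasure \<pi> (A \<times> UNIV) = 0" using \<mu>A by auto
      have "emeasure \<pi> (A \<times> {..of_rat q}) \<le> emeasure \<pi> (A \<times> UNIV)"
        by (intro emeasure_mono) (use A(1) in \<open>auto simp: sets\<close>)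
      then show "A \<in> null_sets N" using A em by (auto simp: null_sets_def N_def)
    qed
    then obtain G where G: "G \<in> borel_measurable \<mu>" "density \<mu> G = N"
      using \<mu>.Radon_Nikodym[of N] by (auto simp: N_def)
    show ?thesis
    proof (intro bexI[of _ G] ballI)
      show "G \<in> borel_measurable borel" using G(1) by simp
      fix A :: "real set" assume A: "A \<in> sets borel"
      then show "(\<integral>\<^sup>+x\<in>A. G x \<partial>\<mu>) = emeasure \<pi> (A \<times> {..of_rat q})"
        using emeasure_density[OF G(1), of A] G(2) em by simp
    qed
  qed
  then obtain G :: "rat \<Rightarrow> real \<Rightarrow> ennreal" where [measurable]: "\<And>q. G q \<in> borel_measurable borel"
    and G: "\<And>q A. A \<in> sets borel \<Longrightarrow> (\<integral>\<^sup>+x\<in>A. G q x \<partial>\<mu>) = emeasure \<pi> (A \<times> {..of_rat q})"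
    by metis
  have Gfin: "(\<integral>\<^sup>+x. G q x \<partial>\<mu>) \<noteq> \<infinity>" for q using G[of UNIV q] by (simp add: \<pi>.emeasure_eq_measure)
  have mono: "AE x in \<mu>. G q x \<le> G q' x" if "q \<le> q'" for q q'
  proof (rule AE_le_of_integrals_le)
    fix A assume "A \<in> sets \<mu>"
    then have A: "A \<in> sets borel" by simp
    show "(\<integral>\<^sup>+x\<in>A. G q x \<partial>\<mu>) \<le> (\<integral>\<^sup>+x\<in>A. G q' x \<partial>\<mu>)"
      unfolding G[OF A] using A that by (intro emeasure_mono) (auto simp: sets of_rat_less_eq elim!: order_trans)
  qed (use Gfin in auto)
  have le1: "AE x in \<mu>. G q x \<le> 1" for q
  proof (rule AE_le_of_integrals_le)
    fix A assume "A \<in> sets \<mu>"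
    then have A: "A \<in> sets borel" by simp
    show "(\<integral>\<^sup>+x\<in>A. G q x \<partial>\<mu>) \<le> (\<integral>\<^sup>+x\<in>A. 1 \<partial>\<mu>)"
      unfolding G[OF A] using A by (simp add: \<mu>A) (intro emeasure_mono, auto simp: sets)
  qed (use Gfin in auto)
  have top: "AE x in \<mu>. 1 \<le> (SUP n::nat. G (of_nat n) x)"
  proof (rule AE_le_of_integrals_le)
    fix A assume "A \<in> sets \<mu>"
    then have A: "A \<in> sets borel" by simp
    have "(SUP n::nat. emeasure \<pi> (A \<times> {..real n})) = emeasure \<pi> (\<Union>n. A \<times> {..real n})"
      by (rule SUP_emeasure_incseq) (use A in \<open>auto simp: sets incseq_def\<close>)
    also have "(\<Union>n. A \<times> {..real n}) = A \<times> UNIV" using real_arch_simple by auto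
    finally have "(\<integral>\<^sup>+x\<in>A. 1 \<partial>\<mu>) = (SUP n::nat. emeasure \<pi> (A \<times> {..real n}))"
      using A by (simp add: \<mu>A)
    also have "\<dots> \<le> (\<integral>\<^sup>+x\<in>A. (SUP n::nat. G (of_nat n) x) \<partial>\<mu>)"
    proof (rule SUP_least)
      fix n :: nat
      have "emeasure \<pi> (A \<times> {..real n}) = (\<integral>\<^sup>+x\<in>A. G (of_nat n) x \<partial>\<mu>)" using G[OF A, of "of_nat n"] by simp
      also have "\<dots> \<le> (\<integral>\<^sup>+x\<in>A. (SUP n::nat. G (of_nat n) x) \<partial>\<mu>)"
        by (intro nn_integral_mono mult_right_mono SUP_upper) auto
      finally show "emeasure \<pi> (A \<times> {..real n}) \<le> \<dots>" .
    qed
    finally show "(\<integral>\<^sup>+x\<in>A. 1 \<partial>\<mu>) \<le> (\<integral>\<^sup>+x\<in>A. (SUP n::nat. G (of_nat n) x) \<partial>\<mu>)" .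
  qed (auto simp: \<mu>.emeasure_eq_measure)
  have bot: "AE x in \<mu>. (INF n::nat. G (- of_nat n) x) \<le> 0"
  proof (rule AE_le_of_integrals_le)
    have le: "(\<integral>\<^sup>+x\<in>A. (INF n::nat. G (- of_nat n) x) \<partial>\<mu>) \<le> emeasure \<pi> (UNIV \<times> {..- real n})"
      if A: "A \<in> sets borel" for A n
    proof -
      have "(\<integral>\<^sup>+x\<in>A. (INF n::nat. G (- of_nat n) x) \<partial>\<mu>) \<le> (\<integral>\<^sup>+x\<in>A. G (- of_nat n) x \<partial>\<mu>)"
        by (intro nn_integral_mono mult_right_mono INF_lower) auto
      also have "\<dots> = emeasure \<pi> (A \<times> {..- real n})" using G[OF A, of "- of_nat n"] by (simp add: of_rat_minus)
      also have "\<dots> \<le> emeasure \<pi> (UNIV \<times> {..- real n})" by (intro emeasure_mono) (auto simp: sets)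
      finally show ?thesis .
    qed
    have "(INF n::nat. emeasure \<pi> (UNIV \<times> {..- real n})) = emeasure \<pi> (\<Inter>n. UNIV \<times> {..- real n})"
      by (rule INF_emeasure_decseq) (auto simp: sets decseq_def)
    also have "(\<Inter>n. (UNIV :: real set) \<times> {..- real n}) = {}"
    proof -
      have "\<exists>n. \<not> y \<le> - real n" for y :: real
      proof -
        obtain n where "- y < real n" using reals_Archimedean2 by blast
        then show ?thesis by (intro exI[of _ n]) linarith
      qed
      then show ?thesis by auto
    qed
    finally have inf0: "(INF n::nat. emeasure \<pi> (UNIV \<times> {..- real n})) = 0" by simp
    have le0: "(\<integral>\<^sup>+x\<in>A. (INF n::nat. G (- of_nat n) x) \<partial>\<mu>) \<le> 0" if "A \<in> sets borel" for A
      unfolding inf0[symmetric] by (rule INF_greatest) (rule le[OF that])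
    show "(\<integral>\<^sup>+x\<in>A. (INF n::nat. G (- of_nat n) x) \<partial>\<mu>) \<le> (\<integral>\<^sup>+x\<in>A. 0 \<partial>\<mu>)" if "A \<in> sets \<mu>" for A
      using le0[of A] that by simp
    show "(\<integral>\<^sup>+x. (INF n::nat. G (- of_nat n) x) \<partial>\<mu>) \<noteq> \<infinity>" using le0[of UNIV] by simp
  qed auto
  \<comment> \<open>Countably many almost sure statements, collected into one measurable set of full
    measure.\<close>
  define good where "good x \<longleftrightarrow> (\<forall>q q'. q \<le> q' \<longrightarrow> G q x \<le> G q' x) \<and> (\<forall>q. G q x \<le> 1) \<and>
    1 \<le> (SUP n::nat. G (of_nat n) x) \<and> (INF n::nat. G (- of_nat n) x) \<le> 0" for x
  have good_AE: "AE x in \<mu>. good x"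
    unfolding good_def using mono le1 top bot by (auto simp: AE_all_countable)
  have good_meas[measurable]: "Measurable.pred borel good" unfolding good_def by measurable
  \<comment> \<open>At the exceptional points the distribution function of the unit mass at 0 is
    substituted, so that the kernel consists of probability measures everywhere.\<close>
  define H where "H x q = (if good x then enn2real (G q x) else of_bool (0 \<le> q))" for x and q :: rat
  have H[measurable]: "(\<lambda>x. H x q) \<in> borel_measurable borel" for q unfolding H_def by measurable
  have Hcdf: "rat_cdf (H x)" for x
  proof (cases "good x")
    case True
    have 1: "G q x \<le> G q' x" if "q \<le> q'" for q q' using True that by (auto simp: good_def)
    have 2: "G q x \<le> 1" for q using True by (auto simp: good_def)
    have 3: "G q x = ennreal (H x q)" for q
    proof -
      have "G q x < top" using 2[of q] by (rule le_less_trans) simp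
      then show ?thesis using True by (simp add: H_def)
    qed
    have nn: "0 \<le> H x q" for q using True by (simp add: H_def)
    show ?thesis unfolding rat_cdf_def
    proof (intro conjI allI impI)
      show "mono (H x)" using 1 unfolding 3 by (auto simp: mono_def nn ennreal_le_iff)
      show "0 \<le> H x q" "H x q \<le> 1" for q using nn 2[of q] unfolding 3 by auto
      fix \<epsilon> :: real assume \<epsilon>: "0 < \<epsilon>"
      have "(INF n::nat. G (- of_nat n) x) < ennreal \<epsilon>" using True \<epsilon> by (auto simp: good_def)
      then obtain n where "G (- of_nat n) x < ennreal \<epsilon>" by (auto simp: INF_less_iff)
      then show "\<exists>q. H x q < \<epsilon>" unfolding 3 by (auto simp: ennreal_less_iff nn)
      have "ennreal (1 - \<epsilon>) < 1" using \<epsilon> by (cases "\<epsilon> \<le> 1") (auto simp: ennreal_less_iff ennreal_neg simp flip: ennreal_1)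
      also have "1 \<le> (SUP n::nat. G (of_nat n) x)" using True by (simp add: good_def)
      finally obtain n where "ennreal (1 - \<epsilon>) < G (of_nat n) x" by (auto simp: less_SUP_iff)
      then show "\<exists>q. 1 - \<epsilon> < H x q" unfolding 3 by (metis ennreal_leI not_le)
    qed
  next
    case False
    have "H x (-1) = 0" "H x 0 = 1" using False by (auto simp: H_def)
    moreover have "mono (H x)" using False by (auto simp: mono_def H_def)
    moreover have "0 \<le> H x q \<and> H x q \<le> 1" for q using False by (auto simp: H_def)
    ultimately have "mono (H x) \<and> (\<forall>q. 0 \<le> H x q \<and> H x q \<le> 1) \<and> (\<forall>\<epsilon>>0. H x (-1) < \<epsilon> \<and> 1 - \<epsilon> < H x 0)" by auto
    then show ?thesis unfolding rat_cdf_def by blast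
  qed
  define \<kappa> where "\<kappa> x = interval_measure (right_limit (H x))" for x
  note \<kappa>D = rat_cdf_measure[OF Hcdf, folded \<kappa>_def]
  have [measurable]: "(\<lambda>x. right_limit (H x) t) \<in> borel_measurable borel" for t
    unfolding right_limit_def
    by (rule borel_measurable_cINF_real) (use Hcdf in \<open>auto simp: rat_cdf_def\<close>)
  have \<kappa>m: "\<kappa> \<in> borel \<rightarrow>\<^sub>M prob_algebra borel"
  proof (rule measurable_prob_algebra_generated)
    show "sets (borel :: real measure) = sigma_sets UNIV (range atMost)"
      by (subst borel_eq_atMost) simp
    show "Int_stable (range (atMost :: real \<Rightarrow> real set))" by (auto simp: Int_stable_def)
    show "prob_space (\<kappa> x)" for x using \<kappa>D(1)[of x] by (simp add: real_distribution_def)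
    show "sets (\<kappa> x) = sets borel" for x using \<kappa>D(1)[of x] by (simp add: real_distribution_def real_distribution_axioms_def)
    fix A :: "real set" assume "A \<in> range atMost"
    then obtain t where "A = {..t}" by auto
    then show "(\<lambda>x. emeasure (\<kappa> x) A) \<in> borel_measurable borel" using \<kappa>D(2)[of _ t] by simp
  qed auto
  define \<pi>' where "\<pi>' = \<mu> \<bind> (\<lambda>x. distr (\<kappa> x) borel (Pair x))"
  have k: "(\<lambda>x. distr (\<kappa> x) borel (Pair x)) \<in> \<mu> \<rightarrow>\<^sub>M subprob_algebra borel"
    using measurable_prob_algebraD[OF kernel_pair_measurable[OF \<kappa>m]] by simp
  have key: "emeasure \<pi> (A \<times> {..t}) = emeasure \<pi>' (A \<times> {..t})" if A[measurable]: "A \<in> sets borel" for A t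
  proof -
    \<comment> \<open>Placing \<open>q n\<close> between consecutive points t + 1/(n+2) and t +
      1/(n+1) makes the sequence decrease to \<open>t\<close> from strictly above. Only such
      rationals determine the right limit, so the identity is first known at \<open>q n\<close> and
      then passed to the limit on both sides.\<close>
    have "\<exists>q::rat. t + 1 / real (Suc (Suc n)) < of_rat q \<and> real_of_rat q < t + 1 / real (Suc n)" for n
      by (intro of_rat_dense) (simp add: field_simps)
    then obtain q :: "nat \<Rightarrow> rat" where q: "\<And>n. t + 1 / real (Suc (Suc n)) < of_rat (q n)"
      "\<And>n. real_of_rat (q n) < t + 1 / real (Suc n)" by metis
    have tq: "t < of_rat (q n)" for n using q(1)[of n] by (smt (verit) divide_pos_pos of_nat_0_less_iff zero_less_Suc)
    have "decseq (\<lambda>n. real_of_rat (q n))"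
      by (rule decseq_SucI) (use q in \<open>meson less_imp_le less_trans\<close>)
    have qlim: "(\<lambda>n. real_of_rat (q n)) \<longlonglongrightarrow> t"
    proof (rule real_tendsto_sandwich)
      show "\<forall>\<^sub>F n in sequentially. t \<le> real_of_rat (q n)" by (intro always_eventually allI less_imp_le tq)
      show "\<forall>\<^sub>F n in sequentially. real_of_rat (q n) \<le> t + 1 / real (Suc n)" by (intro always_eventually allI less_imp_le q(2))
      have "(\<lambda>n. t + 1 / real (Suc n)) \<longlonglongrightarrow> t + 0"
        by (intro tendsto_intros LIMSEQ_inverse_real_of_nat[unfolded inverse_eq_divide])
      then show "(\<lambda>n. t + 1 / real (Suc n)) \<longlonglongrightarrow> t" by simp
    qed simp
    have "(\<lambda>n. measure \<pi> (A \<times> {..of_rat (q n)})) \<longlonglongrightarrow> measure \<pi> (\<Inter>n. A \<times> {..of_rat (q n)})"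
      by (rule \<pi>.finite_Lim_measure_decseq)
         (use \<open>decseq (\<lambda>n. real_of_rat (q n))\<close> in \<open>auto simp: sets decseq_def intro: order_trans\<close>)
    moreover have "(\<Inter>n. A \<times> {..real_of_rat (q n)}) = A \<times> {..t}"
    proof -
      have "y \<le> t" if "\<And>n. y \<le> real_of_rat (q n)" for y
        using qlim that by (intro LIMSEQ_le_const) auto
      moreover have "y \<le> real_of_rat (q n)" if "y \<le> t" for y n using that tq[of n] by linarith
      ultimately show ?thesis by auto
    qed
    ultimately have l1: "(\<lambda>n. measure \<pi> (A \<times> {..of_rat (q n)})) \<longlonglongrightarrow> measure \<pi> (A \<times> {..t})" by simp
    have H01: "0 \<le> H x r" "H x r \<le> 1" for x r using Hcdf[of x] by (auto simp: rat_cdf_def)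
    have R01: "0 \<le> right_limit (H x) t" "right_limit (H x) t \<le> 1" for x
      using right_limit_greatest[OF Hcdf, of t 0 x] right_limit_le[OF Hcdf tq, of x 0] H01[of x]
      by (auto intro: order_trans)
    have l2: "(\<lambda>n. \<integral>x. H x (q n) * indicator A x \<partial>\<mu>) \<longlonglongrightarrow> (\<integral>x. right_limit (H x) t * indicator A x \<partial>\<mu>)"
    proof (rule integral_dominated_convergence[where w="\<lambda>_. 1"])
      show "AE x in \<mu>. (\<lambda>n. H x (q n) * indicator A x) \<longlonglongrightarrow> right_limit (H x) t * indicator A x"
      proof (intro AE_I2 tendsto_mult tendsto_const order_tendstoI)
        fix x c assume "c < right_limit (H x) t"
        then show "\<forall>\<^sub>F n in sequentially. c < H x (q n)"
          by (intro always_eventually allI) (rule less_le_trans[OF _ right_limit_le[OF Hcdf tq]])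
      next
        fix x c assume "right_limit (H x) t < c"
        then obtain r where r: "t < of_rat r" "H x r < c" using right_limit_lessE[OF Hcdf] by blast
        have "\<forall>\<^sub>F n in sequentially. real_of_rat (q n) < of_rat r" using order_tendstoD(2)[OF qlim r(1)] .
        then show "\<forall>\<^sub>F n in sequentially. H x (q n) < c"
        proof eventually_elim
          case (elim n)
          then have "q n \<le> r" by (simp add: of_rat_less)
          then have "H x (q n) \<le> H x r" using Hcdf[of x] by (auto simp: rat_cdf_def mono_def)
          then show ?case using r by linarith
        qed
      qed
      show "AE x in \<mu>. norm (H x (q n) * indicator A x) \<le> 1" for n using H01 by (auto simp: indicator_def)
    qed auto
    have eq: "(\<integral>x. H x r * indicator A x \<partial>\<mu>) = measure \<pi> (A \<times> {..of_rat r})" for r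
    proof -
      have "ennreal (\<integral>x. H x r * indicator A x \<partial>\<mu>) = (\<integral>\<^sup>+x. ennreal (H x r * indicator A x) \<partial>\<mu>)"
        by (intro nn_integral_eq_integral[symmetric] \<mu>.integrable_const_bound[where B=1])
           (use H01 in \<open>auto simp: indicator_def\<close>)
      also have "\<dots> = (\<integral>\<^sup>+x\<in>A. G r x \<partial>\<mu>)"
      proof (rule nn_integral_cong_AE, use good_AE in eventually_elim)
        case (elim x)
        then have "G r x < \<infinity>" by (auto simp: good_def intro: le_less_trans[of _ 1])
        then show ?case using elim by (auto simp: H_def indicator_def)
      qed
      also have "\<dots> = ennreal (measure \<pi> (A \<times> {..of_rat r}))" using G[OF A] by (simp add: \<pi>.emeasure_eq_measure)
      finally show ?thesis using H01 by (subst (asm) ennreal_inj) auto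
    qed
    have "measure \<pi> (A \<times> {..t}) = (\<integral>x. right_limit (H x) t * indicator A x \<partial>\<mu>)"
      using LIMSEQ_unique[OF l1] l2 unfolding eq by blast
    then have "emeasure \<pi> (A \<times> {..t}) = ennreal (\<integral>x. right_limit (H x) t * indicator A x \<partial>\<mu>)"
      by (simp add: \<pi>.emeasure_eq_measure)
    also have "\<dots> = (\<integral>\<^sup>+x. ennreal (right_limit (H x) t * indicator A x) \<partial>\<mu>)"
      by (intro nn_integral_eq_integral[symmetric] \<mu>.integrable_const_bound[where B=1])
         (use R01 in \<open>auto simp: indicator_def\<close>)
    also have "\<dots> = (\<integral>\<^sup>+x. emeasure (distr (\<kappa> x) borel (Pair x)) (A \<times> {..t}) \<partial>\<mu>)"
    proof (rule nn_integral_cong)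
      fix x
      have "emeasure (distr (\<kappa> x) borel (Pair x)) (A \<times> {..t}) = emeasure (\<kappa> x) (Pair x -` (A \<times> {..t}) \<inter> space (\<kappa> x))"
        unfolding borel_prod[symmetric] using A
        by (intro emeasure_distr) (auto simp: measurable_cong_sets[OF kernel_simps(1)[OF \<kappa>m] refl])
      also have "\<dots> = ennreal (right_limit (H x) t * indicator A x)"
        using \<kappa>D(2)[of x t] kernel_simps(2)[OF \<kappa>m, of x] by (cases "x \<in> A") auto
      finally show "ennreal (right_limit (H x) t * indicator A x) = emeasure (distr (\<kappa> x) borel (Pair x)) (A \<times> {..t})" by simp
    qed
    also have "\<dots> = emeasure \<pi>' (A \<times> {..t})"
      unfolding \<pi>'_def by (rule emeasure_bind[OF _ k, symmetric]) auto
    finally show ?thesis .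
  qed
  have "\<pi> = \<pi>'"
  proof (rule measure_eqI_generator_eq)
    let ?E = "{A \<times> {..t} | A t. A \<in> sets (borel :: real measure)} :: (real \<times> real) set set"
    show "Int_stable ?E"
    proof (rule Int_stableI, safe)
      fix A A' :: "real set" and t t' :: real
      assume "A \<in> sets borel" "A' \<in> sets borel"
      then show "\<exists>B s. A \<times> {..t} \<inter> A' \<times> {..t'} = B \<times> {..s} \<and> B \<in> sets borel"
        by (intro exI[of _ "A \<inter> A'"] exI[of _ "min t t'"]) auto
    qed
    have "sets (borel :: (real \<times> real) measure) = sets (sigma UNIV {a \<times> b | a b. a \<in> sets (borel :: real measure) \<and> b \<in> range atMost})"
    proof -
      have "sets ((borel :: real measure) \<Otimes>\<^sub>M (borel :: real measure)) = sets (sigma (space borel \<times> space borel) {a \<times> b | a b. a \<in> sets (borel :: real measure) \<and> b \<in> range atMost})"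
      proof (rule sets_pair_eq[where Ca="{UNIV}" and Cb="range (\<lambda>n. {..real n})"])
        show "sets (borel :: real measure) = sigma_sets (space borel) (range atMost)" by (subst borel_eq_atMost) simp
        show "\<Union> (range (\<lambda>n. {..real n})) = space borel" using real_arch_simple by auto
      qed (auto simp: sets.sigma_sets_eq[of borel, simplified])
      then show ?thesis unfolding borel_prod space_borel UNIV_Times_UNIV .
    qed
    also have "{a \<times> b | a b. a \<in> sets (borel :: real measure) \<and> b \<in> range atMost} = ?E" by auto
    finally have *: "sets (borel :: (real \<times> real) measure) = sigma_sets UNIV ?E" by simp
    show "sets \<pi> = sigma_sets UNIV ?E" using sets * by simp
    show "sets \<pi>' = sigma_sets UNIV ?E" unfolding *[symmetric] \<pi>'_def by (rule sets_bind[of _ _ borel]) auto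
    show "range (\<lambda>n::nat. UNIV \<times> {..real n}) \<subseteq> ?E" by auto
    show "(\<Union>n::nat. UNIV \<times> {..real n}) = (UNIV :: (real \<times> real) set)" using real_arch_simple by auto
    show "emeasure \<pi> X = emeasure \<pi>' X" if "X \<in> ?E" for X using that key by auto
  qed auto
  then have "disintegration \<pi> \<kappa>"
    unfolding disintegration_iff_bind[OF sets \<kappa>m] by (simp add: \<pi>'_def \<mu>_def)
  then show ?thesis by blast
qed

section \<open>Exchanging mass between measures\<close>

text \<open>The mixture is the image under \<open>Z\<close> of the product of counting measure on
  \<open>T\<close> with \<eta>, weighted by \<open>u\<close>. The weights need not sum to 1.\<close>

lemma ex_mixture:
  fixes u :: "'s \<Rightarrow> 'e \<Rightarrow> real" and Z :: "'s \<Rightarrow> 'e \<Rightarrow> 'z::topological_space"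
  assumes "prob_space \<eta>" and T: "finite T"
    and u: "\<And>s. s \<in> T \<Longrightarrow> u s \<in> borel_measurable \<eta>" and Z: "\<And>s. s \<in> T \<Longrightarrow> Z s \<in> \<eta> \<rightarrow>\<^sub>M borel"
  shows "\<exists>\<omega>. sets \<omega> = sets borel \<and> (\<forall>f\<in>borel_measurable borel.
       (\<integral>\<^sup>+z. f z \<partial>\<omega>) = (\<Sum>s\<in>T. \<integral>\<^sup>+e. ennreal (u s e) * f (Z s e) \<partial>\<eta>))"
proof -
  interpret prob_space \<eta> by fact
  let ?P = "count_space T \<Otimes>\<^sub>M \<eta>"
  have u': "(\<lambda>(s, e). ennreal (u s e)) \<in> borel_measurable ?P"
    by (rule measurable_pair_measure_countable1) (use T u in \<open>auto intro: countable_finite\<close>)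
  have Z': "(\<lambda>(s, e). Z s e) \<in> ?P \<rightarrow>\<^sub>M borel"
    by (rule measurable_pair_measure_countable1) (use T Z in \<open>auto intro: countable_finite\<close>)
  let ?\<omega> = "distr (density ?P (\<lambda>(s, e). ennreal (u s e))) borel (\<lambda>(s, e). Z s e)"
  show ?thesis
  proof (intro exI[of _ ?\<omega>] conjI ballI)
    fix f :: "'z \<Rightarrow> ennreal" assume f: "f \<in> borel_measurable borel"
    have fZ: "(\<lambda>p. f ((\<lambda>(s, e). Z s e) p)) \<in> borel_measurable ?P"
      by (rule measurable_compose[OF Z' f])
    have "(\<integral>\<^sup>+z. f z \<partial>?\<omega>) =
        (\<integral>\<^sup>+p. (\<lambda>(s, e). ennreal (u s e)) p * f ((\<lambda>(s, e). Z s e) p) \<partial>?P)"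
      using Z' by (subst nn_integral_distr) (auto simp: f intro!: nn_integral_density[OF u' fZ])
    also have "\<dots> = (\<integral>\<^sup>+s. \<integral>\<^sup>+e. (\<lambda>(s, e). ennreal (u s e)) (s, e) * f ((\<lambda>(s, e). Z s e) (s, e)) \<partial>\<eta> \<partial>count_space T)"
      by (rule nn_integral_fst[symmetric]) (intro borel_measurable_times_ennreal u' fZ)
    also have "\<dots> = (\<Sum>s\<in>T. \<integral>\<^sup>+e. ennreal (u s e) * f (Z s e) \<partial>\<eta>)"
      using T by (simp add: nn_integral_count_space_finite)
    finally show "(\<integral>\<^sup>+z. f z \<partial>?\<omega>) = (\<Sum>s\<in>T. \<integral>\<^sup>+e. ennreal (u s e) * f (Z s e) \<partial>\<eta>)" .
  qed simp
qed

lemma ex_sum_measure: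
  assumes sets: "sets M = sets N"
  shows "\<exists>K. sets K = sets M \<and> (\<forall>A\<in>sets M. emeasure K A = emeasure M A + emeasure N A)"
proof -
  let ?m = "\<lambda>A. emeasure M A + emeasure N A"
  show ?thesis
  proof (intro exI[of _ "measure_of (space M) (sets M) ?m"] conjI ballI)
    fix A assume A: "A \<in> sets M"
    show "emeasure (measure_of (space M) (sets M) ?m) A = ?m A"
    proof (rule emeasure_measure_of_sigma[OF sets.sigma_algebra_axioms _ _ A])
      show "positive (sets M) ?m" by (simp add: positive_def)
      show "countably_additive (sets M) ?m"
      proof (rule countably_additiveI)
        fix F :: "nat \<Rightarrow> 'a set" assume F: "range F \<subseteq> sets M" "disjoint_family F"
        have "(\<Sum>i. ?m (F i)) = (\<Sum>i. emeasure M (F i)) + (\<Sum>i. emeasure N (F i))"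
          by (rule suminf_add[symmetric]) auto
        also have "\<dots> = ?m (\<Union>i. F i)" using F sets by (simp add: suminf_emeasure)
        finally show "(\<Sum>i. ?m (F i)) = ?m (\<Union>i. F i)" .
      qed
    qed
  qed simp
qed

text \<open>The relation \<open>\<pi>' = \<pi> - \<omega> + \<omega>'\<close> is handled in the
  subtraction-free form \<open>\<pi>' + \<omega> = \<pi> + \<omega>'\<close>, which makes sense even
  for infinite values.\<close>

lemma nn_integral_add_measures:
  assumes sets: "sets M2 = sets M1" "sets M3 = sets M1" "sets M4 = sets M1"
    and em: "\<And>A. A \<in> sets M1 \<Longrightarrow> emeasure M1 A + emeasure M2 A = emeasure M3 A + emeasure M4 A"
    and f: "f \<in> borel_measurable M1"
  shows "(\<integral>\<^sup>+z. f z \<partial>M1) + (\<integral>\<^sup>+z. f z \<partial>M2) = (\<integral>\<^sup>+z. f z \<partial>M3) + (\<integral>\<^sup>+z. f z \<partial>M4)"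
proof -
  have [simp]: "g \<in> borel_measurable M2 \<longleftrightarrow> g \<in> borel_measurable M1"
    "g \<in> borel_measurable M3 \<longleftrightarrow> g \<in> borel_measurable M1"
    "g \<in> borel_measurable M4 \<longleftrightarrow> g \<in> borel_measurable M1" for g :: "'a \<Rightarrow> ennreal"
    unfolding measurable_cong_sets[OF sets(1) refl] measurable_cong_sets[OF sets(2) refl] measurable_cong_sets[OF sets(3) refl]
    by simp_all
  have sp: "space M2 = space M1" "space M3 = space M1" "space M4 = space M1"
    using sets by (auto dest: sets_eq_imp_space_eq)
  from f show ?thesis
  proof (induction rule: borel_measurable_induct)
    case (cong f g)
    have "(\<integral>\<^sup>+z. f z \<partial>M) = (\<integral>\<^sup>+z. g z \<partial>M)" if "space M = space M1" for M
      by (rule nn_integral_cong) (use cong that in auto)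
    with cong sp show ?case by simp
  next
    case (set A)
    then show ?case using em sets by simp
  next
    case (mult u c)
    then show ?case by (simp add: nn_integral_cmult distrib_left[symmetric])
  next
    case (add u v)
    have "(a + b) + (c + d) = (a + c) + (b + d)" for a b c d :: ennreal by (simp add: ac_simps)
    from this[of "integral\<^sup>N M1 v" "integral\<^sup>N M1 u" "integral\<^sup>N M2 v" "integral\<^sup>N M2 u"]
      this[of "integral\<^sup>N M3 v" "integral\<^sup>N M3 u" "integral\<^sup>N M4 v" "integral\<^sup>N M4 u"]
    show ?case using add by (simp add: nn_integral_add)
  next
    case (seq U)
    have mono: "incseq (\<lambda>i. \<integral>\<^sup>+z. U i z \<partial>M)" for M
      using seq(3) by (auto simp: incseq_def le_fun_def intro!: nn_integral_mono)
    have *: "(\<integral>\<^sup>+z. (SUP i. U i) z \<partial>M) = (SUP i. \<integral>\<^sup>+z. U i z \<partial>M)" if "\<And>i. U i \<in> borel_measurable M" for M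
      unfolding SUP_apply by (rule nn_integral_monotone_convergence_SUP[OF seq(3) that])
    have **: "(SUP i. \<integral>\<^sup>+z. U i z \<partial>M) + (SUP i. \<integral>\<^sup>+z. U i z \<partial>M') = (SUP i. (\<integral>\<^sup>+z. U i z \<partial>M) + (\<integral>\<^sup>+z. U i z \<partial>M'))" for M M'
      by (rule ennreal_SUP_add[symmetric]; rule mono)
    have U: "U i \<in> borel_measurable M1" "U i \<in> borel_measurable M2" "U i \<in> borel_measurable M3" "U i \<in> borel_measurable M4" for i
      using seq by auto
    show ?case unfolding *[OF U(1)] *[OF U(2)] *[OF U(3)] *[OF U(4)] ** using seq by simp
  qed
qed

text \<open>The conversion \<open>ennreal\<close> cuts \<open>h\<close> off at 0, so this treats
  positive parts. Applied to the identity and to its negative it yields the two halves of the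
  barycenter.\<close>

lemma disintegration_integral_snd:
  fixes \<pi> :: "(real \<times> real) measure" and h :: "real \<Rightarrow> real"
  assumes sets: "sets \<pi> = sets borel" and dis: "disintegration \<pi> \<kappa>"
    and h[measurable]: "h \<in> borel_measurable borel" and fin: "(\<integral>\<^sup>+z. ennreal (h (snd z)) \<partial>\<pi>) < top"
  defines "q \<equiv> \<lambda>x. \<integral>\<^sup>+y. ennreal (h y) \<partial>\<kappa> x"
  shows "AE x in fst_marginal \<pi>. q x < top"
    and "A \<in> sets borel \<Longrightarrow> integrable (fst_marginal \<pi>) (\<lambda>x. indicator A x * enn2real (q x))"
    and "A \<in> sets borel \<Longrightarrow> (\<integral>x. indicator A x * enn2real (q x) \<partial>fst_marginal \<pi>) =
      enn2real (\<integral>\<^sup>+z. indicator A (fst z) * ennreal (h (snd z)) \<partial>\<pi>)"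
proof -
  let ?\<mu> = "fst_marginal \<pi>"
  have \<kappa>: "\<kappa> \<in> borel \<rightarrow>\<^sub>M prob_algebra borel" using dis by (simp add: disintegration_def)
  have [measurable]: "q \<in> borel_measurable borel"
    unfolding q_def
    by (rule measurable_compose[OF measurable_prob_algebraD[OF \<kappa>] nn_integral_measurable_subprob_algebra]) simp
  have [measurable]: "fst \<in> borel_measurable (borel :: (real \<times> real) measure)" "snd \<in> borel_measurable (borel :: (real \<times> real) measure)"
    by (intro borel_measurable_continuous_onI continuous_intros)+
  have h\<kappa>: "(\<lambda>y. ennreal (h y)) \<in> borel_measurable (\<kappa> x)" for x
    unfolding measurable_cong_sets[OF kernel_simps(1)[OF \<kappa>] refl] by simp
  have Q: "(\<integral>\<^sup>+z. indicator B (fst z) * ennreal (h (snd z)) \<partial>\<pi>) = (\<integral>\<^sup>+x. indicator B x * q x \<partial>?\<mu>)"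
    if [measurable]: "B \<in> sets borel" for B
  proof -
    have "(\<lambda>z :: real \<times> real. indicator B (fst z) * ennreal (h (snd z))) \<in> borel_measurable borel" by measurable
    from nn_integral_disintegration[OF sets dis this] show ?thesis
      unfolding q_def fst_conv snd_conv nn_integral_cmult[OF h\<kappa>] .
  qed
  have qf: "(\<integral>\<^sup>+x. q x \<partial>?\<mu>) < top" using Q[of UNIV] fin by simp
  have "AE x in ?\<mu>. q x \<noteq> \<infinity>" by (rule nn_integral_noteq_infinite) (use qf in auto)
  then show ae: "AE x in ?\<mu>. q x < top" unfolding infinity_ennreal_def less_top .
  assume A[measurable]: "A \<in> sets borel"
  have eq: "(\<integral>\<^sup>+x. ennreal (indicator A x * enn2real (q x)) \<partial>?\<mu>) = (\<integral>\<^sup>+x. indicator A x * q x \<partial>?\<mu>)"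
    by (rule nn_integral_cong_AE) (use ae in eventually_elim, auto simp: indicator_def)
  have "(\<integral>\<^sup>+x. indicator A x * q x \<partial>?\<mu>) \<le> (\<integral>\<^sup>+x. q x \<partial>?\<mu>)"
    by (intro nn_integral_mono) (auto simp: indicator_def)
  with qf eq show int: "integrable ?\<mu> (\<lambda>x. indicator A x * enn2real (q x))"
    by (intro integrableI_nonneg) (auto intro: le_less_trans)
  show "(\<integral>x. indicator A x * enn2real (q x) \<partial>?\<mu>) = enn2real (\<integral>\<^sup>+z. indicator A (fst z) * ennreal (h (snd z)) \<partial>\<pi>)"
    unfolding Q[OF A] eq[symmetric] by (rule integral_eq_nn_integral[OF borel_measurable_integrable[OF int]]) simp
qed

text \<open>Here \<beta> is the barycenter of \<kappa>, written through positive and negative parts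
  so that it is measurable without regard to integrability. The last claim determines it almost
  everywhere from \<pi> itself, independently of the chosen kernel.\<close>

lemma disintegration_barycenter:
  fixes \<pi> :: "(real \<times> real) measure"
  assumes sets: "sets \<pi> = sets borel" and dis: "disintegration \<pi> \<kappa>" and int: "integrable \<pi> snd"
  defines "\<beta> \<equiv> \<lambda>x. enn2real (\<integral>\<^sup>+y. ennreal y \<partial>\<kappa> x) - enn2real (\<integral>\<^sup>+y. ennreal (- y) \<partial>\<kappa> x)"
  shows "integrable (fst_marginal \<pi>) \<beta>"
    and "AE x in fst_marginal \<pi>. integrable (\<kappa> x) (\<lambda>y. y) \<and> (\<integral>y. y \<partial>\<kappa> x) = \<beta> x"
    and "A \<in> sets borel \<Longrightarrow>
      (\<integral>z. indicator A (fst z) * snd z \<partial>\<pi>) = (\<integral>x. indicator A x * \<beta> x \<partial>fst_marginal \<pi>)"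
proof -
  let ?\<mu> = "fst_marginal \<pi>"
  have \<kappa>: "\<kappa> \<in> borel \<rightarrow>\<^sub>M prob_algebra borel" using dis by (simp add: disintegration_def)
  have fin: "(\<integral>\<^sup>+z. ennreal (snd z) \<partial>\<pi>) < top" "(\<integral>\<^sup>+z. ennreal (- snd z) \<partial>\<pi>) < top"
    using int unfolding real_integrable_def infinity_ennreal_def less_top by simp_all
  have id: "(\<lambda>y. y) \<in> borel_measurable borel" "uminus \<in> borel_measurable (borel :: real measure)" by simp_all
  note P = disintegration_integral_snd[OF sets dis id(1) fin(1)]
  note N = disintegration_integral_snd[OF sets dis id(2) fin(2)]
  show "integrable ?\<mu> \<beta>" unfolding \<beta>_def using P(2)[of UNIV] N(2)[of UNIV] by simp
  show "AE x in ?\<mu>. integrable (\<kappa> x) (\<lambda>y. y) \<and> (\<integral>y. y \<partial>\<kappa> x) = \<beta> x"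
    using P(1) N(1)
  proof eventually_elim
    case (elim x)
    then have "integrable (\<kappa> x) (\<lambda>y. y)"
      unfolding real_integrable_def by (auto simp: measurable_cong_sets[OF kernel_simps(1)[OF \<kappa>] refl])
    then show ?case using real_lebesgue_integral_def[of "\<kappa> x" "\<lambda>y. y"] by (simp add: \<beta>_def)
  qed
  assume A[measurable]: "A \<in> sets borel"
  have [measurable]: "fst \<in> borel_measurable (borel :: (real \<times> real) measure)" "snd \<in> borel_measurable (borel :: (real \<times> real) measure)"
    by (intro borel_measurable_continuous_onI continuous_intros)+
  have iA: "integrable \<pi> (\<lambda>z. indicator A (fst z) * snd z)"
  proof (rule Bochner_Integration.integrable_bound[OF int])
    show "(\<lambda>z. indicator A (fst z) * snd z) \<in> borel_measurable \<pi>"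
      unfolding measurable_cong_sets[OF sets refl] by measurable
  qed (auto simp: indicator_def)
  have e: "ennreal (indicator A (fst z) * snd z) = indicator A (fst z) * ennreal (snd z)"
    "ennreal (- (indicator A (fst z) * snd z)) = indicator A (fst z) * ennreal (- snd z)" for z :: "real \<times> real"
    by (auto simp: indicator_def)
  show "(\<integral>z. indicator A (fst z) * snd z \<partial>\<pi>) = (\<integral>x. indicator A x * \<beta> x \<partial>?\<mu>)"
    unfolding real_lebesgue_integral_def[OF iA] e P(3)[OF A, symmetric] N(3)[OF A, symmetric]
      \<beta>_def right_diff_distrib
    by (rule Bochner_Integration.integral_diff[symmetric]) (intro P(2) N(2) A)+
qed

text \<open>Since the weights are nonnegative, the positive and negative parts of
  \<open>u s e * F (Z s e)\<close> are the weighted parts of \<open>F\<close>, so the formula for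
  nonnegative functions applies to each part.\<close>

lemma mixture_integrable_iff:
  fixes F :: "'z::topological_space \<Rightarrow> real"
  assumes sets: "sets \<omega> = sets borel" and T: "finite T"
    and nn: "\<And>f. f \<in> borel_measurable borel \<Longrightarrow>
       (\<integral>\<^sup>+z. f z \<partial>\<omega>) = (\<Sum>s\<in>T. \<integral>\<^sup>+e. ennreal (u s e) * f (Z s e) \<partial>\<eta>)"
    and u0: "\<And>s e. s \<in> T \<Longrightarrow> 0 \<le> u s e"
    and u: "\<And>s. s \<in> T \<Longrightarrow> u s \<in> borel_measurable \<eta>" and Z: "\<And>s. s \<in> T \<Longrightarrow> Z s \<in> \<eta> \<rightarrow>\<^sub>M borel"
    and F: "F \<in> borel_measurable borel"
  shows "integrable \<omega> F \<longleftrightarrow> (\<forall>s\<in>T. integrable \<eta> (\<lambda>e. u s e * F (Z s e)))"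
    and "integrable \<omega> F \<Longrightarrow> (\<integral>z. F z \<partial>\<omega>) = (\<Sum>s\<in>T. \<integral>e. u s e * F (Z s e) \<partial>\<eta>)"
proof -
  have F\<omega>: "F \<in> borel_measurable \<omega>" unfolding measurable_cong_sets[OF sets refl] by (rule F)
  have FZ: "(\<lambda>e. u s e * F (Z s e)) \<in> borel_measurable \<eta>" if "s \<in> T" for s
    by (intro borel_measurable_times u measurable_compose[OF Z F] that)
  have nnF: "(\<integral>\<^sup>+z. ennreal (G (F z)) \<partial>\<omega>) = (\<Sum>s\<in>T. \<integral>\<^sup>+e. ennreal (u s e * G (F (Z s e))) \<partial>\<eta>)"
    if "G \<in> borel_measurable borel" for G
    using nn[of "\<lambda>z. ennreal (G (F z))"] measurable_compose[OF F that] u0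
    by (simp add: ennreal_mult')
  show iff: "integrable \<omega> F \<longleftrightarrow> (\<forall>s\<in>T. integrable \<eta> (\<lambda>e. u s e * F (Z s e)))"
    unfolding integrable_iff_bounded using F\<omega> FZ nnF[of abs] u0 T
    by (simp add: abs_mult)
  assume int: "integrable \<omega> F"
  then have ints: "integrable \<eta> (\<lambda>e. u s e * F (Z s e))" if "s \<in> T" for s using iff that by blast
  have fin: "(\<integral>\<^sup>+e. ennreal (u s e * F (Z s e)) \<partial>\<eta>) < top" "(\<integral>\<^sup>+e. ennreal (- (u s e * F (Z s e))) \<partial>\<eta>) < top"
    if "s \<in> T" for s
    using ints[OF that] unfolding real_integrable_def infinity_ennreal_def less_top by simp_all
  have "(\<integral>z. F z \<partial>\<omega>) = enn2real (\<Sum>s\<in>T. \<integral>\<^sup>+e. ennreal (u s e * F (Z s e)) \<partial>\<eta>)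
      - enn2real (\<Sum>s\<in>T. \<integral>\<^sup>+e. ennreal (- (u s e * F (Z s e))) \<partial>\<eta>)"
    unfolding real_lebesgue_integral_def[OF int] using nnF[of "\<lambda>t. t"] nnF[of uminus] by simp
  also have "\<dots> = (\<Sum>s\<in>T. enn2real (\<integral>\<^sup>+e. ennreal (u s e * F (Z s e)) \<partial>\<eta>)
      - enn2real (\<integral>\<^sup>+e. ennreal (- (u s e * F (Z s e))) \<partial>\<eta>))"
    using fin by (simp add: enn2real_sum comp_def sum_subtractf)
  also have "\<dots> = (\<Sum>s\<in>T. \<integral>e. u s e * F (Z s e) \<partial>\<eta>)"
    by (intro sum.cong) (simp_all add: real_lebesgue_integral_def[OF ints])
  finally show "(\<integral>z. F z \<partial>\<omega>) = (\<Sum>s\<in>T. \<integral>e. u s e * F (Z s e) \<partial>\<eta>)" .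
qed

text \<open>Integrability under \<open>M1\<close> is obtained rather than assumed: for each of the
  two parts of \<open>F\<close> its integral is bounded by a finite sum on the right.\<close>

lemma integral_exchange:
  fixes F :: "'z \<Rightarrow> real"
  assumes sets: "sets M2 = sets M1" "sets M3 = sets M1" "sets M4 = sets M1"
    and em: "\<And>A. A \<in> sets M1 \<Longrightarrow> emeasure M1 A + emeasure M2 A = emeasure M3 A + emeasure M4 A"
    and int: "integrable M2 F" "integrable M3 F" "integrable M4 F"
  shows "integrable M1 F" "(\<integral>z. F z \<partial>M1) + (\<integral>z. F z \<partial>M2) = (\<integral>z. F z \<partial>M3) + (\<integral>z. F z \<partial>M4)"
proof -
  have F: "F \<in> borel_measurable M1"
    using borel_measurable_integrable[OF int(1)] unfolding measurable_cong_sets[OF sets(1) refl] .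
  note nn = nn_integral_add_measures[OF sets em]
  have 1: "(\<integral>\<^sup>+z. ennreal (F z) \<partial>M1) + (\<integral>\<^sup>+z. ennreal (F z) \<partial>M2) = (\<integral>\<^sup>+z. ennreal (F z) \<partial>M3) + (\<integral>\<^sup>+z. ennreal (F z) \<partial>M4)"
    by (rule nn) (use F in auto)
  have 2: "(\<integral>\<^sup>+z. ennreal (- F z) \<partial>M1) + (\<integral>\<^sup>+z. ennreal (- F z) \<partial>M2) = (\<integral>\<^sup>+z. ennreal (- F z) \<partial>M3) + (\<integral>\<^sup>+z. ennreal (- F z) \<partial>M4)"
    by (rule nn) (use F in auto)
  have fin: "(\<integral>\<^sup>+z. ennreal (F z) \<partial>M) < top" "(\<integral>\<^sup>+z. ennreal (- F z) \<partial>M) < top" if "integrable M F" for M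
    using that unfolding real_integrable_def infinity_ennreal_def less_top by simp_all
  have real: "a < top \<and> enn2real a + enn2real b = enn2real c + enn2real d"
    if "a + b = c + d" "b < top" "c < top" "d < top" for a b c d :: ennreal
  proof -
    have "c + d < top" using that by simp
    then have a: "a < top" unfolding that(1)[symmetric] by simp
    have "enn2real (a + b) = enn2real (c + d)" using that(1) by simp
    then show ?thesis using a unfolding enn2real_plus[OF a that(2)] enn2real_plus[OF that(3,4)] by simp
  qed
  note r1 = real[OF 1 fin(1)[OF int(1)] fin(1)[OF int(2)] fin(1)[OF int(3)]]
  note r2 = real[OF 2 fin(2)[OF int(1)] fin(2)[OF int(2)] fin(2)[OF int(3)]]
  show i1: "integrable M1 F"
    using F r1 r2 unfolding real_integrable_def infinity_ennreal_def less_top by simp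
  show "(\<integral>z. F z \<partial>M1) + (\<integral>z. F z \<partial>M2) = (\<integral>z. F z \<partial>M3) + (\<integral>z. F z \<partial>M4)"
    using r1 r2 by (simp add: real_lebesgue_integral_def int i1)
qed

lemma ext_integral_integrable:
  assumes "integrable M f" shows "ext_integral M f = ereal (\<integral>z. f z \<partial>M)"
proof -
  have "(\<integral>\<^sup>+z. ennreal (f z) \<partial>M) < top" "(\<integral>\<^sup>+z. ennreal (- f z) \<partial>M) < top"
    using assms unfolding real_integrable_def infinity_ennreal_def less_top by simp_all
  then have "(\<integral>\<^sup>+z. ennreal (f z) \<partial>M) = ennreal (enn2real (\<integral>\<^sup>+z. ennreal (f z) \<partial>M))"
    "(\<integral>\<^sup>+z. ennreal (- f z) \<partial>M) = ennreal (enn2real (\<integral>\<^sup>+z. ennreal (- f z) \<partial>M))" by simp_all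
  then have "enn2ereal (\<integral>\<^sup>+z. ennreal (f z) \<partial>M) = ereal (enn2real (\<integral>\<^sup>+z. ennreal (f z) \<partial>M))"
    "enn2ereal (\<integral>\<^sup>+z. ennreal (- f z) \<partial>M) = ereal (enn2real (\<integral>\<^sup>+z. ennreal (- f z) \<partial>M))"
    by (metis enn2ereal_ennreal enn2real_nonneg)+
  then show ?thesis unfolding ext_integral_def real_lebesgue_integral_def[OF assms] by simp
qed

lemma integrable_of_ext_integral_finite:
  assumes f: "f \<in> borel_measurable M" and neg: "(\<integral>\<^sup>+z. ennreal (- f z) \<partial>M) < top"
    and ext: "ext_integral M f < \<infinity>"
  shows "integrable M f"
proof -
  have "(\<integral>\<^sup>+z. ennreal (f z) \<partial>M) \<noteq> top"
  proof
    assume "(\<integral>\<^sup>+z. ennreal (f z) \<partial>M) = top"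
    moreover obtain r where "0 \<le> r" "(\<integral>\<^sup>+z. ennreal (- f z) \<partial>M) = ennreal r"
      using neg by (cases "\<integral>\<^sup>+z. ennreal (- f z) \<partial>M") auto
    ultimately show False using ext unfolding ext_integral_def
      by (simp add: top_ennreal.rep_eq enn2ereal_ennreal top_ereal_def)
  qed
  then show ?thesis using f neg unfolding real_integrable_def infinity_ennreal_def less_top by simp
qed

text \<open>Replaces a statement about a kernel by linear equations in \<pi>. An exchange of mass
  preserves them as soon as the removed and the added measure have equal integrals of
  \<open>indicator A (fst z) * snd z\<close>.\<close>

lemma martingale_plans_iff:
  fixes \<mu> \<nu> :: "real measure" and \<pi> :: "(real \<times> real) measure"
  assumes \<mu>: "prob_space \<mu>" "integrable \<mu> (\<lambda>x. x)" and \<nu>: "integrable \<nu> (\<lambda>y. y)"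
    and sets: "sets \<pi> = sets borel" and marg: "fst_marginal \<pi> = \<mu>" "snd_marginal \<pi> = \<nu>"
  shows "integrable \<pi> snd"
    and "\<pi> \<in> martingale_plans \<mu> \<nu> \<longleftrightarrow>
      (\<forall>A\<in>sets borel. (\<integral>z. indicator A (fst z) * snd z \<partial>\<pi>) = (\<integral>x. indicator A x * x \<partial>\<mu>))"
proof -
  have m: "fst \<in> \<pi> \<rightarrow>\<^sub>M (borel :: real measure)" "snd \<in> \<pi> \<rightarrow>\<^sub>M (borel :: real measure)"
    unfolding measurable_cong_sets[OF sets refl] borel_prod[symmetric] by auto
  show int: "integrable \<pi> snd"
    using \<nu> unfolding marg(2)[symmetric] by (subst (asm) integrable_distr_eq[OF m(2)]) auto
  have s\<mu>: "sets \<mu> = sets borel" using marg(1) by auto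
  have "prob_space \<pi>"
  proof
    have "emeasure \<mu> (space \<mu>) = emeasure \<pi> (space \<pi>)"
      unfolding marg(1)[symmetric] by (subst emeasure_distr[OF m(1)]) auto
    then show "emeasure \<pi> (space \<pi>) = 1" using prob_space.emeasure_space_1[OF \<mu>(1)] by simp
  qed
  then obtain \<kappa>0 where \<kappa>0: "disintegration \<pi> \<kappa>0" using ex_disintegration sets by blast
  have key: "(AE x in \<mu>. integrable (\<kappa> x) (\<lambda>y. y) \<and> (\<integral>y. y \<partial>\<kappa> x) = x) \<longleftrightarrow>
      (\<forall>A\<in>sets borel. (\<integral>z. indicator A (fst z) * snd z \<partial>\<pi>) = (\<integral>x. indicator A x * x \<partial>\<mu>))"
    if \<kappa>: "disintegration \<pi> \<kappa>" for \<kappa>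
  proof -
    define \<beta> where "\<beta> x = enn2real (\<integral>\<^sup>+y. ennreal y \<partial>\<kappa> x) - enn2real (\<integral>\<^sup>+y. ennreal (- y) \<partial>\<kappa> x)" for x
    note b = disintegration_barycenter[OF sets \<kappa> int, unfolded marg, folded \<beta>_def]
    have "(AE x in \<mu>. integrable (\<kappa> x) (\<lambda>y. y) \<and> (\<integral>y. y \<partial>\<kappa> x) = x) \<longleftrightarrow> (AE x in \<mu>. \<beta> x = x)"
      using b(2) by (auto elim!: eventually_elim2)
    also have "\<dots> \<longleftrightarrow> (\<forall>A\<in>sets borel. (\<integral>x. indicator A x * \<beta> x \<partial>\<mu>) = (\<integral>x. indicator A x * x \<partial>\<mu>))"
    proof
      assume ae: "AE x in \<mu>. \<beta> x = x"
      show "\<forall>A\<in>sets borel. (\<integral>x. indicator A x * \<beta> x \<partial>\<mu>) = (\<integral>x. indicator A x * x \<partial>\<mu>)"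
      proof
        fix A :: "real set" assume A: "A \<in> sets borel"
        then have [measurable]: "A \<in> sets \<mu>" using s\<mu> by simp
        have [measurable]: "\<beta> \<in> borel_measurable \<mu>" "(\<lambda>x. x) \<in> borel_measurable \<mu>" using b(1) \<mu>(2) by auto
        show "(\<integral>x. indicator A x * \<beta> x \<partial>\<mu>) = (\<integral>x. indicator A x * x \<partial>\<mu>)"
          by (rule integral_cong_AE) (use ae in auto)
      qed
    next
      assume eq: "\<forall>A\<in>sets borel. (\<integral>x. indicator A x * \<beta> x \<partial>\<mu>) = (\<integral>x. indicator A x * x \<partial>\<mu>)"
      show "AE x in \<mu>. \<beta> x = x"
        by (rule density_unique_real[OF b(1) \<mu>(2)])
           (use eq s\<mu> in \<open>auto simp: set_lebesgue_integral_def\<close>)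
    qed
    also have "\<dots> \<longleftrightarrow> (\<forall>A\<in>sets borel. (\<integral>z. indicator A (fst z) * snd z \<partial>\<pi>) = (\<integral>x. indicator A x * x \<partial>\<mu>))"
      using b(3) by auto
    finally show ?thesis .
  qed
  show "\<pi> \<in> martingale_plans \<mu> \<nu> \<longleftrightarrow>
      (\<forall>A\<in>sets borel. (\<integral>z. indicator A (fst z) * snd z \<partial>\<pi>) = (\<integral>x. indicator A x * x \<partial>\<mu>))"
    unfolding martingale_plans_def using sets marg key \<kappa>0 by auto
qed

section \<open>Improving a martingale plan\<close>

text \<open>A function of the first coordinate sees only the row sums of the weights, so weights
  with equal row sums give mixtures with the same first marginal.\<close>

lemma mixture_fst:
  fixes u :: "'i \<Rightarrow> 'j \<Rightarrow> 'e \<Rightarrow> real"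
  assumes fin: "finite I" "finite J"
    and u: "\<And>i j. i \<in> I \<Longrightarrow> j \<in> J \<Longrightarrow> u i j \<in> borel_measurable \<eta>"
    and u0: "\<And>i j e. i \<in> I \<Longrightarrow> j \<in> J \<Longrightarrow> 0 \<le> u i j e"
    and x: "\<And>i. i \<in> I \<Longrightarrow> x i \<in> borel_measurable \<eta>" and g: "g \<in> borel_measurable borel"
  shows "(\<Sum>s\<in>I\<times>J. \<integral>\<^sup>+e. ennreal (u (fst s) (snd s) e) * g (x (fst s) e :: real) \<partial>\<eta>)
       = (\<integral>\<^sup>+e. (\<Sum>i\<in>I. ennreal (\<Sum>j\<in>J. u i j e) * g (x i e)) \<partial>\<eta>)"
proof -
  have m: "(\<lambda>e. ennreal (u (fst s) (snd s) e) * g (x (fst s) e)) \<in> borel_measurable \<eta>" if "s \<in> I \<times> J" for s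
    by (rule borel_measurable_times_ennreal[OF measurable_compose[OF u measurable_ennreal] measurable_compose[OF x g]])
       (use that in auto)
  have "(\<Sum>s\<in>I\<times>J. \<integral>\<^sup>+e. ennreal (u (fst s) (snd s) e) * g (x (fst s) e) \<partial>\<eta>)
      = (\<integral>\<^sup>+e. (\<Sum>s\<in>I\<times>J. ennreal (u (fst s) (snd s) e) * g (x (fst s) e)) \<partial>\<eta>)"
    by (rule nn_integral_sum[symmetric]) (rule m)
  also have "\<dots> = (\<integral>\<^sup>+e. (\<Sum>i\<in>I. ennreal (\<Sum>j\<in>J. u i j e) * g (x i e)) \<partial>\<eta>)"
  proof (rule nn_integral_cong)
    fix e
    have "(\<Sum>s\<in>I\<times>J. ennreal (u (fst s) (snd s) e) * g (x (fst s) e)) = (\<Sum>i\<in>I. \<Sum>j\<in>J. ennreal (u i j e) * g (x i e))"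
      by (simp add: sum.cartesian_product case_prod_beta)
    also have "\<dots> = (\<Sum>i\<in>I. ennreal (\<Sum>j\<in>J. u i j e) * g (x i e))"
      using u0 by (intro sum.cong refl) (simp add: sum_distrib_right[symmetric])
    finally show "(\<Sum>s\<in>I\<times>J. ennreal (u (fst s) (snd s) e) * g (x (fst s) e)) = (\<Sum>i\<in>I. ennreal (\<Sum>j\<in>J. u i j e) * g (x i e))" .
  qed
  finally show ?thesis .
qed

lemma mixture_snd:
  fixes u :: "'i \<Rightarrow> 'j \<Rightarrow> 'e \<Rightarrow> real"
  assumes fin: "finite I" "finite J"
    and u: "\<And>i j. i \<in> I \<Longrightarrow> j \<in> J \<Longrightarrow> u i j \<in> borel_measurable \<eta>"
    and u0: "\<And>i j e. i \<in> I \<Longrightarrow> j \<in> J \<Longrightarrow> 0 \<le> u i j e"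
    and y: "\<And>j. j \<in> J \<Longrightarrow> y j \<in> borel_measurable \<eta>" and g: "g \<in> borel_measurable borel"
  shows "(\<Sum>s\<in>I\<times>J. \<integral>\<^sup>+e. ennreal (u (fst s) (snd s) e) * g (y (snd s) e :: real) \<partial>\<eta>)
       = (\<integral>\<^sup>+e. (\<Sum>j\<in>J. ennreal (\<Sum>i\<in>I. u i j e) * g (y j e)) \<partial>\<eta>)"
proof -
  have "(\<Sum>s\<in>I\<times>J. \<integral>\<^sup>+e. ennreal (u (fst s) (snd s) e) * g (y (snd s) e) \<partial>\<eta>)
      = (\<Sum>s\<in>J\<times>I. \<integral>\<^sup>+e. ennreal (u (snd s) (fst s) e) * g (y (fst s) e) \<partial>\<eta>)"
    by (rule sum.reindex_bij_witness[of _ prod.swap prod.swap]) auto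
  also have "\<dots> = (\<integral>\<^sup>+e. (\<Sum>j\<in>J. ennreal (\<Sum>i\<in>I. u i j e) * g (y j e)) \<partial>\<eta>)"
    by (rule mixture_fst[of J I "\<lambda>j i. u i j"]) (use assms in auto)
  finally show ?thesis .
qed

text \<open>Each hypothesis on the weights serves one property of the exchanged plan:
  \<open>rows\<close> and \<open>cols\<close> keep the two marginals, \<open>bary\<close> the
  martingale equations, \<open>dom\<close> makes the removed mixture at most \<pi>, and
  \<open>less\<close> lowers the cost.\<close>

lemma optimal_plan_no_improvement:
  fixes \<mu> \<nu> :: "real measure" and c :: "real \<times> real \<Rightarrow> real" and \<pi> :: "(real \<times> real) measure"
    and w v :: "'i \<Rightarrow> 'j \<Rightarrow> 'e \<Rightarrow> real" and x :: "'i \<Rightarrow> 'e \<Rightarrow> real" and y :: "'j \<Rightarrow> 'e \<Rightarrow> real"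
  assumes \<mu>: "prob_space \<mu>" "integrable \<mu> (\<lambda>x. x)" and \<nu>: "integrable \<nu> (\<lambda>y. y)"
    and c[measurable]: "c \<in> borel_measurable borel"
    and suff: "sufficient_integrability \<mu> \<nu> c"
    and opt: "optimal_martingale_plan \<mu> \<nu> c \<pi>" and cost: "ext_integral \<pi> c < \<infinity>"
    and \<eta>: "prob_space \<eta>" and fin: "finite I" "finite J"
    and xm: "\<And>i. i \<in> I \<Longrightarrow> x i \<in> borel_measurable \<eta>"
    and ym: "\<And>j. j \<in> J \<Longrightarrow> y j \<in> borel_measurable \<eta>"
    and wm: "\<And>i j. i \<in> I \<Longrightarrow> j \<in> J \<Longrightarrow> w i j \<in> borel_measurable \<eta>"
    and vm: "\<And>i j. i \<in> I \<Longrightarrow> j \<in> J \<Longrightarrow> v i j \<in> borel_measurable \<eta>"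
    and w0: "\<And>i j e. i \<in> I \<Longrightarrow> j \<in> J \<Longrightarrow> 0 \<le> w i j e"
    and v0: "\<And>i j e. i \<in> I \<Longrightarrow> j \<in> J \<Longrightarrow> 0 \<le> v i j e"
    and rows: "\<And>i e. i \<in> I \<Longrightarrow> (\<Sum>j\<in>J. w i j e) = (\<Sum>j\<in>J. v i j e)"
    and cols: "\<And>j e. j \<in> J \<Longrightarrow> (\<Sum>i\<in>I. w i j e) = (\<Sum>i\<in>I. v i j e)"
    and bary: "\<And>i e. i \<in> I \<Longrightarrow> (\<Sum>j\<in>J. w i j e * y j e) = (\<Sum>j\<in>J. v i j e * y j e)"
    and less: "AE e in \<eta>. (\<Sum>i\<in>I. \<Sum>j\<in>J. v i j e * c (x i e, y j e)) < (\<Sum>i\<in>I. \<Sum>j\<in>J. w i j e * c (x i e, y j e))"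
    and dom: "\<And>B. B \<in> sets borel \<Longrightarrow>
       (\<Sum>i\<in>I. \<Sum>j\<in>J. \<integral>\<^sup>+e. ennreal (w i j e) * indicator B (x i e, y j e) \<partial>\<eta>) \<le> emeasure \<pi> B"
  shows False
proof -
  interpret \<mu>: prob_space \<mu> by fact
  interpret \<eta>: prob_space \<eta> by fact
  have plan: "\<pi> \<in> martingale_plans \<mu> \<nu>" using opt by (simp add: optimal_martingale_plan_def)
  then have sets: "sets \<pi> = sets borel" and marg: "fst_marginal \<pi> = \<mu>" "snd_marginal \<pi> = \<nu>"
    by (auto simp: martingale_plans_def)
  have s\<mu>: "sets \<mu> = sets borel" and s\<nu>: "sets \<nu> = sets borel" using marg by auto
  have fs[measurable]: "fst \<in> (borel :: (real \<times> real) measure) \<rightarrow>\<^sub>M (borel :: real measure)"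
    "snd \<in> (borel :: (real \<times> real) measure) \<rightarrow>\<^sub>M (borel :: real measure)"
    unfolding borel_prod[symmetric] by auto
  have nn_marg: "(\<integral>\<^sup>+z. g (p z) \<partial>\<pi>) = (\<integral>\<^sup>+t. g t \<partial>distr \<pi> borel p)"
    if "p \<in> borel \<rightarrow>\<^sub>M borel" "g \<in> borel_measurable borel" for p :: "real \<times> real \<Rightarrow> real" and g
  proof -
    have "p \<in> \<pi> \<rightarrow>\<^sub>M borel" unfolding measurable_cong_sets[OF sets refl] by fact
    from nn_integral_distr[OF this, of g] that(2) show ?thesis by simp
  qed
  have "emeasure \<pi> (space \<pi>) = 1"
    using nn_marg[OF fs(1), of "\<lambda>_. 1"] \<mu>.emeasure_space_1 by (simp add: marg)
  then interpret \<pi>: prob_space \<pi> by (rule prob_spaceI)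

  let ?T = "I \<times> J"
  define W where "W s = w (fst s) (snd s)" for s
  define V where "V s = v (fst s) (snd s)" for s
  define Z where "Z s e = (x (fst s) e, y (snd s) e)" for s e
  have T: "finite ?T" using fin by auto
  have Wm: "W s \<in> borel_measurable \<eta>" and Vm: "V s \<in> borel_measurable \<eta>"
    and Zm: "Z s \<in> \<eta> \<rightarrow>\<^sub>M borel" if "s \<in> ?T" for s
    using that wm vm unfolding W_def V_def Z_def[abs_def] borel_prod[symmetric]
    by (auto intro!: measurable_Pair xm ym)
  have W0: "0 \<le> W s e" and V0: "0 \<le> V s e" if "s \<in> ?T" for s e
    using that w0 v0 by (auto simp: W_def V_def)
  have "\<exists>\<omega>. sets \<omega> = sets borel \<and> (\<forall>f\<in>borel_measurable borel.
       (\<integral>\<^sup>+z. f z \<partial>\<omega>) = (\<Sum>s\<in>?T. \<integral>\<^sup>+e. ennreal (W s e) * f (Z s e) \<partial>\<eta>))"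
    by (rule ex_mixture[OF \<eta> T Wm Zm])
  then obtain \<omega> where \<omega>: "sets \<omega> = sets borel" "\<forall>f\<in>borel_measurable borel.
       (\<integral>\<^sup>+z. f z \<partial>\<omega>) = (\<Sum>s\<in>?T. \<integral>\<^sup>+e. ennreal (W s e) * f (Z s e) \<partial>\<eta>)"
    by auto
  have "\<exists>\<omega>. sets \<omega> = sets borel \<and> (\<forall>f\<in>borel_measurable borel.
       (\<integral>\<^sup>+z. f z \<partial>\<omega>) = (\<Sum>s\<in>?T. \<integral>\<^sup>+e. ennreal (V s e) * f (Z s e) \<partial>\<eta>))"
    by (rule ex_mixture[OF \<eta> T Vm Zm])
  then obtain \<omega>' where \<omega>': "sets \<omega>' = sets borel" "\<forall>f\<in>borel_measurable borel.
       (\<integral>\<^sup>+z. f z \<partial>\<omega>') = (\<Sum>s\<in>?T. \<integral>\<^sup>+e. ennreal (V s e) * f (Z s e) \<partial>\<eta>)"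
    by auto
  have \<omega>\<pi>: "emeasure \<omega> B \<le> emeasure \<pi> B" for B
  proof (cases "B \<in> sets borel")
    case True
    then have "emeasure \<omega> B = (\<Sum>s\<in>?T. \<integral>\<^sup>+e. ennreal (W s e) * indicator B (Z s e) \<partial>\<eta>)"
      using \<omega>(2)[rule_format, of "indicator B"] \<omega>(1) by simp
    also have "\<dots> = (\<Sum>i\<in>I. \<Sum>j\<in>J. \<integral>\<^sup>+e. ennreal (w i j e) * indicator B (x i e, y j e) \<partial>\<eta>)"
      by (simp add: sum.cartesian_product case_prod_beta W_def Z_def)
    also have "\<dots> \<le> emeasure \<pi> B" by (rule dom[OF True])
    finally show ?thesis .
  qed (simp add: emeasure_notin_sets \<omega>(1))
  have sw: "(\<integral>\<^sup>+z. g (fst z) \<partial>\<omega>) = (\<integral>\<^sup>+z. g (fst z) \<partial>\<omega>')"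
    and sw': "(\<integral>\<^sup>+z. g (snd z) \<partial>\<omega>) = (\<integral>\<^sup>+z. g (snd z) \<partial>\<omega>')"
    if g[measurable]: "g \<in> borel_measurable borel" for g
  proof -
    have mfst_w: "(\<Sum>s\<in>?T. \<integral>\<^sup>+e. ennreal (w (fst s) (snd s) e) * g (x (fst s) e) \<partial>\<eta>)
      = (\<integral>\<^sup>+e. (\<Sum>i\<in>I. ennreal (\<Sum>j\<in>J. w i j e) * g (x i e)) \<partial>\<eta>)"
      by (rule mixture_fst[OF fin wm w0 xm g])
    have mfst_v: "(\<Sum>s\<in>?T. \<integral>\<^sup>+e. ennreal (v (fst s) (snd s) e) * g (x (fst s) e) \<partial>\<eta>)
      = (\<integral>\<^sup>+e. (\<Sum>i\<in>I. ennreal (\<Sum>j\<in>J. v i j e) * g (x i e)) \<partial>\<eta>)"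
      by (rule mixture_fst[OF fin vm v0 xm g])
    have "(\<integral>\<^sup>+e. (\<Sum>i\<in>I. ennreal (\<Sum>j\<in>J. w i j e) * g (x i e)) \<partial>\<eta>)
        = (\<integral>\<^sup>+e. (\<Sum>i\<in>I. ennreal (\<Sum>j\<in>J. v i j e) * g (x i e)) \<partial>\<eta>)" using rows by simp
    then show "(\<integral>\<^sup>+z. g (fst z) \<partial>\<omega>) = (\<integral>\<^sup>+z. g (fst z) \<partial>\<omega>')"
      using mfst_w mfst_v
        \<omega>(2)[rule_format, of "\<lambda>z. g (fst z)"] \<omega>'(2)[rule_format, of "\<lambda>z. g (fst z)"]
      by (simp add: W_def V_def Z_def)
    have msnd_w: "(\<Sum>s\<in>?T. \<integral>\<^sup>+e. ennreal (w (fst s) (snd s) e) * g (y (snd s) e) \<partial>\<eta>)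
      = (\<integral>\<^sup>+e. (\<Sum>j\<in>J. ennreal (\<Sum>i\<in>I. w i j e) * g (y j e)) \<partial>\<eta>)"
      by (rule mixture_snd[OF fin wm w0 ym g])
    have msnd_v: "(\<Sum>s\<in>?T. \<integral>\<^sup>+e. ennreal (v (fst s) (snd s) e) * g (y (snd s) e) \<partial>\<eta>)
      = (\<integral>\<^sup>+e. (\<Sum>j\<in>J. ennreal (\<Sum>i\<in>I. v i j e) * g (y j e)) \<partial>\<eta>)"
      by (rule mixture_snd[OF fin vm v0 ym g])
    have "(\<integral>\<^sup>+e. (\<Sum>j\<in>J. ennreal (\<Sum>i\<in>I. w i j e) * g (y j e)) \<partial>\<eta>)
        = (\<integral>\<^sup>+e. (\<Sum>j\<in>J. ennreal (\<Sum>i\<in>I. v i j e) * g (y j e)) \<partial>\<eta>)" using cols by simp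
    then show "(\<integral>\<^sup>+z. g (snd z) \<partial>\<omega>) = (\<integral>\<^sup>+z. g (snd z) \<partial>\<omega>')"
      using msnd_w msnd_v
        \<omega>(2)[rule_format, of "\<lambda>z. g (snd z)"] \<omega>'(2)[rule_format, of "\<lambda>z. g (snd z)"]
      by (simp add: W_def V_def Z_def)
  qed
  have le_nn: "(\<integral>\<^sup>+z. f z \<partial>\<omega>) \<le> (\<integral>\<^sup>+z. f z \<partial>\<pi>)" for f
    by (rule nn_integral_mono_measure) (use \<omega>\<pi> \<omega>(1) sets in \<open>auto simp: le_measure\<close>)
  have fin\<omega>: "finite_measure \<omega>"
  proof
    show "emeasure \<omega> (space \<omega>) \<noteq> \<infinity>"
      using \<omega>\<pi>[of "space \<omega>"] \<pi>.emeasure_finite by (metis infinity_ennreal_def neq_top_trans)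
  qed
  obtain \<pi>' where \<pi>': "sets \<pi>' = sets (diff_measure \<pi> \<omega>)"
    "\<forall>A\<in>sets (diff_measure \<pi> \<omega>). emeasure \<pi>' A = emeasure (diff_measure \<pi> \<omega>) A + emeasure \<omega>' A"
    using ex_sum_measure[of "diff_measure \<pi> \<omega>" \<omega>'] sets \<omega>'(1) by auto
  have s': "sets \<pi>' = sets borel" using \<pi>'(1) sets by simp
  have em: "emeasure \<pi>' A + emeasure \<omega> A = emeasure \<pi> A + emeasure \<omega>' A" if "A \<in> sets \<pi>'" for A
  proof -
    have A: "A \<in> sets \<pi>" using that s' sets by simp
    have "emeasure (diff_measure \<pi> \<omega>) A = emeasure \<pi> A - emeasure \<omega> A"
      by (rule emeasure_diff_measure[OF \<pi>.finite_measure_axioms fin\<omega> _ _ A]) (use \<omega>\<pi> sets \<omega>(1) in auto)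
    then have "emeasure \<pi>' A + emeasure \<omega> A = (emeasure \<pi> A - emeasure \<omega> A + emeasure \<omega> A) + emeasure \<omega>' A"
      using \<pi>'(2) A by (simp add: ac_simps)
    also have "emeasure \<pi> A - emeasure \<omega> A + emeasure \<omega> A = emeasure \<pi> A"
      by (rule diff_add_cancel_ennreal[OF \<omega>\<pi>])
    finally show ?thesis .
  qed
  have sets4: "sets \<omega> = sets \<pi>'" "sets \<pi> = sets \<pi>'" "sets \<omega>' = sets \<pi>'"
    using s' sets \<omega>(1) \<omega>'(1) by auto
  have exch_nn: "(\<integral>\<^sup>+z. f z \<partial>\<pi>') + (\<integral>\<^sup>+z. f z \<partial>\<omega>) = (\<integral>\<^sup>+z. f z \<partial>\<pi>) + (\<integral>\<^sup>+z. f z \<partial>\<omega>')"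
    if "f \<in> borel_measurable \<pi>'" for f
    by (rule nn_integral_add_measures[OF sets4 em that])
  have exch_int: "integrable \<pi>' F"
    and exch: "(\<integral>z. F z \<partial>\<pi>') + (\<integral>z. F z \<partial>\<omega>) = (\<integral>z. F z \<partial>\<pi>) + (\<integral>z. F z \<partial>\<omega>')"
    if F: "integrable \<omega> F" "integrable \<pi> F" "integrable \<omega>' F" for F :: "real \<times> real \<Rightarrow> real"
    by (rule integral_exchange(1)[OF sets4 em F], assumption, rule integral_exchange(2)[OF sets4 em F])
  have cancel: "a = b" if "a + d = b + d" "d < top" for a b d :: ennreal
    using that ennreal_add_left_cancel[of d a b] by (auto simp: add.commute)
  \<comment> \<open>The added measure \<open>\<omega>'\<close> is not dominated by \<pi>, but its
    images under the two projections are, since they agree with those of \<omega>. This gives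
    integrability under \<open>\<omega>'\<close> of functions of one coordinate.\<close>
  have proj: "distr \<pi>' borel p = distr \<pi> borel p"
    "\<And>g :: real \<Rightarrow> real. g \<in> borel_measurable borel \<Longrightarrow> integrable (distr \<pi> borel p) g \<Longrightarrow> integrable \<omega>' (\<lambda>z. g (p z))"
    if p[measurable]: "p \<in> borel \<rightarrow>\<^sub>M borel"
      and sw: "\<And>g. g \<in> borel_measurable borel \<Longrightarrow> (\<integral>\<^sup>+z. g (p z) \<partial>\<omega>) = (\<integral>\<^sup>+z. g (p z) \<partial>\<omega>')"
    for p :: "real \<times> real \<Rightarrow> real"
  proof -
    show "distr \<pi>' borel p = distr \<pi> borel p"
    proof (rule measure_eqI)
      fix A assume "A \<in> sets (distr \<pi>' borel p)"
      then have A[measurable]: "A \<in> sets borel" by simp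
      have m: "(\<lambda>z. indicator A (p z) :: ennreal) \<in> borel_measurable \<pi>'"
        unfolding measurable_cong_sets[OF s' refl] by measurable
      have "(\<integral>\<^sup>+z. indicator A (p z) \<partial>\<omega>) \<le> (\<integral>\<^sup>+z. indicator A (p z) \<partial>\<pi>)" by (rule le_nn)
      also have "\<dots> \<le> (\<integral>\<^sup>+z. 1 \<partial>\<pi>)" by (intro nn_integral_mono) (simp add: indicator_def)
      also have "\<dots> < top" by (simp add: \<pi>.emeasure_space_1)
      finally have "(\<integral>\<^sup>+z. indicator A (p z) \<partial>\<pi>') = (\<integral>\<^sup>+z. indicator A (p z) \<partial>\<pi>)"
        using cancel[OF exch_nn[OF m, folded sw[OF borel_measurable_indicator[OF A]]]] by blast
      moreover have "emeasure (distr K borel p) A = (\<integral>\<^sup>+z. indicator A (p z) \<partial>K)" if "sets K = sets borel" for K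
        using nn_integral_distr[of p K borel "indicator A"] p A unfolding measurable_cong_sets[OF that refl] by simp
      ultimately show "emeasure (distr \<pi>' borel p) A = emeasure (distr \<pi> borel p) A" using s' sets by simp
    qed simp
    fix g :: "real \<Rightarrow> real"
    assume g[measurable]: "g \<in> borel_measurable borel" and int: "integrable (distr \<pi> borel p) g"
    have "(\<integral>\<^sup>+z. ennreal (norm (g (p z))) \<partial>\<omega>') \<le> (\<integral>\<^sup>+z. ennreal (norm (g (p z))) \<partial>\<pi>)"
      using le_nn[of "\<lambda>z. ennreal (norm (g (p z)))"] sw[of "\<lambda>t. ennreal (norm (g t))"] by simp
    also have "\<dots> = (\<integral>\<^sup>+t. ennreal (norm (g t)) \<partial>distr \<pi> borel p)" by (rule nn_marg[OF p]) simp
    also have "\<dots> < \<infinity>" using int unfolding integrable_iff_bounded by simp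
    finally show "integrable \<omega>' (\<lambda>z. g (p z))"
      unfolding integrable_iff_bounded measurable_cong_sets[OF \<omega>'(1) refl] by simp
  qed
  have marg': "fst_marginal \<pi>' = \<mu>"
    unfolding marg(1)[symmetric] by (rule proj(1)[OF fs(1) sw])
  have marg'': "snd_marginal \<pi>' = \<nu>"
    unfolding marg(2)[symmetric] by (rule proj(1)[OF fs(2) sw'])
  have int_fst: "integrable \<omega>' (\<lambda>z. g (fst z))" if "g \<in> borel_measurable borel" "integrable \<mu> g" for g :: "real \<Rightarrow> real"
    by (rule proj(2)[OF fs(1) sw that(1)]) (use that(2) marg in simp_all)
  have int_snd: "integrable \<omega>' (\<lambda>z. g (snd z))" if "g \<in> borel_measurable borel" "integrable \<nu> g" for g :: "real \<Rightarrow> real"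
    by (rule proj(2)[OF fs(2) sw' that(1)]) (use that(2) marg in simp_all)
  have int_iff: "integrable \<omega> F \<longleftrightarrow> (\<forall>s\<in>?T. integrable \<eta> (\<lambda>e. W s e * F (Z s e)))"
    if F: "F \<in> borel_measurable borel" for F :: "real \<times> real \<Rightarrow> real"
    by (rule mixture_integrable_iff(1)[OF \<omega>(1) T \<omega>(2)[rule_format] W0 Wm Zm F])
  have int_eq: "(\<integral>z. F z \<partial>\<omega>) = (\<Sum>s\<in>?T. \<integral>e. W s e * F (Z s e) \<partial>\<eta>)"
    if F: "F \<in> borel_measurable borel" and int: "integrable \<omega> F" for F :: "real \<times> real \<Rightarrow> real"
    by (rule mixture_integrable_iff(2)[OF \<omega>(1) T \<omega>(2)[rule_format] W0 Wm Zm F int])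
  have int_iff': "integrable \<omega>' F \<longleftrightarrow> (\<forall>s\<in>?T. integrable \<eta> (\<lambda>e. V s e * F (Z s e)))"
    if F: "F \<in> borel_measurable borel" for F :: "real \<times> real \<Rightarrow> real"
    by (rule mixture_integrable_iff(1)[OF \<omega>'(1) T \<omega>'(2)[rule_format] V0 Vm Zm F])
  have int_eq': "(\<integral>z. F z \<partial>\<omega>') = (\<Sum>s\<in>?T. \<integral>e. V s e * F (Z s e) \<partial>\<eta>)"
    if F: "F \<in> borel_measurable borel" and int: "integrable \<omega>' F" for F :: "real \<times> real \<Rightarrow> real"
    by (rule mixture_integrable_iff(2)[OF \<omega>'(1) T \<omega>'(2)[rule_format] V0 Vm Zm F int])
  have int\<omega>: "integrable \<omega> F" if "integrable \<pi> F" "F \<in> borel_measurable borel" for F :: "real \<times> real \<Rightarrow> real"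
  proof -
    have "(\<integral>\<^sup>+z. ennreal (norm (F z)) \<partial>\<omega>) < \<infinity>"
      using le_nn[of "\<lambda>z. ennreal (norm (F z))"] that(1) unfolding integrable_iff_bounded by (meson le_less_trans)
    then show ?thesis using that(2) unfolding integrable_iff_bounded measurable_cong_sets[OF \<omega>(1) refl] by simp
  qed
  note mp = martingale_plans_iff[OF \<mu> \<nu> sets marg]
  note mp' = martingale_plans_iff[OF \<mu> \<nu> s' marg' marg'']

  have plan': "\<pi>' \<in> martingale_plans \<mu> \<nu>"
    unfolding mp'(2)
  proof
    fix A :: "real set" assume A[measurable]: "A \<in> sets borel"
    let ?F = "\<lambda>z :: real \<times> real. indicator A (fst z) * snd z"
    have Fm: "?F \<in> borel_measurable borel" by measurable
    have bnd: "integrable M ?F" if "integrable M snd" "sets M = sets borel" for M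
    proof (rule Bochner_Integration.integrable_bound[OF that(1)])
      show "?F \<in> borel_measurable M" unfolding measurable_cong_sets[OF that(2) refl] by (rule Fm)
    qed (auto simp: indicator_def)
    have i\<pi>: "integrable \<pi> ?F" by (rule bnd[OF mp(1) sets])
    have i\<omega>: "integrable \<omega> ?F" by (rule int\<omega>[OF i\<pi> Fm])
    have i\<omega>': "integrable \<omega>' ?F" by (rule bnd[OF _ \<omega>'(1)]) (use int_snd[of "\<lambda>t. t", OF _ \<nu>] in simp)
    have "(\<integral>z. ?F z \<partial>\<omega>) = (\<integral>z. ?F z \<partial>\<omega>')"
    proof -
      have "(\<integral>z. ?F z \<partial>\<omega>) = (\<integral>e. (\<Sum>s\<in>?T. W s e * ?F (Z s e)) \<partial>\<eta>)"
        using int_iff[OF Fm] int_eq[OF Fm i\<omega>] i\<omega> by (subst Bochner_Integration.integral_sum) auto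
      also have "\<dots> = (\<integral>e. (\<Sum>s\<in>?T. V s e * ?F (Z s e)) \<partial>\<eta>)"
      proof (rule Bochner_Integration.integral_cong)
        fix e
        have "(\<Sum>i\<in>I. \<Sum>j\<in>J. u i j * (indicator A (x i e) * y j e)) = (\<Sum>i\<in>I. indicator A (x i e) * (\<Sum>j\<in>J. u i j * y j e))" for u
          by (simp add: sum_distrib_left ac_simps)
        then have "(\<Sum>i\<in>I. \<Sum>j\<in>J. w i j e * (indicator A (x i e) * y j e)) = (\<Sum>i\<in>I. \<Sum>j\<in>J. v i j e * (indicator A (x i e) * y j e))"
          using bary by simp
        then show "(\<Sum>s\<in>?T. W s e * ?F (Z s e)) = (\<Sum>s\<in>?T. V s e * ?F (Z s e))"
          by (simp add: sum.cartesian_product case_prod_beta W_def V_def Z_def)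
      qed simp
      also have "\<dots> = (\<integral>z. ?F z \<partial>\<omega>')"
        using int_iff'[OF Fm] int_eq'[OF Fm i\<omega>'] i\<omega>' by (subst Bochner_Integration.integral_sum) auto
      finally show ?thesis .
    qed
    then have "(\<integral>z. ?F z \<partial>\<pi>') = (\<integral>z. ?F z \<partial>\<pi>)" using exch[OF i\<omega> i\<pi> i\<omega>'] by simp
    also have "\<dots> = (\<integral>x. indicator A x * x \<partial>\<mu>)" using mp(2) plan A by blast
    finally show "(\<integral>z. ?F z \<partial>\<pi>') = (\<integral>x. indicator A x * x \<partial>\<mu>)" .
  qed

  obtain a b where ab: "integrable \<mu> a" "integrable \<nu> b" "\<And>x y. a x + b y \<le> c (x, y)"
    using suff by (auto simp: sufficient_integrability_def)
  have [measurable]: "a \<in> borel_measurable borel" "b \<in> borel_measurable borel"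
    using borel_measurable_integrable[OF ab(1)] borel_measurable_integrable[OF ab(2)]
    unfolding measurable_cong_sets[OF s\<mu> refl] measurable_cong_sets[OF s\<nu> refl] by auto
  \<comment> \<open>A lower bound \<open>- d \<le> c\<close> with \<open>d\<close> a sum of
    functions of one coordinate each, so that \<open>d\<close> is integrable under
    \<open>\<omega>'\<close> through the marginals alone.\<close>
  define d where "d z = \<bar>a (fst z)\<bar> + \<bar>b (snd z)\<bar>" for z :: "real \<times> real"
  have dm[measurable]: "d \<in> borel_measurable borel" unfolding d_def[abs_def] by measurable
  have cd: "- d z \<le> c z" for z
    using ab(3)[of "fst z" "snd z"] unfolding d_def by (simp add: abs_le_iff)
  have d0: "0 \<le> d z" for z by (simp add: d_def)
  have d\<pi>: "(\<integral>\<^sup>+z. ennreal (d z) \<partial>\<pi>) < top"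
  proof -
    have "(\<integral>\<^sup>+z. ennreal (d z) \<partial>\<pi>) = (\<integral>\<^sup>+z. ennreal \<bar>a (fst z)\<bar> \<partial>\<pi>) + (\<integral>\<^sup>+z. ennreal \<bar>b (snd z)\<bar> \<partial>\<pi>)"
      unfolding d_def using sets by (subst nn_integral_add[symmetric]) (auto simp: measurable_cong_sets[OF sets refl])
    also have "\<dots> = (\<integral>\<^sup>+t. ennreal \<bar>a t\<bar> \<partial>\<mu>) + (\<integral>\<^sup>+t. ennreal \<bar>b t\<bar> \<partial>\<nu>)"
      by (simp add: nn_marg[of fst "\<lambda>t. ennreal \<bar>a t\<bar>"] nn_marg[of snd "\<lambda>t. ennreal \<bar>b t\<bar>"] marg)
    also have "\<dots> < top" using ab(1,2) unfolding integrable_iff_bounded by simp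
    finally show ?thesis .
  qed
  have d\<omega>': "integrable \<omega>' d"
    unfolding d_def[abs_def] using int_fst[of "\<lambda>t. \<bar>a t\<bar>"] int_snd[of "\<lambda>t. \<bar>b t\<bar>"] ab by auto
  have c\<pi>: "integrable \<pi> c"
  proof (rule integrable_of_ext_integral_finite[OF _ _ cost])
    show "c \<in> borel_measurable \<pi>" unfolding measurable_cong_sets[OF sets refl] by (rule c)
    have "(\<integral>\<^sup>+z. ennreal (- c z) \<partial>\<pi>) \<le> (\<integral>\<^sup>+z. ennreal (d z) \<partial>\<pi>)"
      by (intro nn_integral_mono ennreal_leI) (use cd in \<open>simp add: minus_le_iff\<close>)
    then show "(\<integral>\<^sup>+z. ennreal (- c z) \<partial>\<pi>) < top" using d\<pi> by (rule le_less_trans)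
  qed
  have c\<omega>: "integrable \<omega> c" by (rule int\<omega>[OF c\<pi> c])
  have cW: "integrable \<eta> (\<lambda>e. W s e * c (Z s e))" if "s \<in> ?T" for s
    using int_iff[OF c] c\<omega> that by blast
  have dV: "integrable \<eta> (\<lambda>e. V s e * d (Z s e))" if "s \<in> ?T" for s
    using int_iff'[OF dm] d\<omega>' that by blast
  have sumT: "(\<Sum>i\<in>I. \<Sum>j\<in>J. u i j) = (\<Sum>s\<in>?T. u (fst s) (snd s))" for u :: "'i \<Rightarrow> 'j \<Rightarrow> real"
    by (simp add: sum.cartesian_product case_prod_beta)
  have less': "AE e in \<eta>. (\<Sum>s\<in>?T. V s e * c (Z s e)) < (\<Sum>s\<in>?T. W s e * c (Z s e))"
    using less unfolding sumT W_def V_def Z_def .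
  \<comment> \<open>The added cost has no majorant from \<pi>; it is squeezed instead. Each term is
    at least \<open>- V s e * d (Z s e)\<close>, and the sum of all terms is below the old cost
    \<open>\<Sum> W c\<close>. Adding \<open>d\<close> to make all terms nonnegative bounds a single
    one, and the factor 2 covers both signs.\<close>
  have cV: "integrable \<eta> (\<lambda>e. V s e * c (Z s e))" if s: "s \<in> ?T" for s
  proof (rule Bochner_Integration.integrable_bound)
    show "integrable \<eta> (\<lambda>e. (\<Sum>s\<in>?T. W s e * c (Z s e)) + 2 * (\<Sum>s\<in>?T. V s e * d (Z s e)))"
      using cW dV by (intro Bochner_Integration.integrable_add integrable_mult_right Bochner_Integration.integrable_sum) auto
    show "(\<lambda>e. V s e * c (Z s e)) \<in> borel_measurable \<eta>"
      by (intro borel_measurable_times Vm measurable_compose[OF Zm c] s)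
    show "AE e in \<eta>. norm (V s e * c (Z s e)) \<le> norm ((\<Sum>s\<in>?T. W s e * c (Z s e)) + 2 * (\<Sum>s\<in>?T. V s e * d (Z s e)))"
      using less'
    proof eventually_elim
      case (elim e)
      have vd: "0 \<le> V s e * d (Z s e)" "- (V s e * d (Z s e)) \<le> V s e * c (Z s e)" if "s \<in> ?T" for s
        using V0[OF that, of e] d0[of "Z s e"] mult_left_mono[OF cd[of "Z s e"] V0[OF that]] by auto
      have vd': "0 \<le> V s e * c (Z s e) + V s e * d (Z s e)" if "s \<in> ?T" for s
        using vd(2)[OF that] by linarith
      have "V s e * c (Z s e) + V s e * d (Z s e) \<le> (\<Sum>s\<in>?T. V s e * c (Z s e) + V s e * d (Z s e))"
        by (rule member_le_sum[OF s _ T, of "\<lambda>s. V s e * c (Z s e) + V s e * d (Z s e)"]) (use vd' in blast)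
      then have 1: "V s e * c (Z s e) + V s e * d (Z s e) \<le> (\<Sum>s\<in>?T. V s e * c (Z s e)) + (\<Sum>s\<in>?T. V s e * d (Z s e))"
        by (simp add: sum.distrib)
      have 2: "V s e * d (Z s e) \<le> (\<Sum>s\<in>?T. V s e * d (Z s e))"
        by (rule member_le_sum[OF s _ T, of "\<lambda>s. V s e * d (Z s e)"]) (use vd(1) in blast)
      have 3: "- (\<Sum>s\<in>?T. V s e * d (Z s e)) \<le> (\<Sum>s\<in>?T. V s e * c (Z s e))"
        unfolding sum_negf[symmetric] by (intro sum_mono vd)
      show ?case using 1 2 3 vd[OF s] elim by (simp add: abs_le_iff)
    qed
  qed
  have c\<omega>': "integrable \<omega>' c" using int_iff'[OF c] cV by blast
  have "(\<integral>z. c z \<partial>\<omega>') = (\<integral>e. (\<Sum>s\<in>?T. V s e * c (Z s e)) \<partial>\<eta>)"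
    using int_eq'[OF c c\<omega>'] cV by (subst Bochner_Integration.integral_sum) auto
  also have "\<dots> < (\<integral>e. (\<Sum>s\<in>?T. W s e * c (Z s e)) \<partial>\<eta>)"
    by (rule \<eta>.integral_less_AE_space) (use cV cW less' \<eta>.emeasure_space_1 in auto)
  also have "\<dots> = (\<integral>z. c z \<partial>\<omega>)"
    using int_eq[OF c c\<omega>] cW by (subst Bochner_Integration.integral_sum) auto
  finally have "(\<integral>z. c z \<partial>\<pi>') < (\<integral>z. c z \<partial>\<pi>)" using exch[OF c\<omega> c\<pi> c\<omega>'] by simp
  moreover have "ext_integral \<pi> c \<le> ext_integral \<pi>' c"
    using opt plan' by (simp add: optimal_martingale_plan_def)
  ultimately show False
    using ext_integral_integrable[OF c\<pi>] ext_integral_integrable[OF exch_int[OF c\<omega> c\<pi> c\<omega>']] by simp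
qed

text \<open>The points \<open>(x i, y j)\<close>, \<open>(i, j) \<in> S\<close>, carry the weights \<open>w\<close> of a measure, and the weights \<open>v\<close> of a
  competitor live on the grid spanned by them. The points need not be distinct.\<close>

definition improvable ::
  "(real \<times> real \<Rightarrow> real) \<Rightarrow> (nat \<times> nat) set \<Rightarrow> (nat \<Rightarrow> real) \<Rightarrow> (nat \<Rightarrow> real) \<Rightarrow>
    (nat \<Rightarrow> nat \<Rightarrow> real) \<Rightarrow> (nat \<Rightarrow> nat \<Rightarrow> real) \<Rightarrow> bool" where
  "improvable c S x y w v \<longleftrightarrow>
     (\<forall>i\<in>fst ` S. \<forall>j\<in>snd ` S. 0 \<le> w i j \<and> w i j \<le> 1 \<and> 0 \<le> v i j \<and> ((i, j) \<notin> S \<longrightarrow> w i j = 0)) \<and>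
     (\<forall>i\<in>fst ` S. (\<Sum>j\<in>snd ` S. w i j) = (\<Sum>j\<in>snd ` S. v i j)) \<and>
     (\<forall>j\<in>snd ` S. (\<Sum>i\<in>fst ` S. w i j) = (\<Sum>i\<in>fst ` S. v i j)) \<and>
     (\<forall>i\<in>fst ` S. (\<Sum>j\<in>snd ` S. w i j * y j) = (\<Sum>j\<in>snd ` S. v i j * y j)) \<and>
     (\<Sum>i\<in>fst ` S. \<Sum>j\<in>snd ` S. v i j * c (x i, y j)) < (\<Sum>i\<in>fst ` S. \<Sum>j\<in>snd ` S. w i j * c (x i, y j))"

text \<open>One sequence codes a whole configuration: the first components 0, 1, 2, 3 of the paired
  index select \<open>x\<close>, \<open>y\<close>, \<open>w\<close> and \<open>v\<close>.
  Improvability then defines a Borel set of sequences, and the points of the grid depend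
  continuously on the code.\<close>

lemma improvable_null_cover:
  fixes \<mu> \<nu> :: "real measure" and \<pi> :: "(real \<times> real) measure"
  assumes \<mu>: "prob_space \<mu>" "integrable \<mu> (\<lambda>x. x)" and \<nu>: "integrable \<nu> (\<lambda>y. y)"
    and c: "c \<in> borel_measurable borel"
    and suff: "sufficient_integrability \<mu> \<nu> c"
    and opt: "optimal_martingale_plan \<mu> \<nu> c \<pi>" and cost: "ext_integral \<pi> c < \<infinity>"
    and \<pi>: "finite_measure \<pi>" "sets \<pi> = sets borel" and S: "finite S"
  shows "\<exists>N\<in>sets borel. emeasure \<pi> N = 0 \<and>
    (\<forall>x y w v. improvable c S x y w v \<longrightarrow> (\<exists>(i, j)\<in>S. (x i, y j) \<in> N))"
proof -
  define X :: "nat \<Rightarrow> (nat \<Rightarrow> real) \<Rightarrow> real" where "X i e = e (prod_encode (0, i))" for i e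
  define Y :: "nat \<Rightarrow> (nat \<Rightarrow> real) \<Rightarrow> real" where "Y i e = e (prod_encode (1, i))" for i e
  define W :: "nat \<Rightarrow> nat \<Rightarrow> (nat \<Rightarrow> real) \<Rightarrow> real" where "W i j e = e (prod_encode (2, prod_encode (i, j)))" for i j e
  define V :: "nat \<Rightarrow> nat \<Rightarrow> (nat \<Rightarrow> real) \<Rightarrow> real" where "V i j e = e (prod_encode (3, prod_encode (i, j)))" for i j e
  have coord: "(\<lambda>e :: nat \<Rightarrow> real. e k) \<in> borel_measurable borel" for k
    by (intro borel_measurable_continuous_onI continuous_on_coordinate)
  have [measurable]: "X i \<in> borel_measurable borel" "Y i \<in> borel_measurable borel"
    "W i j \<in> borel_measurable borel" "V i j \<in> borel_measurable borel" for i j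
    unfolding X_def Y_def W_def V_def by (rule coord)+
  have XY[measurable]: "(\<lambda>e. (X i e, Y j e)) \<in> borel \<rightarrow>\<^sub>M (borel :: (real \<times> real) measure)" for i j
    unfolding borel_prod[symmetric] by measurable
  let ?I = "fst ` S" and ?J = "snd ` S"
  let ?P = "\<lambda>s e. (X (fst s) e, Y (snd s) e)"
  let ?cost = "\<lambda>U e. \<Sum>i\<in>?I. \<Sum>j\<in>?J. U i j e * c (X i e, Y j e)"
  define M where "M = {e. improvable c S (\<lambda>i. X i e) (\<lambda>j. Y j e) (\<lambda>i j. W i j e) (\<lambda>i j. V i j e)}"
  have fin: "finite ?I" "finite ?J" using S by auto
  have [measurable]: "M \<in> sets borel"
  proof -
    have cXY: "(\<lambda>e. c (X i e, Y j e)) \<in> borel_measurable borel" for i j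
      by (rule measurable_compose[OF XY c])
    have cost_meas: "(\<lambda>e. \<Sum>i\<in>?I. \<Sum>j\<in>?J. W i j e * c (X i e, Y j e)) \<in> borel_measurable borel"
      "(\<lambda>e. \<Sum>i\<in>?I. \<Sum>j\<in>?J. V i j e * c (X i e, Y j e)) \<in> borel_measurable borel"
      by (intro borel_measurable_sum borel_measurable_times cXY; measurable)+
    have pos: "{e \<in> space borel. 0 \<le> W i j e \<and> W i j e \<le> 1 \<and> 0 \<le> V i j e \<and> ((i, j) \<notin> S \<longrightarrow> W i j e = 0)} \<in> sets borel" for i j
      by (cases "(i, j) \<in> S") simp_all
    have eqs: "{e \<in> space borel. (\<Sum>j\<in>?J. W i j e) = (\<Sum>j\<in>?J. V i j e)} \<in> sets borel"
      "{e \<in> space borel. (\<Sum>i\<in>?I. W i j e) = (\<Sum>i\<in>?I. V i j e)} \<in> sets borel"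
      "{e \<in> space borel. (\<Sum>j\<in>?J. W i j e * Y j e) = (\<Sum>j\<in>?J. V i j e * Y j e)} \<in> sets borel" for i j
      by (rule borel_measurable_eq; measurable)+
    have "{e \<in> space borel. improvable c S (\<lambda>i. X i e) (\<lambda>j. Y j e) (\<lambda>i j. W i j e) (\<lambda>i j. V i j e)} \<in> sets borel"
      unfolding improvable_def
      by (intro sets.sets_Collect_conj sets.sets_Collect_finite_All fin pos eqs borel_measurable_less cost_meas)
    then show ?thesis by (simp add: M_def)
  qed
  have MD: "0 \<le> W i j e" "W i j e \<le> 1" "0 \<le> V i j e" "(i, j) \<notin> S \<Longrightarrow> W i j e = 0"
    if "e \<in> M" "i \<in> ?I" "j \<in> ?J" for i j e
    using that unfolding M_def improvable_def mem_Collect_eq by blast+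
  have Mrow: "(\<Sum>j\<in>?J. W i j e) = (\<Sum>j\<in>?J. V i j e)" "(\<Sum>j\<in>?J. W i j e * Y j e) = (\<Sum>j\<in>?J. V i j e * Y j e)"
    if "e \<in> M" "i \<in> ?I" for i e
    using that unfolding M_def improvable_def mem_Collect_eq by blast+
  have Mcol: "(\<Sum>i\<in>?I. W i j e) = (\<Sum>i\<in>?I. V i j e)" if "e \<in> M" "j \<in> ?J" for j e
    using that unfolding M_def improvable_def mem_Collect_eq by blast
  have Mcost: "?cost V e < ?cost W e"
    if "e \<in> M" for e
    using that unfolding M_def improvable_def mem_Collect_eq by blast
  have "\<exists>N\<in>sets borel. emeasure \<pi> N = 0 \<and> (\<forall>e\<in>M. \<exists>s\<in>S. (X (fst s) e, Y (snd s) e) \<in> N)"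
  proof (rule null_cover_or_dominated_measure[OF \<pi> S, of M "\<lambda>s e. (X (fst s) e, Y (snd s) e)"])
    show "continuous_on UNIV (?P s)" for s
      unfolding X_def Y_def by (intro continuous_intros continuous_on_coordinate)
  next
    fix N assume "N \<in> sets borel" "emeasure \<pi> N = 0" "\<And>e. e \<in> M \<Longrightarrow> \<exists>i\<in>S. (X (fst i) e, Y (snd i) e) \<in> N"
    then show ?thesis by blast
  next
    fix a :: real and \<eta>
    assume a: "0 < a" and \<eta>: "prob_space \<eta>" and s\<eta>[measurable_cong]: "sets \<eta> = sets borel" and ae: "AE e in \<eta>. e \<in> M"
      and dom: "\<And>B. B \<in> sets borel \<Longrightarrow>
        ennreal a * (\<Sum>s\<in>S. emeasure \<eta> (?P s -` B)) \<le> emeasure \<pi> B"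
    interpret prob_space \<eta> by fact
    \<comment> \<open>Since \<open>W \<le> 1\<close> on \<open>M\<close>, the factor
      \<open>a\<close> turns the bound on the laws of the points into domination of the mixture by
      \<pi>. The indicator makes the sign conditions and the balance equations hold at every
      \<open>e\<close>, not just almost surely.\<close>
    define w where "w i j e = a * W i j e * indicator M e" for i j e
    define v where "v i j e = a * V i j e * indicator M e" for i j e
    have [measurable]: "w i j \<in> borel_measurable \<eta>" "v i j \<in> borel_measurable \<eta>"
      "X i \<in> borel_measurable \<eta>" "Y j \<in> borel_measurable \<eta>" for i j
      unfolding w_def[abs_def] v_def[abs_def] measurable_cong_sets[OF s\<eta> refl] by measurable
    have scale: "(\<Sum>j\<in>K. a * f j * b) = a * b * (\<Sum>j\<in>K. f j)" for f :: "nat \<Rightarrow> real" and b K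
      by (simp add: sum_distrib_left ac_simps)
    have False
    proof (rule optimal_plan_no_improvement[OF \<mu> \<nu> c suff opt cost \<eta> fin, of X Y w v])
      show "0 \<le> w i j e" "0 \<le> v i j e" if "i \<in> ?I" "j \<in> ?J" for i j e
        using MD[OF _ that] a by (auto simp: w_def v_def indicator_def)
      show "(\<Sum>j\<in>?J. w i j e) = (\<Sum>j\<in>?J. v i j e)" if "i \<in> ?I" for i e
        unfolding w_def v_def scale by (cases "e \<in> M") (simp_all add: Mrow that)
      show "(\<Sum>i\<in>?I. w i j e) = (\<Sum>i\<in>?I. v i j e)" if "j \<in> ?J" for j e
        unfolding w_def v_def scale by (cases "e \<in> M") (simp_all add: Mcol that)
      show "(\<Sum>j\<in>?J. w i j e * Y j e) = (\<Sum>j\<in>?J. v i j e * Y j e)" if "i \<in> ?I" for i e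
      proof -
        have "(\<Sum>j\<in>?J. w i j e * Y j e) = a * indicator M e * (\<Sum>j\<in>?J. W i j e * Y j e)"
          "(\<Sum>j\<in>?J. v i j e * Y j e) = a * indicator M e * (\<Sum>j\<in>?J. V i j e * Y j e)"
          by (simp_all add: w_def v_def sum_distrib_left ac_simps)
        then show ?thesis by (cases "e \<in> M") (simp_all add: Mrow that)
      qed
      show "AE e in \<eta>. ?cost v e < ?cost w e"
        using ae
      proof eventually_elim
        case (elim e)
        have "?cost w e = a * ?cost W e"
          "?cost v e = a * ?cost V e"
          using elim by (simp_all add: w_def v_def sum_distrib_left ac_simps)
        then show ?case using a Mcost[OF elim] by simp
      qed
      fix B :: "(real \<times> real) set" assume B[measurable]: "B \<in> sets borel"
      let ?f = "\<lambda>i j. \<integral>\<^sup>+e. ennreal (w i j e) * indicator B (X i e, Y j e) \<partial>\<eta>"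
      have "(\<Sum>i\<in>?I. \<Sum>j\<in>?J. ?f i j) = (\<Sum>s\<in>?I \<times> ?J. ?f (fst s) (snd s))"
        by (simp add: sum.cartesian_product case_prod_beta)
      \<comment> \<open>Only the points indexed by \<open>S\<close> have laws dominated by \<pi>; at
        the other grid points the weight \<open>w\<close> vanishes.\<close>
      also have "\<dots> = (\<Sum>s\<in>S. ?f (fst s) (snd s))"
      proof (rule sum.mono_neutral_right)
        show "finite (?I \<times> ?J)" using fin by auto
        show "S \<subseteq> ?I \<times> ?J" by force
        show "\<forall>s\<in>?I \<times> ?J - S. ?f (fst s) (snd s) = 0"
        proof
          fix s assume "s \<in> ?I \<times> ?J - S"
          then have "fst s \<in> ?I" "snd s \<in> ?J" "(fst s, snd s) \<notin> S" by (simp_all add: mem_Times_iff)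
          then have "w (fst s) (snd s) e = 0" for e
            using MD(4)[of e "fst s" "snd s"] by (cases "e \<in> M") (simp_all add: w_def)
          then show "?f (fst s) (snd s) = 0" by simp
        qed
      qed
      also have "\<dots> \<le> (\<Sum>s\<in>S. ennreal a * emeasure \<eta> (?P s -` B))"
      proof (rule sum_mono)
        fix s assume s: "s \<in> S"
        have pB: "?P s -` B \<in> sets \<eta>"
          unfolding s\<eta> by (rule measurable_sets_borel[OF XY B])
        have "?f (fst s) (snd s) \<le> (\<integral>\<^sup>+e. ennreal a * indicator (?P s -` B) e \<partial>\<eta>)"
        proof (rule nn_integral_mono)
          fix e
          have "w (fst s) (snd s) e \<le> a"
          proof (cases "e \<in> M")
            case True
            then have "W (fst s) (snd s) e \<le> 1" by (rule MD(2)) (use s in auto)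
            then show ?thesis using True a by (simp add: w_def)
          qed (use a in \<open>simp add: w_def\<close>)
          then show "ennreal (w (fst s) (snd s) e) * indicator B (X (fst s) e, Y (snd s) e)
              \<le> ennreal a * indicator (?P s -` B) e"
            by (auto simp: indicator_def intro: ennreal_leI)
        qed
        also have "\<dots> = ennreal a * emeasure \<eta> (?P s -` B)"
          using pB by (simp add: nn_integral_cmult_indicator)
        finally show "?f (fst s) (snd s) \<le> ennreal a * emeasure \<eta> (?P s -` B)" .
      qed
      also have "\<dots> \<le> emeasure \<pi> B" using dom[OF B] by (simp add: sum_distrib_left)
      finally show "(\<Sum>i\<in>?I. \<Sum>j\<in>?J. ?f i j) \<le> emeasure \<pi> B" .
    qed auto
    then show ?thesis ..
  qed auto
  then obtain N where N: "N \<in> sets borel" "emeasure \<pi> N = 0" "\<forall>e\<in>M. \<exists>s\<in>S. (X (fst s) e, Y (snd s) e) \<in> N" by blast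
  have "\<exists>(i, j)\<in>S. (x i, y j) \<in> N" if imp: "improvable c S x y w v" for x y w v
  proof -
    define e where "e n = (case prod_decode n of (k, i) \<Rightarrow>
      if k = 0 then x i else if k = 1 then y i else
      if k = 2 then case_prod w (prod_decode i) else case_prod v (prod_decode i))" for n
    have "X i e = x i" "Y i e = y i" "W i j e = w i j" "V i j e = v i j" for i j
      by (simp_all add: X_def Y_def W_def V_def e_def)
    then have "e \<in> M" "\<And>i j. (X i e, Y j e) = (x i, y j)" using imp by (simp_all add: M_def)
    then show ?thesis using N(3) by fastforce
  qed
  then show ?thesis using N by blast
qed

section \<open>Measures with finite support\<close>

lemma emeasure_compl_spt:
  fixes \<alpha> :: "'a::second_countable_topology measure"
  assumes "sets \<alpha> = sets borel"
  shows "emeasure \<alpha> (- spt \<alpha>) = 0"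
proof -
  define \<U> where "\<U> = {U. open U \<and> emeasure \<alpha> U = 0}"
  \<comment> \<open>Lindelof's theorem reduces the union of all open null sets to a countable one,
    which is again null.\<close>
  obtain \<U>' where U': "\<U>' \<subseteq> \<U>" "countable \<U>'" "\<Union>\<U>' = \<Union>\<U>"
    using Lindelof[of \<U>] by (auto simp: \<U>_def)
  have "- spt \<alpha> = \<Union>\<U>" unfolding spt_def \<U>_def by (auto simp: not_less)
  also have "\<dots> = (\<Union>U\<in>\<U>'. U)" using U'(3) by simp
  also have "\<dots> \<in> null_sets \<alpha>"
    by (rule null_sets_UN'[OF U'(2)]) (use U'(1) assms in \<open>auto simp: \<U>_def null_sets_def\<close>)
  finally show ?thesis by auto
qed

lemma finite_support_integral:
  fixes \<beta> :: "'a::t1_space measure" and f :: "'a \<Rightarrow> real"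
  assumes sets: "sets \<beta> = sets borel" and "finite_measure \<beta>" and G: "finite G" "emeasure \<beta> (- G) = 0"
    and f: "f \<in> borel_measurable borel"
  shows "integrable \<beta> f" "(\<integral>z. f z \<partial>\<beta>) = (\<Sum>z\<in>G. measure \<beta> {z} * f z)"
proof -
  interpret finite_measure \<beta> by fact
  have fm: "f \<in> borel_measurable \<beta>" unfolding measurable_cong_sets[OF sets refl] by (rule f)
  have sing[simp]: "{z} \<in> sets \<beta>" for z unfolding sets by simp
  have cG: "- G \<in> sets \<beta>" unfolding sets using finite_imp_closed[OF G(1)] by simp
  have ae: "AE z in \<beta>. z \<in> G" by (rule AE_I[of _ _ "- G"]) (use G cG in auto)
  define g where "g z = (\<Sum>t\<in>G. indicator {t} z * f t)" for z
  have ind: "integrable \<beta> (indicat_real {t})" for t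
    by (rule integrable_const_bound[where B=1]) (auto intro!: borel_measurable_indicator)
  have ig: "integrable \<beta> g" unfolding g_def using ind by (intro Bochner_Integration.integrable_sum integrable_mult_left) auto
  have eq: "AE z in \<beta>. f z = g z"
    using ae
  proof eventually_elim
    case (elim z)
    have "g z = (\<Sum>t\<in>G. if t = z then f t else 0)" unfolding g_def by (intro sum.cong) (auto simp: indicator_def)
    then show ?case using G(1) elim by simp
  qed
  show "integrable \<beta> f"
    using ig eq fm borel_measurable_integrable[OF ig] by (subst integrable_cong_AE[of f _ g]) auto
  have "(\<integral>z. f z \<partial>\<beta>) = (\<integral>z. g z \<partial>\<beta>)"
    by (rule integral_cong_AE[OF fm borel_measurable_integrable[OF ig] eq])
  also have "\<dots> = (\<Sum>z\<in>G. measure \<beta> {z} * f z)"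
    unfolding g_def using ind by (subst Bochner_Integration.integral_sum) auto
  finally show "(\<integral>z. f z \<partial>\<beta>) = (\<Sum>z\<in>G. measure \<beta> {z} * f z)" .
qed

section \<open>Competitors with finite support\<close>

text \<open>The marginals of the competitor are concentrated on the finite sets \<open>X\<close> and
  \<open>Y\<close>, so it lives on the grid \<open>X \<times> Y\<close>, possibly off the support of
  \<alpha>. All integrals become finite sums, and both costs are real numbers.\<close>

lemma competitor_improvable:
  fixes c :: "real \<times> real \<Rightarrow> real" and \<alpha> \<alpha>' :: "(real \<times> real) measure"
  assumes c: "c \<in> borel_measurable borel" and sets: "sets \<alpha> = sets borel"
    and fin: "finite_measure \<alpha>" and F: "finite (spt \<alpha>)" and comp: "competitor \<alpha> \<alpha>'"
    and less: "ext_integral \<alpha>' c < ext_integral \<alpha> c"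
  shows "\<exists>S x y w v. finite S \<and> improvable c S x y w v \<and> (\<forall>(i, j)\<in>S. (x i, y j) \<in> spt \<alpha>)"
proof -
  interpret \<alpha>: finite_measure \<alpha> by fact
  have s': "sets \<alpha>' = sets borel" and m1: "fst_marginal \<alpha>' = fst_marginal \<alpha>" and m2: "snd_marginal \<alpha>' = snd_marginal \<alpha>"
    using comp by (auto simp: competitor_def)
  have fs: "fst \<in> M \<rightarrow>\<^sub>M (borel :: real measure)" "snd \<in> M \<rightarrow>\<^sub>M (borel :: real measure)"
    if "sets M = sets borel" for M :: "(real \<times> real) measure"
    unfolding measurable_cong_sets[OF that refl] borel_prod[symmetric] by auto
  have sp: "space \<alpha> = UNIV" "space \<alpha>' = UNIV" using sets_eq_imp_space_eq[OF sets] sets_eq_imp_space_eq[OF s'] by auto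
  have fst_eq: "emeasure \<alpha>' (A \<times> UNIV) = emeasure \<alpha> (A \<times> UNIV)" if "A \<in> sets borel" for A
  proof -
    have "emeasure M (A \<times> UNIV) = emeasure (fst_marginal M) A" if "sets M = sets borel" "space M = UNIV" for M :: "(real \<times> real) measure"
      using \<open>A \<in> sets borel\<close> that(2) by (subst emeasure_distr[OF fs(1)[OF that(1)]]) (auto intro!: arg_cong[where f="emeasure M"])
    from this[OF sets sp(1)] this[OF s' sp(2)] show ?thesis by (simp add: m1)
  qed
  have snd_eq: "emeasure \<alpha>' (UNIV \<times> A) = emeasure \<alpha> (UNIV \<times> A)" if "A \<in> sets borel" for A
  proof -
    have "emeasure M (UNIV \<times> A) = emeasure (snd_marginal M) A" if "sets M = sets borel" "space M = UNIV" for M :: "(real \<times> real) measure"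
      using \<open>A \<in> sets borel\<close> that(2) by (subst emeasure_distr[OF fs(2)[OF that(1)]]) (auto intro!: arg_cong[where f="emeasure M"])
    from this[OF sets sp(1)] this[OF s' sp(2)] show ?thesis by (simp add: m2)
  qed
  have fin': "finite_measure \<alpha>'"
  proof
    show "emeasure \<alpha>' (space \<alpha>') \<noteq> \<infinity>"
      using fst_eq[of UNIV] sp \<alpha>.emeasure_finite[of UNIV] by (simp add: UNIV_Times_UNIV)
  qed
  interpret \<alpha>': finite_measure \<alpha>' by fact
  define X where "X = fst ` spt \<alpha>"
  define Y where "Y = snd ` spt \<alpha>"
  have XY: "finite X" "finite Y" and sub: "spt \<alpha> \<subseteq> X \<times> Y" using F by (auto simp: X_def Y_def image_iff) force+
  have bX: "X \<in> sets borel" "- X \<in> sets borel" and bY: "Y \<in> sets borel" "- Y \<in> sets borel"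
    using finite_imp_closed[OF XY(1)] finite_imp_closed[OF XY(2)] by auto
  have rect: "A \<times> B \<in> sets (borel :: (real \<times> real) measure)" if "A \<in> sets borel" "B \<in> sets borel" for A B :: "real set"
    unfolding borel_prod[symmetric] using that by auto
  have spt0: "emeasure \<alpha> (- spt \<alpha>) = 0" by (rule emeasure_compl_spt[OF sets])
  have csp: "- spt \<alpha> \<in> sets \<alpha>" unfolding sets using finite_imp_closed[OF F] by simp
  have zero: "emeasure \<alpha> A = 0" if "A \<inter> spt \<alpha> = {}" for A
    using emeasure_mono[of A "- spt \<alpha>" \<alpha>] that csp spt0 by auto
  have G0: "emeasure \<alpha> (- (X \<times> Y)) = 0" using sub by (intro zero) auto
  have G0': "emeasure \<alpha>' (- (X \<times> Y)) = 0"
  proof -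
    have "emeasure \<alpha>' ((- X) \<times> UNIV) = 0" "emeasure \<alpha>' (UNIV \<times> (- Y)) = 0"
      using fst_eq[OF bX(2)] snd_eq[OF bY(2)] zero[of "(- X) \<times> UNIV"] zero[of "UNIV \<times> (- Y)"] sub by auto
    moreover have "- (X \<times> Y) = ((- X) \<times> UNIV) \<union> (UNIV \<times> (- Y))" by auto
    moreover have "(- X) \<times> UNIV \<in> sets \<alpha>'" "UNIV \<times> (- Y) \<in> sets \<alpha>'" unfolding s' using bX bY by (auto intro: rect)
    ultimately show ?thesis using emeasure_subadditive[of "(- X) \<times> UNIV" \<alpha>' "UNIV \<times> (- Y)"] by simp
  qed
  have fG: "finite (X \<times> Y)" using XY by auto
  note I = finite_support_integral[OF sets fin fG G0]
  note I' = finite_support_integral[OF s' fin' fG G0']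
  have sing: "{t} \<in> sets borel" for t :: real by simp
  have mm: "fst \<in> borel_measurable (borel :: (real \<times> real) measure)" "snd \<in> borel_measurable (borel :: (real \<times> real) measure)"
    by (rule fs[OF refl])+
  have ind: "indicat_real (A \<times> B) \<in> borel_measurable borel" if "A \<in> sets borel" "B \<in> sets borel" for A B :: "real set"
    using rect[OF that] by (rule borel_measurable_indicator)
  define a where "a s t = measure \<alpha> {(s, t)}" for s t
  define a' where "a' s t = measure \<alpha>' {(s, t)}" for s t
  have sumXY: "(\<Sum>z\<in>X \<times> Y. f z) = (\<Sum>s\<in>X. \<Sum>t\<in>Y. f (s, t))" for f :: "real \<times> real \<Rightarrow> real"
    by (simp add: sum.cartesian_product)
  have pick_fst: "(\<Sum>s'\<in>X. \<Sum>t\<in>Y. g s' t * (indicator {s} s' * h t)) = (\<Sum>t\<in>Y. g s t * h t)"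
    if "s \<in> X" for s and g :: "real \<Rightarrow> real \<Rightarrow> real" and h
  proof -
    have "(\<Sum>s'\<in>X. \<Sum>t\<in>Y. g s' t * (indicator {s} s' * h t)) = (\<Sum>s'\<in>X. if s' = s then (\<Sum>t\<in>Y. g s t * h t) else 0)"
      by (intro sum.cong) (auto simp: indicator_def)
    then show ?thesis using that XY by simp
  qed
  have row: "(\<Sum>t\<in>Y. a s t) = (\<Sum>t\<in>Y. a' s t)" if s: "s \<in> X" for s
  proof -
    let ?f = "\<lambda>z :: real \<times> real. indicat_real {s} (fst z) * 1"
    have f: "?f = indicat_real ({s} \<times> UNIV)" by (auto simp: indicator_def)
    have fm: "?f \<in> borel_measurable borel" unfolding f by (rule ind) auto
    have "(\<integral>z. ?f z \<partial>\<alpha>) = (\<integral>z. ?f z \<partial>\<alpha>')"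
      unfolding f using fst_eq[OF sing[of s]] sp by (simp add: measure_def)
    then show ?thesis unfolding I(2)[OF fm] I'(2)[OF fm] sumXY
      using pick_fst[OF s, of a "\<lambda>_. 1"] pick_fst[OF s, of a' "\<lambda>_. 1"] by (simp add: a_def a'_def)
  qed
  have col: "(\<Sum>s\<in>X. a s t) = (\<Sum>s\<in>X. a' s t)" if t: "t \<in> Y" for t
  proof -
    let ?f = "indicat_real ((UNIV :: real set) \<times> {t})"
    have fm: "?f \<in> borel_measurable borel" by (rule ind) auto
    have pick: "(\<Sum>s\<in>X. \<Sum>t'\<in>Y. g s t' * ?f (s, t')) = (\<Sum>s\<in>X. g s t)" for g
    proof (rule sum.cong)
      fix s
      have "(\<Sum>t'\<in>Y. g s t' * ?f (s, t')) = (\<Sum>t'\<in>Y. if t' = t then g s t else 0)"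
        by (intro sum.cong) (auto simp: indicator_def)
      then show "(\<Sum>t'\<in>Y. g s t' * ?f (s, t')) = g s t" using t XY by simp
    qed simp
    have "(\<integral>z. ?f z \<partial>\<alpha>) = (\<integral>z. ?f z \<partial>\<alpha>')"
      using snd_eq[OF sing[of t]] sp by (simp add: measure_def)
    then show ?thesis unfolding I(2)[OF fm] I'(2)[OF fm] sumXY
      using pick[of a] pick[of a'] by (simp add: a_def a'_def)
  qed
  have bary: "(\<Sum>t\<in>Y. a s t * t) = (\<Sum>t\<in>Y. a' s t * t)" if s: "s \<in> X" for s
  proof -
    obtain \<kappa> \<kappa>' where \<kappa>: "disintegration \<alpha> \<kappa>" "disintegration \<alpha>' \<kappa>'"
      and ae: "AE x in fst_marginal \<alpha>. integrable (\<kappa> x) (\<lambda>y. y) \<and> integrable (\<kappa>' x) (\<lambda>y. y) \<and> (\<integral>y. y \<partial>\<kappa> x) = (\<integral>y. y \<partial>\<kappa>' x)"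
      using comp unfolding competitor_def by blast
    note b = disintegration_barycenter[OF sets \<kappa>(1) I(1)[OF mm(2)]]
    note b' = disintegration_barycenter[OF s' \<kappa>(2) I'(1)[OF mm(2)], unfolded m1]
    \<comment> \<open>Restricting to the line over an atom \<open>s\<close> isolates one row: there
      the integral of the second coordinate is the row's unnormalised barycenter.\<close>
    let ?f = "\<lambda>z :: real \<times> real. indicat_real {s} (fst z) * snd z"
    have fm: "?f \<in> borel_measurable borel"
      by (intro borel_measurable_times mm measurable_compose[OF mm(1)]) simp
    have "(\<integral>z. ?f z \<partial>\<alpha>) = (\<integral>z. ?f z \<partial>\<alpha>')"
      unfolding b(3)[OF sing] b'(3)[OF sing]
    proof (rule integral_cong_AE)
      show "AE x in fst_marginal \<alpha>. indicat_real {s} x * (enn2real (\<integral>\<^sup>+y. ennreal y \<partial>\<kappa> x) - enn2real (\<integral>\<^sup>+y. ennreal (- y) \<partial>\<kappa> x)) =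
          indicat_real {s} x * (enn2real (\<integral>\<^sup>+y. ennreal y \<partial>\<kappa>' x) - enn2real (\<integral>\<^sup>+y. ennreal (- y) \<partial>\<kappa>' x))"
        using ae b(2) b'(2) by eventually_elim auto
    qed (intro borel_measurable_times borel_measurable_integrable[OF b(1)] borel_measurable_integrable[OF b'(1)]; simp)+
    then show ?thesis unfolding I(2)[OF fm] I'(2)[OF fm] sumXY
      using pick_fst[OF s, of a "\<lambda>t. t"] pick_fst[OF s, of a' "\<lambda>t. t"] by (simp add: a_def a'_def)
  qed
  have cost: "(\<Sum>s\<in>X. \<Sum>t\<in>Y. a' s t * c (s, t)) < (\<Sum>s\<in>X. \<Sum>t\<in>Y. a s t * c (s, t))"
    using less unfolding ext_integral_integrable[OF I(1)[OF c]] ext_integral_integrable[OF I'(1)[OF c]]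
      I(2)[OF c] I'(2)[OF c] sumXY by (simp add: a_def a'_def)
  obtain x where x: "bij_betw x {0..<card X} X" using ex_bij_betw_nat_finite[OF XY(1)] by blast
  obtain y where y: "bij_betw y {0..<card Y} Y" using ex_bij_betw_nat_finite[OF XY(2)] by blast
  \<comment> \<open>Indices of the points of the support. Since \<open>X\<close> and
    \<open>Y\<close> are its projections, every row and every column contains a point of
    \<open>S\<close>, so the grid spanned by \<open>S\<close> is all of
    \<open>X \<times> Y\<close>.\<close>
  define S where "S = {(i, j). i < card X \<and> j < card Y \<and> (x i, y j) \<in> spt \<alpha>}"
  have S: "finite S" unfolding S_def by (rule finite_subset[of _ "{0..<card X} \<times> {0..<card Y}"]) auto
  have xX: "x i \<in> X" if "i < card X" for i using bij_betwE[OF x] that by auto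
  have yY: "y j \<in> Y" if "j < card Y" for j using bij_betwE[OF y] that by auto
  have invx: "\<exists>i<card X. x i = s" if "s \<in> X" for s using x that unfolding bij_betw_def by force
  have invy: "\<exists>j<card Y. y j = t" if "t \<in> Y" for t using y that unfolding bij_betw_def by force
  have fstS: "fst ` S = {0..<card X}"
  proof (intro equalityI subsetI)
    fix i assume i: "i \<in> {0..<card X}"
    then obtain t where t: "(x i, t) \<in> spt \<alpha>" using xX[of i] unfolding X_def by force
    then have "t \<in> Y" unfolding Y_def by force
    then obtain j where "j < card Y" "y j = t" using invy by blast
    then have "(i, j) \<in> S" using i t by (simp add: S_def)
    then show "i \<in> fst ` S" by force
  qed (auto simp: S_def)
  have sndS: "snd ` S = {0..<card Y}"
  proof (intro equalityI subsetI)
    fix j assume j: "j \<in> {0..<card Y}"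
    then obtain s where s: "(s, y j) \<in> spt \<alpha>" using yY[of j] unfolding Y_def by force
    then have "s \<in> X" unfolding X_def by force
    then obtain i where "i < card X" "x i = s" using invx by blast
    then have "(i, j) \<in> S" using j s by (simp add: S_def)
    then show "j \<in> snd ` S" by force
  qed (auto simp: S_def)
  \<comment> \<open>Division by the total mass makes the weights at most 1, while the other
    conditions are homogeneous. The added 1 keeps the divisor positive for the zero measure as
    well.\<close>
  define K where "K = measure \<alpha> UNIV + 1"
  have K: "0 < K" unfolding K_def by (simp add: add_nonneg_pos)
  define w where "w i j = a (x i) (y j) / K" for i j
  define v where "v i j = a' (x i) (y j) / K" for i j
  have rX: "(\<Sum>i\<in>{0..<card X}. f (x i)) = (\<Sum>s\<in>X. f s)" for f :: "real \<Rightarrow> real"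
    by (rule sum.reindex_bij_betw[OF x])
  have rY: "(\<Sum>j\<in>{0..<card Y}. f (y j)) = (\<Sum>t\<in>Y. f t)" for f :: "real \<Rightarrow> real"
    by (rule sum.reindex_bij_betw[OF y])
  have "improvable c S x y w v"
    unfolding improvable_def fstS sndS
  proof (intro conjI ballI)
    fix i j assume ij: "i \<in> {0..<card X}" "j \<in> {0..<card Y}"
    show "0 \<le> w i j" "0 \<le> v i j" using K by (auto simp: w_def v_def a_def a'_def)
    have "a (x i) (y j) \<le> K" using \<alpha>.bounded_measure[of "{(x i, y j)}"] sp by (simp add: a_def K_def)
    then show "w i j \<le> 1" using K by (simp add: w_def)
    show "(i, j) \<notin> S \<longrightarrow> w i j = 0"
    proof
      assume "(i, j) \<notin> S"
      then have "(x i, y j) \<notin> spt \<alpha>" using ij by (simp add: S_def)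
      then have "emeasure \<alpha> {(x i, y j)} = 0" by (intro zero) auto
      then show "w i j = 0" by (simp add: w_def a_def measure_def)
    qed
  next
    fix i assume "i \<in> {0..<card X}"
    then have xi: "x i \<in> X" using xX by auto
    show "(\<Sum>j\<in>{0..<card Y}. w i j) = (\<Sum>j\<in>{0..<card Y}. v i j)"
      unfolding w_def v_def rY[of "\<lambda>t. a (x i) t / K"] rY[of "\<lambda>t. a' (x i) t / K"]
      by (simp add: sum_divide_distrib[symmetric] row[OF xi])
    show "(\<Sum>j\<in>{0..<card Y}. w i j * y j) = (\<Sum>j\<in>{0..<card Y}. v i j * y j)"
      unfolding w_def v_def rY[of "\<lambda>t. a (x i) t / K * t"] rY[of "\<lambda>t. a' (x i) t / K * t"]
      by (simp add: sum_divide_distrib[symmetric] bary[OF xi])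
  next
    fix j assume "j \<in> {0..<card Y}"
    then have yj: "y j \<in> Y" using yY by auto
    show "(\<Sum>i\<in>{0..<card X}. w i j) = (\<Sum>i\<in>{0..<card X}. v i j)"
      unfolding w_def v_def rX[of "\<lambda>s. a s (y j) / K"] rX[of "\<lambda>s. a' s (y j) / K"]
      by (simp add: sum_divide_distrib[symmetric] col[OF yj])
  next
    have "(\<Sum>i\<in>{0..<card X}. \<Sum>j\<in>{0..<card Y}. b (x i) (y j) / K * c (x i, y j)) = (\<Sum>s\<in>X. \<Sum>t\<in>Y. b s t * c (s, t)) / K" for b
      unfolding rY[of "\<lambda>t. b (x i) t / K * c (x i, t)" for i] rX[of "\<lambda>s. \<Sum>t\<in>Y. b s t / K * c (s, t)"]
      by (simp add: sum_divide_distrib)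
    then show "(\<Sum>i\<in>{0..<card X}. \<Sum>j\<in>{0..<card Y}. v i j * c (x i, y j)) < (\<Sum>i\<in>{0..<card X}. \<Sum>j\<in>{0..<card Y}. w i j * c (x i, y j))"
      unfolding w_def v_def using cost K by (simp add: divide_strict_right_mono)
  qed
  moreover have "\<forall>(i, j)\<in>S. (x i, y j) \<in> spt \<alpha>" by (auto simp: S_def)
  ultimately show ?thesis using S by blast
qed

theorem lemma1p11:
  fixes \<mu> \<nu> :: "real measure"
    and c :: "real \<times> real \<Rightarrow> real"
    and \<pi> :: "(real \<times> real) measure"
  assumes "prob_space \<mu>" and "prob_space \<nu>"
    and "convex_order \<mu> \<nu>"
    and "c \<in> borel_measurable borel"
    and "sufficient_integrability \<mu> \<nu> c"
    and "optimal_martingale_plan \<mu> \<nu> c \<pi>"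
    and "ext_integral \<pi> c < \<infinity>"
  shows "\<exists>\<Gamma>\<in>sets borel. emeasure \<pi> \<Gamma> = 1 \<and>
    (\<forall>\<alpha>::(real \<times> real) measure.
       sets \<alpha> = sets borel \<and> finite_measure \<alpha> \<and> finite (spt \<alpha>) \<and> spt \<alpha> \<subseteq> \<Gamma> \<longrightarrow>
       (\<forall>\<alpha>'. competitor \<alpha> \<alpha>' \<longrightarrow> ext_integral \<alpha> c \<le> ext_integral \<alpha>' c))"
proof -
  have int: "integrable \<mu> (\<lambda>x. x)" "integrable \<nu> (\<lambda>y. y)"
    using \<open>convex_order \<mu> \<nu>\<close> by (auto simp: convex_order_def finite_first_moment_def)
  have sets: "sets \<pi> = sets borel" and marg: "fst_marginal \<pi> = \<mu>"
    using \<open>optimal_martingale_plan \<mu> \<nu> c \<pi>\<close> by (auto simp: optimal_martingale_plan_def martingale_plans_def)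
  have "fst \<in> \<pi> \<rightarrow>\<^sub>M (borel :: real measure)"
    unfolding measurable_cong_sets[OF sets refl] borel_prod[symmetric] by auto
  then have "prob_space \<pi>"
    using \<open>prob_space \<mu>\<close> unfolding marg[symmetric] by (rule prob_space_distrD)
  then interpret prob_space \<pi> .
  have sp: "space \<pi> = UNIV" using sets_eq_imp_space_eq[OF sets] by simp
  let ?\<S> = "{S :: (nat \<times> nat) set. finite S}"
  define Q where "Q S N \<longleftrightarrow> N \<in> sets borel \<and> emeasure \<pi> N = 0 \<and>
      (\<forall>x y w v. improvable c S x y w v \<longrightarrow> (\<exists>(i, j)\<in>S. (x i, y j) \<in> N))" for S N
  have "\<exists>N. Q S N" if "finite S" for S
    using improvable_null_cover[OF assms(1) int assms(4-7) finite_measure_axioms sets that]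
    unfolding Q_def Bex_def .
  then obtain N where QN: "\<And>S. finite S \<Longrightarrow> Q S (N S)" by metis
  have N: "N S \<in> sets borel" "emeasure \<pi> (N S) = 0" if "finite S" for S
    using QN[OF that] by (auto simp: Q_def)
  have N_cover: "\<exists>(i, j)\<in>S. (x i, y j) \<in> N S" if "finite S" "improvable c S x y w v" for S x y w v
    using QN[OF that(1)] that(2) unfolding Q_def by blast
  have count: "countable ?\<S>" by (rule countable_Collect_finite)
  have null: "(\<Union>S\<in>?\<S>. N S) \<in> null_sets \<pi>"
  proof (rule null_sets_UN'[OF count])
    fix S assume "S \<in> ?\<S>"
    then show "N S \<in> null_sets \<pi>" using N[of S] sets by (intro null_setsI) simp_all
  qed
  define \<Gamma> where "\<Gamma> = - (\<Union>S\<in>?\<S>. N S)"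
  show ?thesis
  proof (intro bexI[of _ \<Gamma>] conjI allI impI)
    have "(\<Union>S\<in>?\<S>. N S) \<in> sets borel" using null_setsD2[OF null] unfolding sets .
    then show "\<Gamma> \<in> sets borel" unfolding \<Gamma>_def by (rule borel_comp)
    have "emeasure \<pi> \<Gamma> = emeasure \<pi> (space \<pi> - (\<Union>S\<in>?\<S>. N S))"
      unfolding \<Gamma>_def sp Compl_eq_Diff_UNIV ..
    also have "\<dots> = emeasure \<pi> (space \<pi>)" by (rule emeasure_Diff_null_set[OF null]) (rule sets.top)
    finally show "emeasure \<pi> \<Gamma> = 1" unfolding emeasure_space_1 .
    fix \<alpha> \<alpha>' :: "(real \<times> real) measure"
    assume \<alpha>: "sets \<alpha> = sets borel \<and> finite_measure \<alpha> \<and> finite (spt \<alpha>) \<and> spt \<alpha> \<subseteq> \<Gamma>" and comp: "competitor \<alpha> \<alpha>'"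
    then have \<alpha>': "sets \<alpha> = sets borel" "finite_measure \<alpha>" "finite (spt \<alpha>)" "spt \<alpha> \<subseteq> \<Gamma>" by blast+
    show "ext_integral \<alpha> c \<le> ext_integral \<alpha>' c"
    proof (rule ccontr)
      assume "\<not> ?thesis"
      then have "ext_integral \<alpha>' c < ext_integral \<alpha> c" by simp
      from competitor_improvable[OF assms(4) \<alpha>'(1-3) comp this]
      obtain S x y w v where S: "finite S" "improvable c S x y w v" "\<forall>(i, j)\<in>S. (x i, y j) \<in> spt \<alpha>"
        by blast
      then obtain i j where ij: "(i, j) \<in> S" "(x i, y j) \<in> N S" using N_cover[OF S(1,2)] by blast
      then have "(x i, y j) \<in> \<Gamma>" using S(3) \<alpha>'(4) by blast
      then show False using ij(2) S(1) unfolding \<Gamma>_def by blast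
    qed
  qed
qed

end
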